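(* Let $G$ be a real reductive group and let $\rho\colon SL(2,\mathbb{R})\to G$ be a Lie group homomorphism corresponding to an even real nilpotent orbit. Then there exists an integer $g_0\ge 2$ such that for every $g\ge g_0$ and every discrete subgroup $\Gamma_g$ of $SL(2,\mathbb{R})$ isomorphic to the fundamental group $\pi_1(\Sigma_g)$ of a closed oriented surface of genus $g$, every neighborhood of $\rho|_{\Gamma_g}$ in $\mathrm{Hom}(\Gamma_g,G)$ contains a representation $\rho'$ such that $\rho'(\Gamma_g)$ is Zariski-dense in $G$.
   Context: A real reductive group is a (Euclidean) open subgroup $G$ of $\mathbf{G}(\mathbb{R})$, where $\mathbf{G}$ is a connected reductive linear algebraic group defined over $\mathbb{R}$. The Zariski topology on $G$ is the one induced from the Zariski topology of $\mathbf{G}(\mathbb{C})$. $\mathrm{Hom}(\Gamma_g,G)$ carries the topology of pointwise convergence. Let $\mathfrak{g}$ be the Lie algebra of $G$. By the Jacobson--Morozov theorem, $\rho$ corresponds to the real nilpotent adjoint orbit in $\mathfrak{g}$ through $d\rho\begin{pmatrix}0&1\\0&0\end{pmatrix}$. A real nilpotent orbit in $\mathfrak{g}$ is called even if its complexification is an even complex nilpotent orbit in $\mathfrak{g}\otimes\mathbb{C}$; for the orbit corresponding to $\rho$ this means that all eigenvalues of $\mathrm{ad}(d\rho(A_0))$ on $\mathfrak{g}$ are even integers, where $A_0=\begin{pmatrix}1&0\\0&-1\end{pmatrix}$. *)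

theory Defs
  imports "HOL-Analysis.Analysis" "HOL-Algebra.Coset"
begin

definition GL :: "('a::field ^ 'n ^ 'n) monoid" where
  "GL = \<lparr>carrier = {A. invertible A}, mult = (**), one = mat 1\<rparr>"

definition SL2R :: "(real ^ 2 ^ 2) monoid" where
  "SL2R = \<lparr>carrier = {A. det A = 1}, mult = (**), one = mat 1\<rparr>"

definition mat_pow :: "'a::comm_ring_1 ^ 'n ^ 'n \<Rightarrow> nat \<Rightarrow> 'a ^ 'n ^ 'n" where
  "mat_pow A k = (((**) A) ^^ k) (mat 1)"

definition mat_exp :: "real ^ 'n ^ 'n \<Rightarrow> real ^ 'n ^ 'n" where
  "mat_exp A = (\<Sum>k. (1 / fact k) *\<^sub>R mat_pow A k)"

definition commutator :: "'a::comm_ring_1 ^ 'n ^ 'n \<Rightarrow> 'a ^ 'n ^ 'n \<Rightarrow> 'a ^ 'n ^ 'n" where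
  "commutator A B = A ** B - B ** A"

definition unipotent :: "complex ^ 'n ^ 'n \<Rightarrow> bool" where
  "unipotent A \<longleftrightarrow> (\<exists>k. mat_pow (A - mat 1) k = 0)"

lemma group_GL: "group (GL :: ('a::field ^ 'n ^ 'n) monoid)"
proof (rule groupI)
  fix A :: "'a ^ 'n ^ 'n"
  assume "A \<in> carrier GL"
  then obtain B where "A ** B = mat 1" "B ** A = mat 1"
    by (auto simp: GL_def invertible_def)
  then show "\<exists>B\<in>carrier GL. B \<otimes>\<^bsub>GL\<^esub> A = \<one>\<^bsub>GL\<^esub>"
    by (auto simp: GL_def invertible_def)
next
  show "\<one>\<^bsub>GL\<^esub> \<in> carrier (GL :: ('a ^ 'n ^ 'n) monoid)"
    by (auto simp: GL_def invertible_def intro: exI[of _ "mat 1"])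
qed (auto simp: GL_def invertible_mult matrix_mul_assoc)

lemma group_SL2R: "group SL2R"
proof (rule groupI)
  fix A :: "real ^ 2 ^ 2"
  assume "A \<in> carrier SL2R"
  then have A: "det A = 1" by (simp add: SL2R_def)
  then have "invertible A" by (simp add: invertible_det_nz)
  then obtain B where B: "B ** A = mat 1" by (auto simp: invertible_def)
  then have "det B * det A = 1" by (metis det_I det_mul)
  with A B show "\<exists>B\<in>carrier SL2R. B \<otimes>\<^bsub>SL2R\<^esub> A = \<one>\<^bsub>SL2R\<^esub>"
    by (auto simp: SL2R_def)
qed (auto simp: SL2R_def det_mul matrix_mul_assoc)

inductive_set poly_fun :: "complex set \<Rightarrow> (complex ^ 'n ^ 'n \<Rightarrow> complex) set"
  for K :: "complex set" where
  const: "c \<in> K \<Longrightarrow> (\<lambda>_. c) \<in> poly_fun K"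
| entry: "(\<lambda>A. A $ i $ j) \<in> poly_fun K"
| add: "p \<in> poly_fun K \<Longrightarrow> q \<in> poly_fun K \<Longrightarrow> (\<lambda>A. p A + q A) \<in> poly_fun K"
| mult: "p \<in> poly_fun K \<Longrightarrow> q \<in> poly_fun K \<Longrightarrow> (\<lambda>A. p A * q A) \<in> poly_fun K"

definition zariski :: "(complex ^ 'n ^ 'n) topology" where
  "zariski = topology (\<lambda>U. \<exists>P \<subseteq> poly_fun UNIV. U = {A. \<exists>p\<in>P. p A \<noteq> 0})"

lemma openin_zariski:
  fixes U :: "(complex ^ 'n ^ 'n) set"
  shows "openin zariski U \<longleftrightarrow> (\<exists>P \<subseteq> poly_fun UNIV. U = {A. \<exists>p\<in>P. p A \<noteq> 0})"
proof -
  have "istopology (\<lambda>U. \<exists>P \<subseteq> poly_fun UNIV. U = {A::complex ^ 'n ^ 'n. \<exists>p\<in>P. p A \<noteq> 0})"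
    (is "istopology ?op")
    unfolding istopology_def
  proof (intro conjI allI impI)
    fix S T :: "(complex ^ 'n ^ 'n) set"
    assume "?op S" "?op T"
    then obtain P Q where P: "P \<subseteq> poly_fun UNIV" "S = {A. \<exists>p\<in>P. p A \<noteq> 0}"
      and Q: "Q \<subseteq> poly_fun UNIV" "T = {A. \<exists>p\<in>Q. p A \<noteq> 0}"
      by blast
    show "?op (S \<inter> T)"
    proof (intro exI conjI)
      show "(\<lambda>(p, q) A. p A * q A) ` (P \<times> Q) \<subseteq> poly_fun UNIV"
        using P Q by (auto intro!: poly_fun.mult)
      show "S \<inter> T = {A. \<exists>p\<in>(\<lambda>(p, q) A. p A * q A) ` (P \<times> Q). p A \<noteq> 0}"
        unfolding P Q by (auto 4 4)
    qed
  next
    fix \<K> :: "(complex ^ 'n ^ 'n) set set"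
    assume op: "\<forall>K\<in>\<K>. ?op K"
    let ?P = "{p \<in> poly_fun UNIV. {A. p A \<noteq> 0} \<subseteq> \<Union>\<K>}"
    have "A \<in> {A. \<exists>p\<in>?P. p A \<noteq> 0}" if A: "A \<in> K" and K: "K \<in> \<K>" for A K
    proof -
      obtain P where P: "P \<subseteq> poly_fun UNIV" "K = {A. \<exists>p\<in>P. p A \<noteq> 0}"
        using op K by blast
      then obtain p where p: "p \<in> P" "p A \<noteq> 0" using A by blast
      then have "{A. p A \<noteq> 0} \<subseteq> K" using P(2) by blast
      then show ?thesis using p P(1) K by blast
    qed
    then have "\<Union>\<K> = {A. \<exists>p\<in>?P. p A \<noteq> 0}" by blast
    then show "?op (\<Union>\<K>)" by (intro exI[of _ ?P] conjI) auto
  qed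
  then show ?thesis by (simp add: zariski_def)
qed

lemma topspace_zariski [simp]: "topspace (zariski :: (complex ^ 'n ^ 'n) topology) = UNIV"
proof -
  have "openin zariski (UNIV :: (complex ^ 'n ^ 'n) set)"
    unfolding openin_zariski
    by (rule exI[of _ "{\<lambda>_. 1}"]) (auto intro: poly_fun.const)
  then show ?thesis by (meson openin_subset top.extremum_uniqueI)
qed

definition linear_algebraic_group :: "(complex ^ 'n ^ 'n) set \<Rightarrow> bool" where
  "linear_algebraic_group H \<longleftrightarrow>
     subgroup H GL \<and> closedin (subtopology zariski (carrier GL)) H"

text \<open>The vanishing ideal of \<open>H\<close> is generated by its real elements; since \<open>\<complex> = \<real> \<oplus> \<i>\<real>\<close>,
  the ideal of \<open>\<complex>[x\<^sub>i\<^sub>j]\<close> generated by an ideal \<open>J\<close> of \<open>\<real>[x\<^sub>i\<^sub>j]\<close> is \<open>J + \<i>J\<close>.\<close>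

definition defined_over_reals :: "(complex ^ 'n ^ 'n) set \<Rightarrow> bool" where
  "defined_over_reals H \<longleftrightarrow>
     (\<forall>p \<in> poly_fun UNIV. (\<forall>A\<in>H. p A = 0) \<longrightarrow>
        (\<exists>q \<in> poly_fun \<real>. \<exists>r \<in> poly_fun \<real>. (\<forall>A\<in>H. q A = 0) \<and> (\<forall>A\<in>H. r A = 0) \<and>
           p = (\<lambda>A. q A + \<i> * r A)))"

text \<open>The unipotent radical, i.e. the largest closed connected normal unipotent subgroup, is trivial.\<close>

definition reductive :: "(complex ^ 'n ^ 'n) set \<Rightarrow> bool" where
  "reductive H \<longleftrightarrow>
     (\<forall>N. N \<lhd> GL\<lparr>carrier := H\<rparr> \<and> linear_algebraic_group N \<and> connectedin zariski N \<and>
          (\<forall>A\<in>N. unipotent A) \<longrightarrow> N = {mat 1})"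

definition real_points :: "(complex ^ 'n ^ 'n) set \<Rightarrow> (real ^ 'n ^ 'n) set" where
  "real_points H = {A. map_matrix complex_of_real A \<in> H}"

definition real_reductive_group :: "(real ^ 'n ^ 'n) set \<Rightarrow> bool" where
  "real_reductive_group G \<longleftrightarrow>
     (\<exists>H. linear_algebraic_group H \<and> connectedin zariski H \<and> reductive H \<and>
          defined_over_reals H \<and> subgroup G GL \<and> openin (top_of_set (real_points H)) G)"

definition zariski_dense_in :: "(real ^ 'n ^ 'n) set \<Rightarrow> (real ^ 'n ^ 'n) set \<Rightarrow> bool" where
  "zariski_dense_in G S \<longleftrightarrow>
     S \<subseteq> G \<and> pullback_topology G (map_matrix complex_of_real) zariski closure_of S = G"

primrec Ck_on :: "nat \<Rightarrow> 'a::real_normed_vector set \<Rightarrow> ('a \<Rightarrow> 'b::real_normed_vector) \<Rightarrow> bool" where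
  "Ck_on 0 U f \<longleftrightarrow> continuous_on U f"
| "Ck_on (Suc k) U f \<longleftrightarrow>
     f differentiable_on U \<and> (\<forall>v. Ck_on k U (\<lambda>x. frechet_derivative f (at x) v))"

text \<open>Smoothness on a subset: local extendability to smooth maps on open sets of the ambient
  space. For the embedded submanifold \<open>SL(2,\<real>)\<close> this is smoothness as a map of manifolds.\<close>

definition smooth_map_on :: "'a::real_normed_vector set \<Rightarrow> ('a \<Rightarrow> 'b::real_normed_vector) \<Rightarrow> bool" where
  "smooth_map_on S f \<longleftrightarrow>
     (\<forall>x\<in>S. \<exists>U F. open U \<and> x \<in> U \<and> (\<forall>k. Ck_on k U F) \<and> (\<forall>y \<in> U \<inter> S. F y = f y))"

definition lie_group_hom_SL2R :: "(real ^ 'n ^ 'n) set \<Rightarrow> (real ^ 2 ^ 2 \<Rightarrow> real ^ 'n ^ 'n) \<Rightarrow> bool" where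
  "lie_group_hom_SL2R G \<rho> \<longleftrightarrow>
     \<rho> \<in> hom SL2R (GL\<lparr>carrier := G\<rparr>) \<and> smooth_map_on (carrier SL2R) \<rho>"

definition lie_algebra :: "(real ^ 'n ^ 'n) set \<Rightarrow> (real ^ 'n ^ 'n) set" where
  "lie_algebra G = {X. \<forall>t. mat_exp (t *\<^sub>R X) \<in> G}"

definition complexified_lie_algebra :: "(real ^ 'n ^ 'n) set \<Rightarrow> (complex ^ 'n ^ 'n) set" where
  "complexified_lie_algebra G =
     {Z. map_matrix Re Z \<in> lie_algebra G \<and> map_matrix Im Z \<in> lie_algebra G}"

definition differential :: "(real ^ 2 ^ 2 \<Rightarrow> real ^ 'n ^ 'n) \<Rightarrow> real ^ 2 ^ 2 \<Rightarrow> real ^ 'n ^ 'n" where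
  "differential \<rho> X = vector_derivative (\<lambda>t. \<rho> (mat_exp (t *\<^sub>R X))) (at 0)"

definition A0 :: "real ^ 2 ^ 2" where
  "A0 = vector [vector [1, 0], vector [0, -1]]"

text \<open>The nilpotent orbit through the image of the upper triangular nilpotent element is even:
  all (complex) eigenvalues of \<open>ad (d\<rho> A\<^sub>0)\<close> on the Lie algebra are even integers.\<close>

definition even_nilpotent_hom :: "(real ^ 'n ^ 'n) set \<Rightarrow> (real ^ 2 ^ 2 \<Rightarrow> real ^ 'n ^ 'n) \<Rightarrow> bool" where
  "even_nilpotent_hom G \<rho> \<longleftrightarrow>
     (\<forall>c. \<forall>Z \<in> complexified_lie_algebra G.
        Z \<noteq> 0 \<and>
        commutator (map_matrix complex_of_real (differential \<rho> A0)) Z = map_matrix ((*) c) Z \<longrightarrow>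
        (\<exists>m::int. c = of_int (2 * m)))"

text \<open>The fundamental group of the closed oriented surface of genus \<open>g\<close>, by its standard
  presentation with generators \<open>a\<^sub>i, b\<^sub>i\<close> for \<open>i < g\<close> and the single relator
  \<open>[a\<^sub>0,b\<^sub>0] \<cdots> [a\<^sub>g\<^sub>-\<^sub>1,b\<^sub>g\<^sub>-\<^sub>1]\<close>. The letter \<open>(2i, True)\<close> stands for \<open>a\<^sub>i\<close>, \<open>(2i+1, True)\<close> for \<open>b\<^sub>i\<close>,
  and \<open>False\<close> marks the inverse.\<close>

type_synonym word = "(nat \<times> bool) list"

definition surface_words :: "nat \<Rightarrow> word set" where
  "surface_words g = lists ({..<2 * g} \<times> UNIV)"

definition surface_relator :: "nat \<Rightarrow> word" where
  "surface_relator g =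
     concat (map (\<lambda>i. [(2*i, True), (2*i+1, True), (2*i, False), (2*i+1, False)]) [0..<g])"

inductive_set surface_rel :: "nat \<Rightarrow> (word \<times> word) set" for g :: nat where
  refl: "w \<in> surface_words g \<Longrightarrow> (w, w) \<in> surface_rel g"
| sym: "(v, w) \<in> surface_rel g \<Longrightarrow> (w, v) \<in> surface_rel g"
| trans: "(u, v) \<in> surface_rel g \<Longrightarrow> (v, w) \<in> surface_rel g \<Longrightarrow> (u, w) \<in> surface_rel g"
| cancel: "u \<in> surface_words g \<Longrightarrow> v \<in> surface_words g \<Longrightarrow> k < 2 * g \<Longrightarrow>
    (u @ [(k, s), (k, \<not> s)] @ v, u @ v) \<in> surface_rel g"
| relator: "u \<in> surface_words g \<Longrightarrow> v \<in> surface_words g \<Longrightarrow>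
    (u @ surface_relator g @ v, u @ v) \<in> surface_rel g"

definition surface_group :: "nat \<Rightarrow> word set monoid" where
  "surface_group g =
     \<lparr>carrier = surface_words g // surface_rel g,
      mult = (\<lambda>U V. \<Union>u\<in>U. \<Union>v\<in>V. surface_rel g `` {u @ v}),
      one = surface_rel g `` {[]}\<rparr>"

lemma surface_relator_in_words: "surface_relator g \<in> surface_words g"
  by (auto simp: surface_relator_def surface_words_def)

lemma surface_rel_words: "surface_rel g \<subseteq> surface_words g \<times> surface_words g"
proof (rule subrelI)
  fix v w assume "(v, w) \<in> surface_rel g"
  then show "(v, w) \<in> surface_words g \<times> surface_words g"
    by (induction rule: surface_rel.induct)
      (use surface_relator_in_words[of g] in \<open>auto simp: surface_words_def\<close>)
qed

lemma equiv_surface_rel: "equiv (surface_words g) (surface_rel g)"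
proof (rule equivI)
  show "surface_rel g \<subseteq> surface_words g \<times> surface_words g"
    by (rule surface_rel_words)
  show "refl_on (surface_words g) (surface_rel g)"
    by (rule refl_onI) (rule surface_rel.refl)
  show "sym (surface_rel g)"
    by (rule symI) (rule surface_rel.sym)
  show "trans (surface_rel g)"
    by (rule transI) (rule surface_rel.trans)
qed

lemma surface_rel_append:
  assumes "(u, u') \<in> surface_rel g" "x \<in> surface_words g" "y \<in> surface_words g"
  shows "(x @ u @ y, x @ u' @ y) \<in> surface_rel g"
  using assms
proof (induction rule: surface_rel.induct)
  case (refl w)
  then show ?case by (intro surface_rel.refl) (auto simp: surface_words_def)
next
  case (cancel u v k s)
  then have "((x @ u) @ [(k, s), (k, \<not> s)] @ (v @ y), (x @ u) @ (v @ y)) \<in> surface_rel g"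
    by (intro surface_rel.cancel) (auto simp: surface_words_def)
  then show ?case by simp
next
  case (relator u v)
  then have "((x @ u) @ surface_relator g @ (v @ y), (x @ u) @ (v @ y)) \<in> surface_rel g"
    by (intro surface_rel.relator) (auto simp: surface_words_def)
  then show ?case by simp
next
  case (sym v w)
  then show ?case by (simp add: surface_rel.sym)
next
  case (trans u v w)
  then show ?case by (meson surface_rel.trans)
qed

lemma surface_rel_append2:
  assumes "(u, u') \<in> surface_rel g" "(v, v') \<in> surface_rel g"
  shows "(u @ v, u' @ v') \<in> surface_rel g"
proof -
  have m: "u' \<in> surface_words g" "v \<in> surface_words g" "[] \<in> surface_words g"
    using surface_rel_words[of g] assms by (auto simp: surface_words_def)
  show ?thesis
    using surface_rel_append[OF assms(1) m(3) m(2)] surface_rel_append[OF assms(2) m(1) m(3)]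
    by simp (rule surface_rel.trans)
qed

lemma surface_group_mult_class:
  assumes "u \<in> surface_words g" "v \<in> surface_words g"
  shows "surface_rel g `` {u} \<otimes>\<^bsub>surface_group g\<^esub> surface_rel g `` {v} = surface_rel g `` {u @ v}"
proof -
  have "(\<lambda>u v. surface_rel g `` {u @ v}) respects2 surface_rel g"
    by (intro congruent2I' equiv_class_eq[OF equiv_surface_rel] surface_rel_append2)
  from UN_equiv_class2[OF equiv_surface_rel equiv_surface_rel this assms]
  show ?thesis by (simp add: surface_group_def)
qed

lemma surface_rel_inverse:
  "w \<in> surface_words g \<Longrightarrow> \<exists>w'\<in>surface_words g. (w' @ w, []) \<in> surface_rel g"
proof (induction w)
  case Nil
  then show ?case by (intro bexI[of _ "[]"]) (auto intro: surface_rel.refl)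
next
  case (Cons x w)
  obtain k s where x: "x = (k, s)" by (cases x)
  have k: "k < 2 * g" and w: "w \<in> surface_words g"
    using Cons.prems by (auto simp: surface_words_def x)
  obtain w' where w': "w' \<in> surface_words g" "(w' @ w, []) \<in> surface_rel g"
    using Cons.IH w by blast
  have "(w' @ [(k, \<not> s), (k, \<not> \<not> s)] @ w, w' @ w) \<in> surface_rel g"
    using w w' k by (intro surface_rel.cancel)
  then have "((w' @ [(k, \<not> s)]) @ x # w, []) \<in> surface_rel g"
    using surface_rel.trans[OF _ w'(2)] by (simp add: x)
  moreover have "w' @ [(k, \<not> s)] \<in> surface_words g"
    using w' k by (auto simp: surface_words_def)
  ultimately show ?case by blast
qed

lemma group_surface_group: "group (surface_group g)"
proof -
  have car: "U \<in> carrier (surface_group g) \<longleftrightarrow> (\<exists>u\<in>surface_words g. U = surface_rel g `` {u})" for U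
    by (auto simp: surface_group_def quotient_def)
  have one: "\<one>\<^bsub>surface_group g\<^esub> = surface_rel g `` {[]}"
    by (simp add: surface_group_def)
  have app: "u @ v \<in> surface_words g" if "u \<in> surface_words g" "v \<in> surface_words g" for u v
    using that by (auto simp: surface_words_def)
  have nil: "[] \<in> surface_words g" by (simp add: surface_words_def)
  show ?thesis
  proof (rule groupI)
    fix U assume "U \<in> carrier (surface_group g)"
    then obtain u where u: "u \<in> surface_words g" "U = surface_rel g `` {u}" by (auto simp: car)
    obtain w where w: "w \<in> surface_words g" "(w @ u, []) \<in> surface_rel g"
      using surface_rel_inverse[OF u(1)] by blast
    have "surface_rel g `` {w} \<otimes>\<^bsub>surface_group g\<^esub> U = \<one>\<^bsub>surface_group g\<^esub>"
      using equiv_class_eq[OF equiv_surface_rel w(2)] u w by (simp add: one surface_group_mult_class)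
    moreover have "surface_rel g `` {w} \<in> carrier (surface_group g)"
      using w(1) car by blast
    ultimately show "\<exists>V\<in>carrier (surface_group g). V \<otimes>\<^bsub>surface_group g\<^esub> U = \<one>\<^bsub>surface_group g\<^esub>"
      by blast
  qed (auto simp: car one surface_group_mult_class app nil)
qed

text \<open>Representations are extensional functions, so the topology of pointwise convergence is
  induced from the product topology on \<open>G\<^sup>\<Gamma>\<close>.\<close>

definition Hom_space ::
    "(real ^ 2 ^ 2) set \<Rightarrow> (real ^ 'n ^ 'n) set \<Rightarrow> (real ^ 2 ^ 2 \<Rightarrow> real ^ 'n ^ 'n) topology" where
  "Hom_space \<Gamma> G =
     subtopology (product_topology (\<lambda>_. top_of_set G) \<Gamma>)
       (hom (SL2R\<lparr>carrier := \<Gamma>\<rparr>) (GL\<lparr>carrier := G\<rparr>))"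

lemma topspace_Hom_space:
  "topspace (Hom_space \<Gamma> G) =
     hom (SL2R\<lparr>carrier := \<Gamma>\<rparr>) (GL\<lparr>carrier := G\<rparr>) \<inter> extensional \<Gamma>"
  by (auto simp: Hom_space_def PiE_def hom_def)

lemma restrict_in_Hom_space:
  assumes "lie_group_hom_SL2R G \<rho>" "subgroup \<Gamma> SL2R"
  shows "restrict \<rho> \<Gamma> \<in> topspace (Hom_space \<Gamma> G)"
proof -
  have "\<Gamma> \<subseteq> carrier SL2R" "\<And>x y. x \<in> \<Gamma> \<Longrightarrow> y \<in> \<Gamma> \<Longrightarrow> x \<otimes>\<^bsub>SL2R\<^esub> y \<in> \<Gamma>"
    using assms(2) by (auto simp: subgroup_def)
  with assms(1) show ?thesis
    by (auto simp: topspace_Hom_space lie_group_hom_SL2R_def hom_def Pi_iff subset_iff)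
qed

end

theory Submission
  imports Defs "HOL-Library.Function_Algebras" "HOL-Complex_Analysis.Cauchy_Integral_Formula"
begin

text \<open>
  Let \<open>a\<^sub>i, b\<^sub>i\<close> be the standard generators of \<open>\<Gamma>\<close>. If \<open>z\<^sub>i\<close> in the Lie algebra of \<open>G\<close> commutes with
  \<open>\<rho>(a\<^sub>i)\<close>, then \<open>[\<rho>(a\<^sub>i), \<rho>(b\<^sub>i) exp(\<epsilon> z\<^sub>i)] = [\<rho>(a\<^sub>i), \<rho>(b\<^sub>i)]\<close>, so replacing \<open>\<rho>(b\<^sub>i)\<close> by
  \<open>\<rho>(b\<^sub>i) exp(\<epsilon> z\<^sub>i)\<close> is again a representation, close to \<open>\<rho>\<close> for small \<open>\<epsilon>\<close>. Leaving the first handle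
  unchanged, the Zariski closure contains \<open>\<rho>(SL(2,\<real>))\<close>, because \<open>a\<^sub>0\<close> and \<open>b\<^sub>0\<close> do not generate a
  metabelian group; hence it contains every \<open>exp(\<epsilon> z\<^sub>i)\<close>. Each \<open>a\<^sub>i\<close> has infinite order in a discrete
  group, so it is conjugate to a diagonal matrix or, up to sign, to a unipotent one. As all weights
  are even, the centralizer of \<open>\<rho>(a\<^sub>i)\<close> contains a conjugate of the zero weight space, respectively
  of the highest weight vectors, and either of these generates the Lie algebra as an \<open>sl(2)\<close>-module.
  With sufficiently many handles the Lie algebra of the Zariski closure is therefore everything.
  Finally, a Zariski-closed subgroup of a Zariski-connected algebraic group with the same tangent
  space at the identity is Zariski-open by Krull's intersection theorem, hence the whole group.
\<close>

section \<open>Noetherian subrings\<close>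

text \<open>Bending a handle yields single elements \<open>exp(\<epsilon> z)\<close>, not
  one-parameter groups: if \<open>z\<close> generates a compact group, all powers of
  \<open>exp(\<epsilon> z)\<close> may form a finite group. So every basis vector of a centralizer
  is spent on two handles, with bending amounts in an irrational ratio. Counting gives the bound on
  the genus: at most \<open>DIM\<close> basis vectors, two handles for each, twice that because
  hyperbolic and parabolic handles start from different subspaces and only one type is certain to be
  frequent, and one handle left unbent. Evenness enters twice. The zero weight space can only
  generate even weights, and a parabolic generator may carry the sign -1, whose image has to act
  trivially on the Lie algebra. Treating parabolic generators alongside hyperbolic ones spares a
  proof that the discrete group is cocompact. Zariski closures are reached from powers of one matrix
  because a Laurent polynomial is determined by its values on an infinite set. The comparison of two
  groups with equal tangent spaces goes through ideals and Noetherian rings instead of dimension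
  theory, which is why Hilbert's basis theorem comes first.\<close>

definition is_subring :: "'a::comm_ring_1 set \<Rightarrow> bool" where
  "is_subring R \<longleftrightarrow> 0 \<in> R \<and> 1 \<in> R \<and> (\<forall>x\<in>R. \<forall>y\<in>R. x + y \<in> R \<and> x * y \<in> R) \<and> (\<forall>x\<in>R. - x \<in> R)"

lemma is_subringD:
  assumes "is_subring R"
  shows "0 \<in> R" "1 \<in> R" "x \<in> R \<Longrightarrow> y \<in> R \<Longrightarrow> x + y \<in> R" "x \<in> R \<Longrightarrow> y \<in> R \<Longrightarrow> x * y \<in> R"
    "x \<in> R \<Longrightarrow> - x \<in> R"
  using assms by (auto simp: is_subring_def)

lemma is_subring_power: "is_subring R \<Longrightarrow> x \<in> R \<Longrightarrow> x ^ n \<in> R"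
  by (induction n) (auto simp: is_subringD)

text \<open>Rings are subsets of a type here, so the generated ideal is the \<open>R\<close>-span of
  \<open>S\<close>. Adding one multiple of one generator at a time leaves inductions a single case
  to treat.\<close>

inductive_set idl :: "'a::comm_ring_1 set \<Rightarrow> 'a set \<Rightarrow> 'a set" for R S where
  zero: "0 \<in> idl R S"
| step: "x \<in> idl R S \<Longrightarrow> c \<in> R \<Longrightarrow> s \<in> S \<Longrightarrow> x + c * s \<in> idl R S"

lemma idl_add: "x \<in> idl R S \<Longrightarrow> y \<in> idl R S \<Longrightarrow> x + y \<in> idl R S"
proof (induction x rule: idl.induct)
  case (step x c s)
  then have "(x + y) + c * s \<in> idl R S" by (intro idl.step)
  then show ?case by (simp add: algebra_simps)
qed simp

lemma idl_mult:
  assumes "is_subring R" "y \<in> R" shows "x \<in> idl R S \<Longrightarrow> y * x \<in> idl R S"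
proof (induction x rule: idl.induct)
  case (step x c s)
  then have "y * x + (y * c) * s \<in> idl R S" using assms by (intro idl.step) (auto simp: is_subringD)
  then show ?case by (simp add: algebra_simps)
qed (simp add: idl.zero)

lemma idl_uminus: "is_subring R \<Longrightarrow> x \<in> idl R S \<Longrightarrow> - x \<in> idl R S"
  using idl_mult[of R "-1" x S] by (auto simp: is_subringD)

lemma idl_base: "is_subring R \<Longrightarrow> s \<in> S \<Longrightarrow> s \<in> idl R S"
  using idl.step[OF idl.zero, of 1 R s S] by (auto simp: is_subringD)

lemma idl_least:
  assumes "is_subring R" "S \<subseteq> idl R T" "x \<in> idl R S"
  shows "x \<in> idl R T"
  using assms(3) by induction (use assms in \<open>auto intro!: idl_add idl_mult idl.zero\<close>)

lemma idl_mono: "x \<in> idl R S \<Longrightarrow> S \<subseteq> T \<Longrightarrow> x \<in> idl R T"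
  by (induction rule: idl.induct) (auto intro: idl.intros)

lemma idl_finite: "x \<in> idl R (range g) \<Longrightarrow> \<exists>K::nat. x \<in> idl R (g ` {..<K})"
proof (induction rule: idl.induct)
  case (step x c s)
  then obtain K m where K: "x \<in> idl R (g ` {..<K})" and m: "s = g m" by auto
  have "x \<in> idl R (g ` {..<max K (Suc m)})" by (rule idl_mono[OF K]) auto
  then have "x + c * s \<in> idl R (g ` {..<max K (Suc m)})"
    using step m by (intro idl.step) auto
  then show ?case by blast
qed (auto intro: idl.zero)

text \<open>The ascending chain condition, phrased for sequences of elements: no sequence can leave,
  at every index, the ideal of its predecessors. Both the basis theorem and Krull's argument use it
  in this shape.\<close>

definition noeth :: "'a::comm_ring_1 set \<Rightarrow> bool" where
  "noeth R \<longleftrightarrow> (\<forall>f::nat \<Rightarrow> 'a. range f \<subseteq> R \<longrightarrow> (\<exists>K. f K \<in> idl R (f ` {..<K})))"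

text \<open>As \<open>x\<close> may be algebraic over \<open>R\<close>, elements have no degree of
  their own; this is the set of elements that admit some expression of degree below
  \<open>d\<close>.\<close>

primrec deglt :: "'a::comm_ring_1 set \<Rightarrow> 'a \<Rightarrow> nat \<Rightarrow> 'a set" where
  "deglt R x 0 = {0}"
| "deglt R x (Suc d) = {r * x ^ d + p | r p. r \<in> R \<and> p \<in> deglt R x d}"

definition adjoin :: "'a::comm_ring_1 set \<Rightarrow> 'a \<Rightarrow> 'a set" where
  "adjoin R x = (\<Union>d. deglt R x d)"

context
  fixes R :: "'a::comm_ring_1 set" and x :: 'a
  assumes R: "is_subring R"
begin

lemma deglt_SucI: "r \<in> R \<Longrightarrow> p \<in> deglt R x d \<Longrightarrow> r * x ^ d + p \<in> deglt R x (Suc d)"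
  by auto

lemma deglt_zero: "0 \<in> deglt R x d"
  by (induction d) (use is_subringD(1)[OF R] in force)+

lemma deglt_Suc: "p \<in> deglt R x d \<Longrightarrow> p \<in> deglt R x (Suc d)"
  using is_subringD(1)[OF R] by force

lemma deglt_mono: "p \<in> deglt R x d \<Longrightarrow> d \<le> d' \<Longrightarrow> p \<in> deglt R x d'"
  by (rule lift_Suc_mono_le[of "deglt R x", THEN subsetD]) (use deglt_Suc in auto)

lemma deglt_add: "p \<in> deglt R x d \<Longrightarrow> q \<in> deglt R x d \<Longrightarrow> p + q \<in> deglt R x d"
proof (induction d arbitrary: p q)
  case (Suc d)
  then obtain r p' s q' where "p = r * x ^ d + p'" "q = s * x ^ d + q'" "r \<in> R" "s \<in> R"
    "p' \<in> deglt R x d" "q' \<in> deglt R x d" by auto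
  moreover from this have "p + q = (r + s) * x ^ d + (p' + q')" by (simp add: algebra_simps)
  ultimately show ?case using Suc.IH is_subringD(3)[OF R] by (simp only: deglt_SucI)
qed simp

lemma deglt_scale: "c \<in> R \<Longrightarrow> p \<in> deglt R x d \<Longrightarrow> c * p \<in> deglt R x d"
proof (induction d arbitrary: p)
  case (Suc d)
  then obtain r p' where "p = r * x ^ d + p'" "r \<in> R" "p' \<in> deglt R x d" by auto
  moreover from this have "c * p = (c * r) * x ^ d + (c * p')" by (simp add: algebra_simps)
  ultimately show ?case using Suc.IH Suc.prems(1) is_subringD(4)[OF R] by (simp only: deglt_SucI)
qed simp

lemma deglt_uminus: "p \<in> deglt R x d \<Longrightarrow> - p \<in> deglt R x d"
  using deglt_scale[of "-1" p d] is_subringD[OF R] by auto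

lemma deglt_shift: "p \<in> deglt R x d \<Longrightarrow> x ^ j * p \<in> deglt R x (d + j)"
proof (induction d arbitrary: p)
  case (Suc d)
  then obtain r p' where "p = r * x ^ d + p'" "r \<in> R" "p' \<in> deglt R x d" by auto
  moreover from this have "x ^ j * p = r * x ^ (d + j) + (x ^ j * p')"
    by (simp add: algebra_simps power_add)
  ultimately show ?case using Suc.IH deglt_SucI[of r "x ^ j * p'" "d + j"] by simp
qed (use deglt_zero in simp)

lemma adjoin_deglt: "p \<in> deglt R x d \<Longrightarrow> p \<in> adjoin R x"
  by (auto simp: adjoin_def)

lemma adjoin_base: "r \<in> R \<Longrightarrow> r \<in> adjoin R x"
  by (rule adjoin_deglt[of _ 1]) auto

lemma adjoin_add:
  assumes "p \<in> adjoin R x" "q \<in> adjoin R x" shows "p + q \<in> adjoin R x"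
proof -
  obtain d d' where "p \<in> deglt R x d" "q \<in> deglt R x d'" using assms by (auto simp: adjoin_def)
  then have "p \<in> deglt R x (max d d')" "q \<in> deglt R x (max d d')" by (auto elim: deglt_mono)
  then show ?thesis by (blast intro: adjoin_deglt deglt_add)
qed

lemma adjoin_mult:
  assumes "p \<in> adjoin R x" "q \<in> adjoin R x" shows "p * q \<in> adjoin R x"
proof -
  obtain d' where q: "q \<in> deglt R x d'" using assms by (auto simp: adjoin_def)
  have "p * q \<in> adjoin R x" if "p \<in> deglt R x d" for d
    using that
  proof (induction d arbitrary: p)
    case 0
    then show ?case using adjoin_base is_subringD(1)[OF R] by simp
  next
    case (Suc d)
    then obtain r p' where p: "p = r * x ^ d + p'" "r \<in> R" "p' \<in> deglt R x d" by auto
    have "r * (x ^ d * q) \<in> adjoin R x"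
      by (rule adjoin_deglt, rule deglt_scale[OF p(2)], rule deglt_shift[OF q])
    moreover have "p * q = r * (x ^ d * q) + p' * q" using p by (simp add: algebra_simps)
    ultimately show ?case using Suc.IH[OF p(3)] adjoin_add by simp
  qed
  then show ?thesis using assms by (auto simp: adjoin_def)
qed

lemma adjoin_gen: "x \<in> adjoin R x"
proof (rule adjoin_deglt[of _ 2])
  have "1 * x ^ 1 + (0 * x ^ 0 + 0) \<in> deglt R x (Suc 1)"
    unfolding One_nat_def by (intro deglt_SucI is_subringD[OF R]) simp
  then show "x \<in> deglt R x 2" by (simp add: numeral_2_eq_2)
qed

lemma is_subring_adjoin: "is_subring (adjoin R x)"
  using adjoin_base adjoin_add adjoin_mult is_subringD[OF R]
  by (auto simp: is_subring_def adjoin_def intro: deglt_uminus)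

lemma adjoin_least:
  assumes T: "is_subring T" "R \<subseteq> T" "x \<in> T"
  shows "adjoin R x \<subseteq> T"
proof -
  have "deglt R x d \<subseteq> T" for d
    by (induction d) (use T in \<open>auto intro!: is_subringD[OF T(1)] is_subring_power[OF T(1)]\<close>)
  then show ?thesis by (auto simp: adjoin_def)
qed

text \<open>Hilbert's argument with leading coefficients. Successive elements of least possible
  degree are chosen outside the ideal of the earlier ones; a relation among their leading
  coefficients then produces an element of smaller degree that is still outside.\<close>

theorem Hilbert_basis:
  assumes N: "noeth R"
  shows "noeth (adjoin R x)"
  unfolding noeth_def
proof (intro allI impI, rule ccontr)
  let ?A = "adjoin R x"
  note A = is_subring_adjoin
  fix g :: "nat \<Rightarrow> 'a"
  assume g: "range g \<subseteq> ?A" and "\<nexists>K. g K \<in> idl ?A (g ` {..<K})"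
  then have ng: "g K \<notin> idl ?A (g ` {..<K})" for K by auto
  define I where "I = idl ?A (range g)"
  have IA: "I \<subseteq> ?A"
  proof
    fix y assume "y \<in> I"
    then show "y \<in> ?A" unfolding I_def
      by induction (use g in \<open>auto intro!: is_subringD[OF A]\<close>)
  qed
  \<comment> \<open>A finite subset of \<open>I\<close> involves only finitely many
    \<open>g j\<close>, so it cannot generate the next one.\<close>
  have ex: "\<exists>y\<in>I. y \<notin> idl ?A F" if F: "finite F" "F \<subseteq> I" for F
  proof -
    have "\<exists>K. F \<subseteq> idl ?A (g ` {..<K})" using F
    proof (induction F rule: finite_induct)
      case (insert y F)
      then obtain K K' where "F \<subseteq> idl ?A (g ` {..<K})" "y \<in> idl ?A (g ` {..<K'})"
        using idl_finite[of y ?A g] by (auto simp: I_def)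
      then have "insert y F \<subseteq> idl ?A (g ` {..<max K K'})"
        by (auto intro: idl_mono)
      then show ?case by blast
    qed auto
    then obtain K where "F \<subseteq> idl ?A (g ` {..<K})" by blast
    then have "g K \<notin> idl ?A F" using ng[of K] idl_least[OF A] by blast
    moreover have "g K \<in> I" unfolding I_def by (rule idl_base[OF A]) auto
    ultimately show ?thesis by blast
  qed
  \<comment> \<open>\<open>P f k y\<close>: among the elements of \<open>I\<close> outside the ideal
    of \<open>f 0, ..., f (k - 1)\<close>, \<open>y\<close> has an expression of least
    degree.\<close>
  define P where "P f k y \<longleftrightarrow> y \<in> I \<and> y \<notin> idl ?A (f ` {..<k}) \<and>
     (\<exists>d. y \<in> deglt R x d \<and> (\<forall>z d'. z \<in> I \<longrightarrow> z \<notin> idl ?A (f ` {..<k}) \<longrightarrow> z \<in> deglt R x d' \<longrightarrow> d \<le> d'))"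
    for f :: "nat \<Rightarrow> 'a" and k :: nat and y
  have "\<exists>f. \<forall>k. P f k (f k)"
  proof (rule dependent_wellorder_choice)
    fix r :: 'a and f g :: "nat \<Rightarrow> 'a" and k :: nat
    assume "\<And>y. y < k \<Longrightarrow> f y = g y"
    then have "f ` {..<k} = g ` {..<k}" by auto
    then show "P f k r = P g k r" by (simp add: P_def)
  next
    fix k :: nat and f :: "nat \<Rightarrow> 'a"
    assume "\<And>j. j < k \<Longrightarrow> P f j (f j)"
    then have "f ` {..<k} \<subseteq> I" by (auto simp: P_def)
    then obtain y0 where y0: "y0 \<in> I" "y0 \<notin> idl ?A (f ` {..<k})" using ex[of "f ` {..<k}"] by auto
    define Q where "Q d \<longleftrightarrow> (\<exists>y\<in>I. y \<notin> idl ?A (f ` {..<k}) \<and> y \<in> deglt R x d)" for d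
    have "y0 \<in> ?A" using y0 IA by auto
    then obtain d where "y0 \<in> deglt R x d" unfolding adjoin_def by blast
    then have "\<exists>d. Q d" using y0 by (auto simp: Q_def)
    then have "Q (LEAST d. Q d)" by (rule LeastI_ex)
    then obtain y where y: "y \<in> I" "y \<notin> idl ?A (f ` {..<k})" "y \<in> deglt R x (LEAST d. Q d)"
      by (auto simp: Q_def)
    have "P f k y" unfolding P_def
    proof (intro conjI exI[of _ "LEAST d. Q d"] allI impI)
      fix z d' assume "z \<in> I" "z \<notin> idl ?A (f ` {..<k})" "z \<in> deglt R x d'"
      then have "Q d'" by (auto simp: Q_def)
      then show "(LEAST d. Q d) \<le> d'" by (rule Least_le)
    qed (use y in auto)
    then show "\<exists>r. P f k r" by blast
  qed
  then obtain f where f: "\<And>k. P f k (f k)" by blast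
  then have fI: "f k \<in> I" "f k \<notin> idl ?A (f ` {..<k})" for k by (auto simp: P_def)
  from f have "\<forall>k. \<exists>d. f k \<in> deglt R x d \<and> (\<forall>z d'. z \<in> I \<longrightarrow> z \<notin> idl ?A (f ` {..<k}) \<longrightarrow> z \<in> deglt R x d' \<longrightarrow> d \<le> d')"
    by (auto simp: P_def)
  then obtain d where d: "\<And>k. f k \<in> deglt R x (d k)"
    and dmin: "\<And>k z d'. z \<in> I \<Longrightarrow> z \<notin> idl ?A (f ` {..<k}) \<Longrightarrow> z \<in> deglt R x d' \<Longrightarrow> d k \<le> d'"
    by metis
  have dmono: "d i \<le> d k" if "i \<le> k" for i k
  proof (rule dmin[of "f k"])
    show "f k \<notin> idl ?A (f ` {..<i})"
      using fI(2)[of k] idl_mono[of "f k" ?A "f ` {..<i}" "f ` {..<k}"] that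
      by (meson image_mono lessThan_subset_iff)
  qed (use fI d in auto)
  have "\<exists>a p. d k > 0 \<and> a \<in> R \<and> p \<in> deglt R x (d k - 1) \<and> f k = a * x ^ (d k - 1) + p" for k
  proof (cases "d k")
    case 0
    then show ?thesis using d[of k] fI(2)[of k] by (auto simp: idl.zero)
  next
    case (Suc m)
    then show ?thesis using d[of k] by auto
  qed
  then obtain a p where ap: "\<And>k. d k > 0" "\<And>k. a k \<in> R" "\<And>k. p k \<in> deglt R x (d k - 1)"
    "\<And>k. f k = a k * x ^ (d k - 1) + p k" by metis
  obtain K where K: "a K \<in> idl R (a ` {..<K})" using N ap(2) by (auto simp: noeth_def image_subset_iff)
  \<comment> \<open>A combination of earlier leading coefficients lifts to the same combination of
    the \<open>f i\<close>, each raised to degree \<open>d K - 1\<close> by a power of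
    \<open>x\<close>; this is possible since \<open>d\<close> is monotone.\<close>
  have "\<exists>h\<in>idl ?A (f ` {..<K}). h - b * x ^ (d K - 1) \<in> deglt R x (d K - 1)"
    if "b \<in> idl R (a ` {..<K})" for b
    using that
  proof induction
    case zero
    then show ?case by (intro bexI[of _ 0]) (auto simp: idl.zero deglt_zero)
  next
    case (step b c s)
    then obtain h i where h: "h \<in> idl ?A (f ` {..<K})" "h - b * x ^ (d K - 1) \<in> deglt R x (d K - 1)"
      and i: "i < K" "s = a i" by auto
    let ?j = "d K - d i"
    have j: "d K - 1 = d i - 1 + ?j" using dmono[of i K] i ap(1)[of i] by auto
    have "h + (c * x ^ ?j) * f i \<in> idl ?A (f ` {..<K})"
      using h i step adjoin_base is_subring_power[OF A adjoin_gen]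
      by (intro idl.step) (auto intro: adjoin_mult)
    moreover have "c * (x ^ ?j * p i) \<in> deglt R x (d K - 1)"
      unfolding j by (intro deglt_scale deglt_shift ap step)
    then have "(h - b * x ^ (d K - 1)) + c * (x ^ ?j * p i) \<in> deglt R x (d K - 1)"
      by (intro deglt_add h)
    moreover have "(h - b * x ^ (d K - 1)) + c * (x ^ ?j * p i)
        = (h + (c * x ^ ?j) * f i) - (b + c * s) * x ^ (d K - 1)"
    proof -
      have "x ^ (d K - 1) = x ^ (d i - 1) * x ^ ?j" using arg_cong[OF j, of "power x"] by (simp only: power_add)
      then show ?thesis by (simp add: i ap(4)[of i] algebra_simps)
    qed
    ultimately show ?case by (intro bexI[of _ "h + (c * x ^ ?j) * f i"]) metis+
  qed
  from this[OF K] obtain h where h: "h \<in> idl ?A (f ` {..<K})"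
    "h - a K * x ^ (d K - 1) \<in> deglt R x (d K - 1)" by blast
  \<comment> \<open>The leading terms cancel, so \<open>?z\<close> contradicts the minimality of
    \<open>d K\<close>.\<close>
  let ?z = "f K + - h"
  have "p K + - (h - a K * x ^ (d K - 1)) \<in> deglt R x (d K - 1)"
    by (intro deglt_add deglt_uminus ap h)
  then have "?z \<in> deglt R x (d K - 1)" by (simp add: ap(4)[of K] algebra_simps)
  moreover have "?z \<notin> idl ?A (f ` {..<K})"
    using fI(2)[of K] idl_add[OF h(1), of ?z] by auto
  moreover have "h \<in> I"
  proof -
    have "f ` {..<K} \<subseteq> I" using fI by auto
    then show ?thesis using idl_least[OF A _ h(1)] unfolding I_def by blast
  qed
  then have "?z \<in> I" using fI(1)[of K] unfolding I_def by (intro idl_add idl_uminus A)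
  ultimately have "d K \<le> d K - 1" by (intro dmin)
  then show False using ap(1)[of K] by simp
qed

end

text \<open>The assumption \<open>least\<close> expresses that \<open>K\<close> and the finite set
  \<open>X\<close> generate \<open>T\<close>; the elements of \<open>X\<close> are adjoined one by
  one without leaving \<open>T\<close>.\<close>

lemma noeth_finitely_generated:
  assumes K: "is_subring K" "noeth K" and T: "is_subring T" "K \<subseteq> T" "finite X" "X \<subseteq> T"
    and least: "\<And>S. is_subring S \<Longrightarrow> K \<subseteq> S \<Longrightarrow> X \<subseteq> S \<Longrightarrow> T \<subseteq> S"
  shows "noeth T"
proof -
  have "\<exists>S. is_subring S \<and> noeth S \<and> K \<subseteq> S \<and> X \<subseteq> S \<and> S \<subseteq> T"
    using T(3,4)
  proof (induction X rule: finite_induct)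
    case (insert x X)
    then obtain S where S: "is_subring S" "noeth S" "K \<subseteq> S" "X \<subseteq> S" "S \<subseteq> T" by auto
    have "is_subring (adjoin S x)" "noeth (adjoin S x)" "adjoin S x \<subseteq> T" "S \<subseteq> adjoin S x" "x \<in> adjoin S x"
      using S insert.prems is_subring_adjoin[OF S(1)] Hilbert_basis[OF S(1,2)]
        adjoin_least[OF S(1) T(1)] adjoin_base[OF S(1)] adjoin_gen[OF S(1)] by auto
    then show ?case using S by (intro exI[of _ "adjoin S x"]) auto
  qed (use K T in auto)
  then obtain S where "is_subring S" "noeth S" "K \<subseteq> S" "X \<subseteq> S" "S \<subseteq> T" by blast
  with least[of S] show ?thesis by auto
qed

lemma noeth_imp_finite_basis:
  assumes R: "is_subring R" "noeth R" and S: "S \<subseteq> R"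
  shows "\<exists>F. finite F \<and> F \<subseteq> S \<and> S \<subseteq> idl R F"
proof (rule ccontr)
  assume "\<not> ?thesis"
  then have ex: "\<exists>y\<in>S. y \<notin> idl R F" if "finite F" "F \<subseteq> S" for F using that by blast
  have "\<exists>f. \<forall>k::nat. f k \<in> S \<and> f k \<notin> idl R (f ` {..<k})"
  proof (rule dependent_wellorder_choice)
    fix r :: 'a and f g :: "nat \<Rightarrow> 'a" and k :: nat
    assume "\<And>y. y < k \<Longrightarrow> f y = g y"
    then have "f ` {..<k} = g ` {..<k}" by auto
    then show "(r \<in> S \<and> r \<notin> idl R (f ` {..<k})) = (r \<in> S \<and> r \<notin> idl R (g ` {..<k}))" by simp
  next
    fix k :: nat and f :: "nat \<Rightarrow> 'a"
    assume "\<And>j. j < k \<Longrightarrow> f j \<in> S \<and> f j \<notin> idl R (f ` {..<j})"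
    then show "\<exists>r. r \<in> S \<and> r \<notin> idl R (f ` {..<k})" using ex[of "f ` {..<k}"] by auto
  qed
  then obtain f where f: "\<And>k::nat. f k \<in> S" "\<And>k. f k \<notin> idl R (f ` {..<k})" by blast
  then have "range f \<subseteq> R" using S by auto
  then show False using R(2) f(2) by (auto simp: noeth_def)
qed

text \<open>The constants form a field: the first term of a sequence either is zero, hence in the
  ideal of no generators, or divides the second.\<close>

lemma const_funs_noeth:
  defines "K \<equiv> range (\<lambda>c::'b::field. (\<lambda>_::'a. c))"
  shows "is_subring K" "noeth K"
proof -
  show sub: "is_subring K"
    by (auto simp: is_subring_def K_def zero_fun_def one_fun_def plus_fun_def times_fun_def fun_Compl_def)
  show "noeth K" unfolding noeth_def
  proof (intro allI impI)
    fix f :: "nat \<Rightarrow> 'a \<Rightarrow> 'b" assume f: "range f \<subseteq> K"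
    then have "f 0 \<in> K" "f 1 \<in> K" by auto
    then obtain c d where cd: "f 0 = (\<lambda>_. c)" "f 1 = (\<lambda>_. d)" by (auto simp: K_def)
    show "\<exists>k. f k \<in> idl K (f ` {..<k})"
    proof (cases "c = 0")
      case True
      then have "f 0 = 0" by (simp add: cd zero_fun_def)
      then show ?thesis by (intro exI[of _ 0]) (auto simp: idl.zero)
    next
      case False
      have "0 + (\<lambda>_. d / c) * f 0 \<in> idl K (f ` {..<1})"
        by (rule idl.step[OF idl.zero]) (auto simp: K_def)
      moreover have "0 + (\<lambda>_. d / c) * f 0 = f 1" using False by (auto simp: cd[unfolded One_nat_def] fun_eq_iff)
      ultimately show ?thesis by metis
    qed
  qed
qed

section \<open>Polynomial functions on matrices\<close>

abbreviation pfun :: "(complex ^ 'n ^ 'n \<Rightarrow> complex) set" where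
  "pfun \<equiv> poly_fun UNIV"

lemma pfun_sum: "finite I \<Longrightarrow> (\<And>i. i \<in> I \<Longrightarrow> f i \<in> pfun) \<Longrightarrow> (\<lambda>A. \<Sum>i\<in>I. f i A) \<in> pfun"
  by (induction I rule: finite_induct) (auto intro: poly_fun.intros)

lemma pfun_prod: "finite I \<Longrightarrow> (\<And>i. i \<in> I \<Longrightarrow> f i \<in> pfun) \<Longrightarrow> (\<lambda>A. \<Prod>i\<in>I. f i A) \<in> pfun"
  by (induction I rule: finite_induct) (auto intro: poly_fun.intros)

lemma pfun_cmult: "p \<in> pfun \<Longrightarrow> (\<lambda>A. c * p A) \<in> pfun"
  by (intro poly_fun.mult poly_fun.const) auto

lemma pfun_uminus: "p \<in> pfun \<Longrightarrow> (\<lambda>A. - p A) \<in> pfun"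
  using pfun_cmult[of p "-1"] by simp

lemma pfun_diff: "p \<in> pfun \<Longrightarrow> q \<in> pfun \<Longrightarrow> (\<lambda>A. p A - q A) \<in> pfun"
  using poly_fun.add[OF _ pfun_uminus] by fastforce

lemma pfun_compose:
  assumes "p \<in> pfun" "\<And>i j. (\<lambda>A. W A $ i $ j) \<in> pfun"
  shows "(\<lambda>A. p (W A)) \<in> pfun"
  using assms(1) by induction (auto intro: poly_fun.intros assms(2))

lemma pfun_mult_entry:
  assumes "\<And>i j. (\<lambda>A. V A $ i $ j) \<in> pfun" "\<And>i j. (\<lambda>A. W A $ i $ j) \<in> pfun"
  shows "(\<lambda>A. (V A ** W A) $ i $ j) \<in> pfun"
  using assms by (auto simp: matrix_matrix_mult_def intro!: pfun_sum poly_fun.mult)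

lemma pfun_const: "(\<lambda>A. c) \<in> pfun"
  by (auto intro: poly_fun.const)

lemma pfun_ltrans: "p \<in> pfun \<Longrightarrow> (\<lambda>A. p (B ** A)) \<in> pfun"
  by (rule pfun_compose) (auto intro!: pfun_mult_entry poly_fun.entry pfun_const)

lemma pfun_rtrans: "p \<in> pfun \<Longrightarrow> (\<lambda>A. p (A ** B)) \<in> pfun"
  by (rule pfun_compose) (auto intro!: pfun_mult_entry poly_fun.entry pfun_const)

lemma is_subring_pfun: "is_subring pfun"
  unfolding is_subring_def zero_fun_def one_fun_def plus_fun_def times_fun_def fun_Compl_def
  by (auto intro: poly_fun.intros pfun_uminus)

lemma noeth_pfun: "noeth (pfun :: (complex ^ 'n ^ 'n \<Rightarrow> complex) set)"
proof (rule noeth_finitely_generated[OF const_funs_noeth is_subring_pfun])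
  show "range (\<lambda>c _. c) \<subseteq> pfun" by (auto intro: poly_fun.const)
  show "finite (range (\<lambda>(i::'n, j::'n). (\<lambda>A::complex ^ 'n ^ 'n. A $ i $ j)))" by simp
  show "range (\<lambda>(i::'n, j::'n). (\<lambda>A::complex ^ 'n ^ 'n. A $ i $ j)) \<subseteq> pfun"
    by (auto intro: poly_fun.entry)
  fix S :: "(complex ^ 'n ^ 'n \<Rightarrow> complex) set"
  assume S: "is_subring S" "range (\<lambda>c _. c) \<subseteq> S"
    "range (\<lambda>(i::'n, j::'n). (\<lambda>A::complex ^ 'n ^ 'n. A $ i $ j)) \<subseteq> S"
  show "pfun \<subseteq> S"
  proof
    fix p :: "complex ^ 'n ^ 'n \<Rightarrow> complex" assume "p \<in> pfun"
    then show "p \<in> S"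
    proof induction
      case (entry i j)
      then show ?case using S(3) by auto
    next
      case (add p q)
      then show ?case using is_subringD(3)[OF S(1), of p q] by (simp add: plus_fun_def)
    next
      case (mult p q)
      then show ?case using is_subringD(4)[OF S(1), of p q] by (simp add: times_fun_def)
    qed (use S(2) in auto)
  qed
qed

section \<open>Derivatives of polynomial functions\<close>

definition pder :: "(complex ^ 'n ^ 'n \<Rightarrow> complex) \<Rightarrow> complex ^ 'n ^ 'n \<Rightarrow> complex ^ 'n ^ 'n \<Rightarrow> complex" where
  "pder p A = frechet_derivative p (at A)"

lemma has_derivative_entry:
  "((\<lambda>A::'a::real_normed_vector ^ 'n ^ 'm. A $ i $ j) has_derivative (\<lambda>V. V $ i $ j)) F"
  by (intro bounded_linear_imp_has_derivative bounded_linear_compose[OF bounded_linear_vec_nth bounded_linear_vec_nth])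

lemma pfun_has_derivative: "p \<in> pfun \<Longrightarrow> (p has_derivative pder p A) (at A)"
proof -
  assume "p \<in> pfun"
  then have "p differentiable (at A)"
  proof induction
    case (entry i j)
    then show ?case using has_derivative_entry by (auto simp: differentiable_def)
  qed (auto intro: differentiable_add differentiable_mult)
  then show ?thesis by (simp add: pder_def frechet_derivative_works)
qed

lemma pder_eqI: "(p has_derivative D) (at A) \<Longrightarrow> pder p A = D"
  by (metis frechet_derivative_at pder_def)

lemma pder_const: "pder (\<lambda>_. c) A = (\<lambda>_. 0)"
  by (rule pder_eqI) simp

lemma pder_entry: "pder (\<lambda>A. A $ i $ j) A = (\<lambda>V. V $ i $ j)"
  by (rule pder_eqI) (rule has_derivative_entry)

lemma pder_add: "p \<in> pfun \<Longrightarrow> q \<in> pfun \<Longrightarrow> pder (\<lambda>A. p A + q A) A = (\<lambda>V. pder p A V + pder q A V)"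
  by (rule pder_eqI) (intro has_derivative_add pfun_has_derivative)

lemma pder_mult: "p \<in> pfun \<Longrightarrow> q \<in> pfun \<Longrightarrow>
  pder (\<lambda>A. p A * q A) A = (\<lambda>V. p A * pder q A V + pder p A V * q A)"
  by (rule pder_eqI) (intro has_derivative_mult pfun_has_derivative)

lemma linear_pder: "p \<in> pfun \<Longrightarrow> linear (pder p A)"
  using pfun_has_derivative has_derivative_linear by blast

text \<open>\<open>pder\<close> is a real Frechet derivative; that it is complex homogeneous on
  polynomial functions makes tangent spaces complex subspaces.\<close>

lemma pder_cscale: "p \<in> pfun \<Longrightarrow> pder p A (map_matrix ((*) c) V) = c * pder p A V"
  by (induction arbitrary: V rule: poly_fun.induct)
    (auto simp: pder_const pder_entry pder_add pder_mult algebra_simps)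

lemma pder_sum: "p \<in> pfun \<Longrightarrow> pder p A (\<Sum>i\<in>I. V i) = (\<Sum>i\<in>I. pder p A (V i))"
  using linear_sum[OF linear_pder] by blast

lemma pder_pfun:
  assumes "p \<in> pfun" "\<And>i j. (\<lambda>A. W A $ i $ j) \<in> pfun"
  shows "(\<lambda>A. pder p A (W A)) \<in> pfun"
  using assms(1) by induction (auto simp: pder_const pder_entry pder_add pder_mult intro: poly_fun.intros assms(2))

lemma pder_cmult: "p \<in> pfun \<Longrightarrow> pder (\<lambda>A. c * p A) A = (\<lambda>V. c * pder p A V)"
  using pder_mult[OF pfun_const, of p c] by (simp add: pder_const)

definition unit_mat :: "'n \<Rightarrow> 'n \<Rightarrow> complex ^ 'n ^ 'n" where
  "unit_mat a b = (\<chi> i j. if i = a \<and> j = b then 1 else 0)"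

lemma mat_unit_expansion:
  "(V :: complex ^ 'n ^ 'n) = (\<Sum>a\<in>UNIV. \<Sum>b\<in>UNIV. map_matrix ((*) (V $ a $ b)) (unit_mat a b))"
proof -
  have *: "(\<Sum>a\<in>UNIV. \<Sum>b\<in>UNIV. V $ a $ b * (if i = a \<and> j = b then 1 else 0)) = V $ i $ j" for i j :: 'n
  proof -
    have "(\<Sum>b\<in>UNIV. V $ a $ b * (if i = a \<and> j = b then 1 else 0)) = (if i = a then V $ a $ j else 0)" for a
      by (auto simp: if_distrib[of "(*) _"] cong: if_cong)
    then show ?thesis by simp
  qed
  show ?thesis by (simp add: vec_eq_iff unit_mat_def *)
qed

lemma pder_expand: "p \<in> pfun \<Longrightarrow>
  pder p A V = (\<Sum>a\<in>UNIV. \<Sum>b\<in>UNIV. V $ a $ b * pder p A (unit_mat a b))"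
  by (subst mat_unit_expansion[of V]) (simp add: pder_sum pder_cscale)

lemma bounded_bilinear_matrix_mult:
  "bounded_bilinear ((**) :: 'a::real_normed_algebra_1 ^ 'n ^ 'm \<Rightarrow> 'a ^ 'p ^ 'n \<Rightarrow> 'a ^ 'p ^ 'm)"
proof (rule bounded_bilinear.intro)
  fix A A' :: "'a ^ 'n ^ 'm" and B B' :: "'a ^ 'p ^ 'n" and r :: real
  show "(A + A') ** B = A ** B + A' ** B" 
    by (simp add: vec_eq_iff matrix_matrix_mult_def distrib_right sum.distrib)
  show "A ** (B + B') = A ** B + A ** B'" 
    by (simp add: vec_eq_iff matrix_matrix_mult_def distrib_left sum.distrib)
  show "(r *\<^sub>R A) ** B = r *\<^sub>R (A ** B)"
    by (simp add: vec_eq_iff matrix_matrix_mult_def scaleR_sum_right)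
  show "A ** (r *\<^sub>R B) = r *\<^sub>R (A ** B)"
    by (simp add: vec_eq_iff matrix_matrix_mult_def scaleR_sum_right)
next
  show "\<exists>K. \<forall>(A::'a ^ 'n ^ 'm) (B::'a ^ 'p ^ 'n). norm (A ** B) \<le> norm A * norm B * K"
  proof (intro exI allI)
    fix A :: "'a ^ 'n ^ 'm" and B :: "'a ^ 'p ^ 'n"
    have "norm (A ** B) \<le> (\<Sum>i\<in>UNIV. norm ((A ** B) $ i))"
      unfolding norm_vec_def[of "A ** B"] by (rule L2_set_le_sum) simp
    also have "\<dots> \<le> (\<Sum>i\<in>UNIV. \<Sum>j\<in>UNIV. norm ((A ** B) $ i $ j))"
    proof (intro sum_mono)
      fix i
      show "norm ((A ** B) $ i) \<le> (\<Sum>j\<in>UNIV. norm ((A ** B) $ i $ j))"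
        unfolding norm_vec_def[of "(A ** B) $ i"] by (rule L2_set_le_sum) simp
    qed
    also have "\<dots> \<le> (\<Sum>i\<in>(UNIV::'m set). \<Sum>j\<in>(UNIV::'p set). \<Sum>k\<in>(UNIV::'n set). norm A * norm B)"
    proof (intro sum_mono)
      fix i j
      have "norm ((A ** B) $ i $ j) \<le> (\<Sum>k\<in>UNIV. norm (A $ i $ k * B $ k $ j))"
        by (simp add: matrix_matrix_mult_def norm_sum)
      also have "\<dots> \<le> (\<Sum>k\<in>(UNIV::'n set). norm A * norm B)"
      proof (intro sum_mono)
        fix k
        have "norm (A $ i $ k) \<le> norm A" "norm (B $ k $ j) \<le> norm B"
          by (auto intro: order_trans[OF Finite_Cartesian_Product.norm_nth_le Finite_Cartesian_Product.norm_nth_le])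
        then show "norm (A $ i $ k * B $ k $ j) \<le> norm A * norm B"
          by (intro order_trans[OF norm_mult_ineq mult_mono]) auto
      qed
      finally show "norm ((A ** B) $ i $ j) \<le> (\<Sum>k\<in>(UNIV::'n set). norm A * norm B)" .
    qed
    also have "\<dots> = norm A * norm B * (real CARD('m) * real CARD('p) * real CARD('n))" by simp
    finally show "norm (A ** B) \<le> norm A * norm B * (real CARD('m) * real CARD('p) * real CARD('n))" .
  qed
qed

lemma pder_ltrans:
  assumes "p \<in> pfun" shows "pder (\<lambda>A. p (B ** A)) A V = pder p (B ** A) (B ** V)"
proof -
  have "((\<lambda>A. B ** A) has_derivative (\<lambda>V. B ** V)) (at A)"
    by (rule bounded_linear_imp_has_derivative)
      (rule bounded_bilinear.bounded_linear_right[OF bounded_bilinear_matrix_mult])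
  from has_derivative_compose[OF this pfun_has_derivative[OF assms]]
  show ?thesis by (simp add: pder_eqI)
qed

section \<open>Tangent spaces\<close>

definition vanishing :: "(complex ^ 'n ^ 'n) set \<Rightarrow> (complex ^ 'n ^ 'n \<Rightarrow> complex) set" where
  "vanishing S = {p \<in> pfun. \<forall>A\<in>S. p A = 0}"

text \<open>The Zariski tangent space at the identity of the closure of \<open>S\<close>, meaningful
  when \<open>mat 1\<close> lies in that closure.\<close>

definition tangent :: "(complex ^ 'n ^ 'n) set \<Rightarrow> (complex ^ 'n ^ 'n) set" where
  "tangent S = {X. \<forall>p\<in>vanishing S. pder p (mat 1) X = 0}"

text \<open>The closure is taken among all matrices, so invertibility of its elements has to be
  supplied separately.\<close>

definition zclosure :: "(complex ^ 'n ^ 'n) set \<Rightarrow> (complex ^ 'n ^ 'n) set" where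
  "zclosure S = {A. \<forall>p\<in>vanishing S. p A = 0}"

lemma zclosure_superset: "S \<subseteq> zclosure S"
  by (auto simp: vanishing_def zclosure_def)

lemma subspace_tangent: "subspace (tangent S)"
  unfolding subspace_def tangent_def vanishing_def
  by (auto simp: linear_0[OF linear_pder] linear_add[OF linear_pder] linear_scale[OF linear_pder])

lemma tangent_cscale: "X \<in> tangent S \<Longrightarrow> map_matrix ((*) c) X \<in> tangent S"
  by (auto simp: tangent_def vanishing_def pder_cscale)

text \<open>Submonoids instead of subgroups: closure under inverses then never has to be carried
  over to \<open>zclosure\<close>.\<close>

definition mult_closed :: "(complex ^ 'n ^ 'n) set \<Rightarrow> bool" where
  "mult_closed S \<longleftrightarrow> mat 1 \<in> S \<and> (\<forall>A\<in>S. \<forall>B\<in>S. A ** B \<in> S)"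

text \<open>The factors are moved into the closure one after the other: first the right one against
  a fixed left factor from \<open>S\<close>, then the left one.\<close>

lemma mult_closed_zclosure:
  assumes "mult_closed S" shows "mult_closed (zclosure S)"
  unfolding mult_closed_def
proof (intro conjI ballI)
  show "mat 1 \<in> zclosure S" using assms zclosure_superset by (auto simp: mult_closed_def)
  fix A B assume A: "A \<in> zclosure S" and B: "B \<in> zclosure S"
  show "A ** B \<in> zclosure S"
    unfolding zclosure_def
  proof (intro CollectI ballI)
    fix p assume p: "p \<in> vanishing S"
    then have pf: "p \<in> pfun" by (simp add: vanishing_def)
    have "(\<lambda>A. p (A ** B)) \<in> vanishing S"
    proof -
      have "p (C ** B) = 0" if C: "C \<in> S" for C
      proof -
        have "(\<lambda>A. p (C ** A)) \<in> vanishing S"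
          using p C assms pfun_ltrans[OF pf] by (auto simp: vanishing_def mult_closed_def)
        then show ?thesis using B by (auto simp: zclosure_def)
      qed
      then show ?thesis using pfun_rtrans[OF pf] by (auto simp: vanishing_def)
    qed
    then show "p (A ** B) = 0" using A by (auto simp: zclosure_def)
  qed
qed

lemma tangent_translate:
  assumes "mult_closed S" "A \<in> S" "X \<in> tangent S" "p \<in> vanishing S"
  shows "pder p A (A ** X) = 0"
proof -
  have pf: "p \<in> pfun" using assms by (simp add: vanishing_def)
  have "(\<lambda>B. p (A ** B)) \<in> vanishing S"
    using assms pfun_ltrans[OF pf] by (auto simp: vanishing_def mult_closed_def)
  then have "pder (\<lambda>B. p (A ** B)) (mat 1) X = 0" using assms(3) by (auto simp: tangent_def)
  then show ?thesis by (simp add: pder_ltrans[OF pf])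
qed

text \<open>The left-invariant vector field of \<open>X\<close> preserves the vanishing ideal, so it
  can be applied repeatedly.\<close>

lemma tangent_derivation:
  assumes "mult_closed S" "X \<in> tangent S" "p \<in> vanishing S"
  shows "(\<lambda>A. pder p A (A ** X)) \<in> vanishing S"
  using assms tangent_translate[OF assms(1) _ assms(2,3)]
  by (auto simp: vanishing_def intro!: pder_pfun pfun_mult_entry poly_fun.entry pfun_const)

text \<open>Membership is asked only for nonzero times, because curves given by Laurent polynomials
  are controlled only there.\<close>

lemma tangent_curve:
  fixes \<gamma> :: "real \<Rightarrow> complex ^ 'n ^ 'n"
  assumes \<gamma>: "(\<gamma> has_vector_derivative X) (at 0)" "\<gamma> 0 = mat 1"
    and S: "\<And>t. t \<noteq> 0 \<Longrightarrow> \<bar>t\<bar> < d \<Longrightarrow> \<gamma> t \<in> zclosure S" "d > 0" "mat 1 \<in> S"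
  shows "X \<in> tangent S"
  unfolding tangent_def
proof (intro CollectI ballI)
  fix p assume p: "p \<in> vanishing S"
  then have pf: "p \<in> pfun" by (simp add: vanishing_def)
  have "(p has_derivative pder p (mat 1)) (at (\<gamma> 0))" using pfun_has_derivative[OF pf] \<gamma>(2) by simp
  from has_derivative_compose[OF \<gamma>(1)[unfolded has_vector_derivative_def] this]
  have "((\<lambda>t. p (\<gamma> t)) has_derivative (\<lambda>t. pder p (mat 1) (t *\<^sub>R X))) (at 0)" .
  then have 1: "((\<lambda>t. p (\<gamma> t)) has_vector_derivative pder p (mat 1) X) (at 0)"
    by (simp add: has_vector_derivative_def linear_scale[OF linear_pder[OF pf]])
  have "((\<lambda>t. 0::complex) has_vector_derivative 0) (at 0)" by simp
  then have "((\<lambda>t. p (\<gamma> t)) has_vector_derivative 0) (at 0)"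
  proof (rule has_vector_derivative_transform_within_open[where S = "ball 0 d"])
    fix t :: real assume "t \<in> ball 0 d"
    then show "0 = p (\<gamma> t)"
      using S p \<gamma>(2) by (cases "t = 0") (auto simp: zclosure_def vanishing_def)
  qed (use S in auto)
  with 1 show "pder p (mat 1) X = 0" using vector_derivative_unique_at by blast
qed

section \<open>The matrix exponential\<close>

text \<open>Entrywise series over any complete normed field, so that one set of lemmas serves real
  and complex matrices.\<close>

definition gexp :: "'a::{real_normed_field,banach} ^ 'n ^ 'n \<Rightarrow> 'a ^ 'n ^ 'n" where
  "gexp X = (\<chi> i j. \<Sum>k. mat_pow X k $ i $ j / fact k)"

lemma mat_pow_0 [simp]: "mat_pow A 0 = mat 1"
  by (simp add: mat_pow_def)

lemma mat_pow_Suc: "mat_pow A (Suc k) = A ** mat_pow A k"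
  by (simp add: mat_pow_def)

lemma mat_pow_commute:
  assumes "A ** X = X ** A" shows "A ** mat_pow X k = mat_pow X k ** A"
proof (induction k)
  case (Suc k)
  have "A ** mat_pow X (Suc k) = X ** (A ** mat_pow X k)"
    by (simp add: mat_pow_Suc matrix_mul_assoc assms)
  then show ?case by (simp add: Suc mat_pow_Suc matrix_mul_assoc)
qed simp

lemma mat_pow_scale:
  "mat_pow (map_matrix ((*) t) X) k = map_matrix ((*) (t ^ k)) (mat_pow X k)"
proof (induction k)
  case (Suc k)
  then show ?case
    by (simp add: mat_pow_Suc vec_eq_iff matrix_matrix_mult_def sum_distrib_left mult_ac)
qed (simp add: vec_eq_iff)

lemma norm_mat_pow_le:
  fixes X :: "'a::real_normed_field ^ 'n ^ 'n"
  shows "norm (mat_pow X k $ i $ j) \<le> (\<Sum>i\<in>UNIV. \<Sum>j\<in>UNIV. norm (X $ i $ j)) ^ k"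
proof (induction k arbitrary: i)
  case 0
  then show ?case by (simp add: mat_def)
next
  case (Suc k)
  let ?C = "\<Sum>i\<in>UNIV. \<Sum>j\<in>UNIV. norm (X $ i $ j)"
  have C: "?C \<ge> 0" by (intro sum_nonneg) auto
  have "norm (mat_pow X (Suc k) $ i $ j) \<le> (\<Sum>l\<in>UNIV. norm (X $ i $ l) * norm (mat_pow X k $ l $ j))"
    by (simp add: mat_pow_Suc matrix_matrix_mult_def sum_norm_le norm_mult)
  also have "\<dots> \<le> (\<Sum>l\<in>UNIV. norm (X $ i $ l) * ?C ^ k)"
    by (intro sum_mono mult_left_mono Suc) auto
  also have "\<dots> = (\<Sum>l\<in>UNIV. norm (X $ i $ l)) * ?C ^ k" by (simp add: sum_distrib_right)
  also have "\<dots> \<le> ?C * ?C ^ k"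
    by (intro mult_right_mono zero_le_power C member_le_sum[of i UNIV "\<lambda>i. \<Sum>l\<in>UNIV. norm (X $ i $ l)"] sum_nonneg) auto
  finally show ?case by simp
qed

lemma gexp_summable:
  fixes X :: "'a::{real_normed_field,banach} ^ 'n ^ 'n"
  shows "summable (\<lambda>k. (mat_pow X k $ i $ j / fact k) * t ^ k)"
proof (rule summable_comparison_test)
  let ?C = "\<Sum>i\<in>UNIV. \<Sum>j\<in>UNIV. norm (X $ i $ j)"
  show "summable (\<lambda>k. (?C * norm t) ^ k /\<^sub>R fact k)" by (rule summable_exp_generic)
  show "\<exists>N. \<forall>k\<ge>N. norm ((mat_pow X k $ i $ j / fact k) * t ^ k) \<le> (?C * norm t) ^ k /\<^sub>R fact k"
  proof (intro exI[of _ 0] allI impI)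
    fix k :: nat
    have "norm (mat_pow X k $ i $ j) * norm t ^ k \<le> ?C ^ k * norm t ^ k"
      by (intro mult_right_mono norm_mat_pow_le) auto
    then show "norm ((mat_pow X k $ i $ j / fact k) * t ^ k) \<le> (?C * norm t) ^ k /\<^sub>R fact k"
      by (simp add: norm_mult norm_divide norm_power power_mult_distrib field_simps)
  qed
qed

lemma gexp_sums: "(\<lambda>k. mat_pow X k $ i $ j / fact k) sums (gexp X $ i $ j)"
  using gexp_summable[of X i j 1] by (simp add: gexp_def summable_sums)

lemma gexp_mult_sums: "(\<lambda>k. (A ** mat_pow X k) $ i $ j / fact k) sums ((A ** gexp X) $ i $ j)"
proof -
  have "(\<lambda>k. \<Sum>l\<in>UNIV. A $ i $ l * (mat_pow X k $ l $ j / fact k)) sums (\<Sum>l\<in>UNIV. A $ i $ l * gexp X $ l $ j)"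
    by (intro sums_sum sums_mult gexp_sums)
  then show ?thesis by (simp add: matrix_matrix_mult_def sum_divide_distrib)
qed

lemma gexp_mult_sums': "(\<lambda>k. (mat_pow X k ** A) $ i $ j / fact k) sums ((gexp X ** A) $ i $ j)"
proof -
  have "(\<lambda>k. \<Sum>l\<in>UNIV. (mat_pow X k $ i $ l / fact k) * A $ l $ j) sums (\<Sum>l\<in>UNIV. gexp X $ i $ l * A $ l $ j)"
    by (intro sums_sum sums_mult2 gexp_sums)
  then show ?thesis by (simp add: matrix_matrix_mult_def sum_divide_distrib)
qed

text \<open>Common source of the commutation rule and the conjugation rule below.\<close>

lemma gexp_intertwine:
  assumes "\<And>k. A ** mat_pow X k = mat_pow Y k ** A"
  shows "A ** gexp X = gexp Y ** A"
proof -
  have "(A ** gexp X) $ i $ j = (gexp Y ** A) $ i $ j" for i j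
    using gexp_mult_sums[of A X i j] gexp_mult_sums'[of Y A i j] unfolding assms by (rule sums_unique2)
  then show ?thesis by (simp add: vec_eq_iff)
qed

lemma gexp_commute: "A ** X = X ** A \<Longrightarrow> A ** gexp X = gexp X ** A"
  by (rule gexp_intertwine) (rule mat_pow_commute)

lemma mat_pow_conj:
  assumes "Q ** P = mat 1"
  shows "mat_pow (P ** X ** Q) k ** P = P ** mat_pow X k"
proof (induction k)
  case (Suc k)
  have "mat_pow (P ** X ** Q) (Suc k) ** P = P ** X ** Q ** (mat_pow (P ** X ** Q) k ** P)"
    by (simp add: mat_pow_Suc matrix_mul_assoc)
  also have "\<dots> = P ** X ** (Q ** P) ** mat_pow X k" by (simp add: Suc matrix_mul_assoc)
  finally show ?case by (simp add: assms mat_pow_Suc matrix_mul_assoc)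
qed simp

lemma gexp_conj:
  assumes "Q ** P = mat 1" "P ** Q = mat 1"
  shows "gexp (P ** X ** Q) = P ** gexp X ** Q"
proof -
  have "P ** gexp X = gexp (P ** X ** Q) ** P"
    by (rule gexp_intertwine) (simp add: mat_pow_conj[OF assms(1)])
  then have "P ** gexp X ** Q = gexp (P ** X ** Q) ** (P ** Q)" by (simp add: matrix_mul_assoc)
  then show ?thesis by (simp add: assms)
qed

lemma gexp_zero: "gexp (0 :: 'a::{real_normed_field,banach} ^ 'n ^ 'n) = mat 1"
proof -
  have "gexp (0::'a ^ 'n ^ 'n) $ i $ j = mat 1 $ i $ j" for i j :: 'n
  proof -
    have "mat_pow (0::'a ^ 'n ^ 'n) k $ i $ j / fact k = (if k = 0 then mat 1 $ i $ j else 0)" for k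
      by (cases k) (auto simp: mat_pow_Suc matrix_matrix_mult_def)
    then have "(\<lambda>k. if k = 0 then mat 1 $ i $ j else 0) sums gexp (0::'a ^ 'n ^ 'n) $ i $ j"
      using gexp_sums[of "0::'a ^ 'n ^ 'n" i j] by simp
    moreover have "(\<lambda>k. if k = 0 then mat 1 $ i $ j else 0) sums (mat 1 :: 'a ^ 'n ^ 'n) $ i $ j"
      using sums_single[of 0 "\<lambda>_. (mat 1 :: 'a ^ 'n ^ 'n) $ i $ j"] by simp
    ultimately show ?thesis by (rule sums_unique2)
  qed
  then show ?thesis by (simp add: vec_eq_iff)
qed

lemma gexp_scale_entry:
  "gexp (map_matrix ((*) t) X) $ i $ j = (\<Sum>k. (mat_pow X k $ i $ j / fact k) * t ^ k)"
  by (simp add: gexp_def mat_pow_scale mult_ac)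

lemma gexp_deriv_entry:
  "((\<lambda>t. gexp (map_matrix ((*) t) X) $ i $ j) has_field_derivative
     (gexp (map_matrix ((*) t) X) ** X) $ i $ j) (at t)"
proof -
  let ?c = "\<lambda>k. mat_pow X k $ i $ j / fact k"
  have comm: "mat_pow X (Suc k) = mat_pow X k ** X" for k
    using mat_pow_commute[of X X k] by (simp add: mat_pow_Suc)
  have "(\<Sum>k. diffs ?c k * t ^ k) = (gexp (map_matrix ((*) t) X) ** X) $ i $ j"
  proof -
    have 1: "diffs ?c k * t ^ k = (mat_pow (map_matrix ((*) t) X) k ** X) $ i $ j / fact k" for k
    proof -
      have "diffs ?c k = (mat_pow X k ** X) $ i $ j / fact k"
        by (simp add: diffs_def comm[of k] del: of_nat_Suc)
      moreover have "(mat_pow (map_matrix ((*) t) X) k ** X) $ i $ j = t ^ k * (mat_pow X k ** X) $ i $ j"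
        by (simp add: mat_pow_scale matrix_matrix_mult_def sum_distrib_left mult_ac)
      ultimately show ?thesis by (simp add: mult_ac)
    qed
    show ?thesis unfolding 1 by (rule sums_unique[symmetric, OF gexp_mult_sums'])
  qed
  then show ?thesis
    using termdiffs_strong_converges_everywhere[of ?c t] gexp_summable[of X i j]
    by (simp add: gexp_scale_entry)
qed

lemma has_derivative_vecI:
  fixes f :: "'a::real_normed_vector \<Rightarrow> 'b::euclidean_space ^ 'n"
  assumes "\<And>i. ((\<lambda>x. f x $ i) has_derivative (\<lambda>h. f' h $ i)) (at a within S)"
  shows "(f has_derivative f') (at a within S)"
proof (subst has_derivative_componentwise_within, rule ballI)
  fix b :: "'b ^ 'n" assume "b \<in> Basis"
  then obtain i u where b: "b = axis i u" by (auto simp: Basis_vec_def)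
  have "((\<lambda>x. f x $ i \<bullet> u) has_derivative (\<lambda>h. f' h $ i \<bullet> u)) (at a within S)"
    by (rule has_derivative_inner_left[OF assms])
  then show "((\<lambda>x. f x \<bullet> b) has_derivative (\<lambda>x. f' x \<bullet> b)) (at a within S)"
    by (simp add: b inner_axis)
qed

lemma has_vector_derivative_matI:
  fixes f :: "real \<Rightarrow> 'b::euclidean_space ^ 'n ^ 'm"
  assumes "\<And>i j. ((\<lambda>x. f x $ i $ j) has_vector_derivative f' $ i $ j) (at a within S)"
  shows "(f has_vector_derivative f') (at a within S)"
  unfolding has_vector_derivative_def
  by (intro has_derivative_vecI) (use assms in \<open>simp add: has_vector_derivative_def\<close>)

lemma has_vector_derivative_matmul:
  fixes f g :: "real \<Rightarrow> 'a::real_normed_algebra_1 ^ 'n ^ 'n"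
  assumes "(f has_vector_derivative f') (at t)" "(g has_vector_derivative g') (at t)"
  shows "((\<lambda>t. f t ** g t) has_vector_derivative (f t ** g' + f' ** g t)) (at t)"
  using bounded_bilinear.has_vector_derivative[OF bounded_bilinear_matrix_mult assms] .

lemma has_vector_derivative_matmul_left:
  fixes g :: "real \<Rightarrow> 'a::real_normed_algebra_1 ^ 'n ^ 'n"
  assumes "(g has_vector_derivative g') (at t)"
  shows "((\<lambda>t. A ** g t) has_vector_derivative (A ** g')) (at t)"
  by (rule bounded_linear.has_vector_derivative[OF bounded_bilinear.bounded_linear_right[OF bounded_bilinear_matrix_mult] assms])

lemma has_vector_derivative_matmul_right:
  fixes g :: "real \<Rightarrow> 'a::real_normed_algebra_1 ^ 'n ^ 'n"
  assumes "(g has_vector_derivative g') (at t)"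
  shows "((\<lambda>t. g t ** A) has_vector_derivative (g' ** A)) (at t)"
  by (rule bounded_linear.has_vector_derivative[OF bounded_bilinear.bounded_linear_left[OF bounded_bilinear_matrix_mult] assms])

lemma scaleR_eq_map_matrix:
  "t *\<^sub>R (X :: 'a::real_normed_field ^ 'n ^ 'n) = map_matrix ((*) (of_real t)) X"
  unfolding vec_eq_iff vector_scaleR_component nth_map_matrix by (simp add: scaleR_conv_of_real)

lemma gexp_vector_derivative:
  fixes X :: "'a::{real_normed_field,euclidean_space} ^ 'n ^ 'n"
  shows "((\<lambda>t. gexp (t *\<^sub>R X)) has_vector_derivative (gexp (t *\<^sub>R X) ** X)) (at t)"
proof (rule has_vector_derivative_matI)
  fix i j
  have d: "((\<lambda>t. of_real t :: 'a) has_vector_derivative 1) (at t)"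
    by (auto intro!: derivative_eq_intros simp: has_vector_derivative_def scaleR_conv_of_real)
  have "((\<lambda>z. gexp (map_matrix ((*) z) X) $ i $ j) has_derivative
      (\<lambda>h. (gexp (t *\<^sub>R X) ** X) $ i $ j * h)) (at (of_real t))"
    using gexp_deriv_entry[of X i j "of_real t"]
    by (simp add: scaleR_eq_map_matrix[symmetric] has_field_derivative_def)
  from has_derivative_compose[OF d[unfolded has_vector_derivative_def] this]
  show "((\<lambda>t. gexp (t *\<^sub>R X) $ i $ j) has_vector_derivative (gexp (t *\<^sub>R X) ** X) $ i $ j) (at t)"
    by (simp add: has_vector_derivative_def scaleR_eq_map_matrix scaleR_conv_of_real mult_ac)
qed

lemma gexp_vector_derivative_0:
  fixes X :: "'a::{real_normed_field,euclidean_space} ^ 'n ^ 'n"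
  shows "((\<lambda>t. gexp (t *\<^sub>R X)) has_vector_derivative X) (at 0)"
  using gexp_vector_derivative[of X 0] by (simp add: gexp_zero)

lemma vector_derivative_zero_const:
  fixes f :: "real \<Rightarrow> 'b::real_normed_vector"
  assumes "\<And>t. (f has_vector_derivative 0) (at t)"
  shows "f s = f t"
  using has_vector_derivative_zero_constant[of UNIV f] assms by (metis UNIV_I convex_UNIV)

lemma matrix_mul_scaleR_left:
  "(c *\<^sub>R A) ** (B :: 'a::real_normed_algebra_1 ^ 'n ^ 'n) = c *\<^sub>R (A ** B)"
  by (simp add: vec_eq_iff matrix_matrix_mult_def scaleR_sum_right)

lemma matrix_mul_scaleR_right:
  "A ** (c *\<^sub>R B :: 'a::real_normed_algebra_1 ^ 'n ^ 'n) = c *\<^sub>R (A ** B)"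
  by (simp add: vec_eq_iff matrix_matrix_mult_def scaleR_sum_right)

lemma matrix_mul_uminus_left: "(- A) ** (B :: 'a::ring_1 ^ 'n ^ 'n) = - (A ** B)"
  by (simp add: vec_eq_iff matrix_matrix_mult_def sum_negf)

lemma matrix_mul_uminus_right: "A ** (- B :: 'a::ring_1 ^ 'n ^ 'n) = - (A ** B)"
  by (simp add: vec_eq_iff matrix_matrix_mult_def sum_negf)

lemma gexp_add:
  fixes X :: "'a::{real_normed_field,euclidean_space} ^ 'n ^ 'n"
  shows "gexp ((s + t) *\<^sub>R X) = gexp (s *\<^sub>R X) ** gexp (t *\<^sub>R X)"
proof -
  \<comment> \<open>This product does not depend on \<open>u\<close>; its values at \<open>0\<close>
    and at \<open>t\<close> are the two sides of the claim.\<close>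
  define f where "f u = gexp ((s + t - u) *\<^sub>R X) ** gexp (u *\<^sub>R X)" for u
  have 1: "((\<lambda>u. gexp ((s + t - u) *\<^sub>R X)) has_vector_derivative - (gexp ((s + t - u) *\<^sub>R X) ** X)) (at u)" for u
  proof -
    have "((\<lambda>u. s + t - u) has_vector_derivative -1) (at u)"
      by (auto intro!: derivative_eq_intros)
    from vector_diff_chain_at[OF this gexp_vector_derivative[of X "s + t - u"]]
    show ?thesis by (simp add: o_def)
  qed
  have "(f has_vector_derivative 0) (at u)" for u
  proof -
    have "X ** gexp (u *\<^sub>R X) = gexp (u *\<^sub>R X) ** X"
      by (rule gexp_commute) (simp add: matrix_mul_scaleR_left matrix_mul_scaleR_right)
    then show ?thesis
      using has_vector_derivative_matmul[OF 1[of u] gexp_vector_derivative[of X u]]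
      unfolding f_def by (simp add: matrix_mul_uminus_left matrix_mul_assoc[symmetric])
  qed
  then have "f 0 = f t" by (rule vector_derivative_zero_const)
  then show ?thesis by (simp add: f_def gexp_zero)
qed

lemma gexp_inverse:
  fixes X :: "'a::{real_normed_field,euclidean_space} ^ 'n ^ 'n"
  shows "gexp X ** gexp (- X) = mat 1" "gexp (- X) ** gexp X = mat 1"
  using gexp_add[of 1 "-1" X] gexp_add[of "-1" 1 X] by (simp_all add: gexp_zero)

lemma one_param_eq_gexp:
  fixes \<phi> :: "real \<Rightarrow> 'a::{real_normed_field,euclidean_space} ^ 'n ^ 'n"
  assumes hom: "\<And>s t. \<phi> (s + t) = \<phi> s ** \<phi> t" and d: "(\<phi> has_vector_derivative X) (at 0)"
    and 0: "\<phi> 0 = mat 1"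
  shows "\<phi> t = gexp (t *\<^sub>R X)"
proof -
  have d': "(\<phi> has_vector_derivative (\<phi> t ** X)) (at t)" for t
  proof -
    have "((\<lambda>u. u - t) has_vector_derivative 1) (at t)" by (auto intro!: derivative_eq_intros)
    from vector_diff_chain_at[OF this, of \<phi> X] d
    have "((\<lambda>u. \<phi> (u - t)) has_vector_derivative X) (at t)" by (simp add: o_def)
    from has_vector_derivative_matmul_left[OF this, of "\<phi> t"]
    show ?thesis by (simp add: hom[symmetric])
  qed
  \<comment> \<open>Again a product with derivative zero: it compares the given one-parameter group
    with the inverse exponential.\<close>
  define f where "f u = \<phi> u ** gexp (u *\<^sub>R (- X))" for u
  have "(f has_vector_derivative 0) (at u)" for u
  proof -
    have "X ** gexp (u *\<^sub>R (-X)) = gexp (u *\<^sub>R (-X)) ** X"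
      by (rule gexp_commute) (simp add: matrix_mul_scaleR_left matrix_mul_scaleR_right matrix_mul_uminus_left matrix_mul_uminus_right)
    then show ?thesis
      using has_vector_derivative_matmul[OF d'[of u] gexp_vector_derivative[of "- X" u]]
      unfolding f_def by (simp add: matrix_mul_uminus_right matrix_mul_assoc[symmetric])
  qed
  then have "f t = f 0" by (rule vector_derivative_zero_const)
  then have "\<phi> t ** gexp (- (t *\<^sub>R X)) = mat 1" by (simp add: f_def gexp_zero 0)
  then have "\<phi> t ** (gexp (- (t *\<^sub>R X)) ** gexp (t *\<^sub>R X)) = gexp (t *\<^sub>R X)" by (simp add: matrix_mul_assoc)
  then show ?thesis by (simp add: gexp_inverse)
qed

lemma mat_exp_eq_gexp: "mat_exp X = gexp X"
proof -
  have "(\<lambda>k. (1 / fact k) *\<^sub>R mat_pow X k) sums gexp X"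
    unfolding sums_def
  proof (intro vec_tendstoI)
    fix i j
    have "(\<lambda>n. \<Sum>k<n. mat_pow X k $ i $ j / fact k) \<longlonglongrightarrow> gexp X $ i $ j"
      using gexp_sums[of X i j] by (simp add: sums_def)
    then show "(\<lambda>n. (\<Sum>k<n. (1 / fact k) *\<^sub>R mat_pow X k) $ i $ j) \<longlonglongrightarrow> gexp X $ i $ j"
      by simp
  qed
  then show ?thesis unfolding mat_exp_def by (rule sums_unique[symmetric])
qed

abbreviation cmat :: "real ^ 'n ^ 'n \<Rightarrow> complex ^ 'n ^ 'n" where
  "cmat \<equiv> map_matrix complex_of_real"

lemma cmat_mult: "cmat (A ** B) = cmat A ** cmat B"
  by (simp add: vec_eq_iff matrix_matrix_mult_def)

lemma cmat_1 [simp]: "cmat (mat 1) = mat 1"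
  by (simp add: vec_eq_iff mat_def)

lemma linear_cmat: "linear cmat"
  by (rule linearI) (simp_all add: vec_eq_iff, simp add: scaleR_conv_of_real)

lemma bounded_linear_cmat: "bounded_linear cmat"
  using linear_cmat linear_conv_bounded_linear by blast

lemma cmat_gexp: "cmat (gexp X) = gexp (cmat X)"
proof -
  have pw: "mat_pow (cmat X) k = cmat (mat_pow X k)" for k
    by (induction k) (simp_all add: mat_pow_Suc cmat_mult)
  have "complex_of_real (gexp X $ i $ j) = gexp (cmat X) $ i $ j" for i j
    using sums_unique2[OF sums_of_real[OF gexp_sums[of X i j], where 'a = complex] , of "gexp (cmat X) $ i $ j"]
      gexp_sums[of "cmat X" i j] by (simp add: pw)
  then show ?thesis by (simp add: vec_eq_iff)
qed

section \<open>Exponentials and Zariski closures\<close>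

lemma pfun_field_derivative:
  assumes p: "p \<in> pfun" and \<gamma>: "\<And>i j. ((\<lambda>t. \<gamma> t $ i $ j) has_field_derivative V $ i $ j) (at t)"
  shows "((\<lambda>t. p (\<gamma> t)) has_field_derivative pder p (\<gamma> t) V) (at t)"
  using p
proof induction
  case (mult p q)
  from DERIV_mult[OF mult.IH] show ?case by (simp add: pder_mult mult.hyps algebra_simps)
next
  case (add p q)
  from DERIV_add[OF add.IH] show ?case by (simp add: pder_add add.hyps)
qed (simp_all add: pder_const pder_entry \<gamma>)

text \<open>The function \<open>p (gexp (z X))\<close> of \<open>z\<close> is entire. Its
  derivatives at \<open>0\<close> are the values at the identity of iterated left-invariant
  derivatives of \<open>p\<close>, which stay in the vanishing ideal; so all of them are
  zero.\<close>

theorem gexp_in_zclosure: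
  assumes S: "mult_closed S" and X: "X \<in> tangent S"
  shows "gexp X \<in> zclosure S"
  unfolding zclosure_def
proof (intro CollectI ballI)
  fix p assume p: "p \<in> vanishing S"
  let ?E = "\<lambda>z. gexp (map_matrix ((*) z) X)"
  let ?D = "\<lambda>p. (\<lambda>A. pder p A (A ** X))"
  have van: "(?D ^^ n) p \<in> vanishing S" for n
    by (induction n) (use p tangent_derivation[OF S X] in auto)
  have der: "((\<lambda>z. q (?E z)) has_field_derivative ?D q (?E z)) (at z)" if "q \<in> pfun" for q z
    by (rule pfun_field_derivative[OF that]) (rule gexp_deriv_entry)
  have hi: "(deriv ^^ n) (\<lambda>z. p (?E z)) = (\<lambda>z. (?D ^^ n) p (?E z))" for n
  proof (induction n)
    case (Suc n)
    have "(?D ^^ n) p \<in> pfun" using van[of n] by (simp add: vanishing_def)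
    from der[OF this] show ?case by (simp add: Suc fun_eq_iff DERIV_imp_deriv)
  qed simp
  have pf: "p \<in> pfun" using p by (simp add: vanishing_def)
  have "p (?E 1) = 0"
  proof (rule holomorphic_fun_eq_0_on_connected[of "\<lambda>z. p (?E z)" UNIV 0])
    show "(\<lambda>z. p (?E z)) holomorphic_on UNIV"
      using der[OF pf] by (auto simp: holomorphic_on_def field_differentiable_def intro: has_field_derivative_at_within)
    fix n
    have "?E 0 = mat 1"
    proof -
      have "map_matrix ((*) 0) X = 0" by (simp add: vec_eq_iff)
      then show ?thesis by (simp only: gexp_zero)
    qed
    then show "(deriv ^^ n) (\<lambda>z. p (?E z)) 0 = 0"
      using van[of n] S by (simp add: hi vanishing_def mult_closed_def)
  qed auto
  then show "p (gexp X) = 0"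
  proof -
    assume "p (?E 1) = 0"
    moreover have "map_matrix ((*) 1) X = X" by (simp add: vec_eq_iff)
    ultimately show ?thesis by simp
  qed
qed

text \<open>Through this equivalence the tangent space, defined by polynomials, acquires the
  properties of a Lie algebra.\<close>

lemma tangent_gexp_iff:
  assumes "mult_closed S"
  shows "X \<in> tangent S \<longleftrightarrow> (\<forall>t. gexp (t *\<^sub>R X) \<in> zclosure S)"
proof
  assume "X \<in> tangent S"
  then show "\<forall>t. gexp (t *\<^sub>R X) \<in> zclosure S"
    using gexp_in_zclosure[OF assms] subspace_tangent subspace_scale by blast
next
  assume "\<forall>t. gexp (t *\<^sub>R X) \<in> zclosure S"
  then show "X \<in> tangent S"
    using tangent_curve[where \<gamma> = "\<lambda>t. gexp (t *\<^sub>R X)" and d = 1, OF gexp_vector_derivative_0] assms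
    by (simp add: gexp_zero mult_closed_def)
qed

text \<open>Finite-dimensional subspaces are closed; here the component of \<open>v\<close>
  orthogonal to \<open>V\<close> is shown to vanish by differentiating a function that is constantly
  zero.\<close>

lemma subspace_closed_derivative:
  fixes f :: "real \<Rightarrow> 'b::euclidean_space"
  assumes V: "subspace V" and f: "\<And>t. f t \<in> V" and d: "(f has_vector_derivative v) (at s)"
  shows "v \<in> V"
proof -
  obtain y z where yz: "y \<in> span V" "\<And>w. w \<in> span V \<Longrightarrow> orthogonal z w" "v = y + z"
    using orthogonal_subspace_decomp_exists[of V v] by blast
  have yV: "y \<in> V" using yz(1) V by (simp add: span_eq_iff[THEN iffD2])
  have z: "w \<bullet> z = 0" if "w \<in> V" for w
    using yz(2)[of w] that by (simp add: span_base orthogonal_def inner_commute)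
  have "((\<lambda>t. f t \<bullet> z) has_vector_derivative (v \<bullet> z)) (at s)"
    by (rule bounded_linear.has_vector_derivative[OF bounded_linear_inner_left d])
  then have "((\<lambda>t. 0::real) has_vector_derivative (v \<bullet> z)) (at s)" by (simp add: z f)
  then have "v \<bullet> z = 0"
    using has_vector_derivative_const[of "0::real" "at s"] vector_derivative_unique_at by blast
  then have "z = 0" using yz(3) z[OF yV] by (simp add: inner_add_left)
  then show ?thesis using yz yV by simp
qed

lemma tangent_Ad:
  assumes S: "mult_closed S" and "g \<in> zclosure S" "g' \<in> zclosure S" "g ** g' = mat 1" "g' ** g = mat 1"
    and X: "X \<in> tangent S"
  shows "g ** X ** g' \<in> tangent S"
proof -
  have "gexp (t *\<^sub>R (g ** X ** g')) = g ** gexp (t *\<^sub>R X) ** g'" for t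
    using gexp_conj[of g' g "t *\<^sub>R X"] assms by (simp add: matrix_mul_scaleR_left matrix_mul_scaleR_right)
  moreover have "mult_closed (zclosure S)" by (rule mult_closed_zclosure[OF S])
  ultimately show ?thesis
    using X assms unfolding tangent_gexp_iff[OF S] by (simp add: mult_closed_def)
qed

lemma ad_vector_derivative:
  fixes X Y :: "'a::{real_normed_field,euclidean_space} ^ 'n ^ 'n"
  shows "((\<lambda>t. gexp (t *\<^sub>R Y) ** X ** gexp ((-t) *\<^sub>R Y)) has_vector_derivative (Y ** X - X ** Y)) (at 0)"
proof -
  have "((\<lambda>t. gexp (t *\<^sub>R (- Y))) has_vector_derivative (- Y)) (at 0)" by (rule gexp_vector_derivative_0)
  from has_vector_derivative_matmul[OF has_vector_derivative_matmul_right[OF gexp_vector_derivative_0[of Y], of X] this]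
  show ?thesis by (simp add: gexp_zero matrix_mul_uminus_right)
qed

text \<open>The bracket is the derivative of the adjoint action, which preserves the tangent
  space.\<close>

lemma tangent_bracket:
  assumes S: "mult_closed S" and X: "X \<in> tangent S" and Y: "Y \<in> tangent S"
  shows "Y ** X - X ** Y \<in> tangent S"
proof (rule subspace_closed_derivative[OF subspace_tangent _ ad_vector_derivative])
  fix t
  show "gexp (t *\<^sub>R Y) ** X ** gexp ((- t) *\<^sub>R Y) \<in> tangent S"
    by (rule tangent_Ad[OF S])
      (use Y[unfolded tangent_gexp_iff[OF S]] X gexp_inverse[of "t *\<^sub>R Y"] in \<open>auto simp del: scaleR_minus_left\<close>, simp_all)
qed

section \<open>Subgroups with full tangent space\<close>

text \<open>The matrices \<open>X a b\<close> are the orthogonal projections of the unit matrices to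
  the tangent space. The complementary projection is given by differentials of elements
  \<open>q c d\<close> of the ideal, so linear algebra at the identity lifts to equations of
  \<open>S\<close>.\<close>

lemma tangent_complement:
  fixes S :: "(complex ^ 'n ^ 'n) set"
  obtains X q where "\<And>a b. X a b \<in> tangent S" "\<And>c d. q c d \<in> vanishing S"
    "\<And>V c d. V $ c $ d - (\<Sum>a\<in>UNIV. \<Sum>b\<in>UNIV. V $ a $ b * X a b $ c $ d) = pder (q c d) (mat 1) V"
proof -
  \<comment> \<open>Conjugation turns the real part of the differential of \<open>p\<close> into the
    inner product with \<open>grad p\<close>.\<close>
  define grad where "grad p = (\<chi> a b. cnj (pder p (mat 1) (unit_mat a b)))"
    for p :: "complex ^ 'n ^ 'n \<Rightarrow> complex"
  define Gr where "Gr = grad ` vanishing S"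
  have pd: "pder p (mat 1) V = (\<Sum>a\<in>UNIV. \<Sum>b\<in>UNIV. cnj (grad p $ a $ b) * V $ a $ b)"
    if "p \<in> vanishing S" for p V
    using that pder_expand[of p "mat 1" V] by (simp add: grad_def vanishing_def mult.commute)
  have re: "grad p \<bullet> V = Re (pder p (mat 1) V)" if "p \<in> vanishing S" for p V
    using pd[OF that, of V] by (simp add: inner_vec_def inner_complex_def)
  have subGr: "subspace Gr"
    unfolding subspace_def
  proof (intro conjI ballI allI)
    have "(\<lambda>_. 0) \<in> vanishing S" by (auto simp: vanishing_def intro: pfun_const)
    moreover have "grad (\<lambda>_. 0) = 0" by (simp add: grad_def pder_const vec_eq_iff)
    ultimately show "0 \<in> Gr" unfolding Gr_def by force
  next
    fix x y assume "x \<in> Gr" "y \<in> Gr"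
    then obtain p q where pq: "p \<in> vanishing S" "q \<in> vanishing S" "x = grad p" "y = grad q"
      by (auto simp: Gr_def)
    then have "(\<lambda>A. p A + q A) \<in> vanishing S" by (auto simp: vanishing_def intro: poly_fun.add)
    moreover have "grad (\<lambda>A. p A + q A) = x + y"
      using pq by (simp add: grad_def pder_add vanishing_def vec_eq_iff)
    ultimately show "x + y \<in> Gr" unfolding Gr_def by force
  next
    fix c :: real and x assume "x \<in> Gr"
    then obtain p where p: "p \<in> vanishing S" "x = grad p" by (auto simp: Gr_def)
    then have "(\<lambda>A. of_real c * p A) \<in> vanishing S" by (auto simp: vanishing_def intro: pfun_cmult)
    moreover have "grad (\<lambda>A. of_real c * p A) = c *\<^sub>R x"
      using p by (simp add: grad_def pder_cmult vanishing_def vec_eq_iff) (simp add: scaleR_conv_of_real)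
    ultimately show "c *\<^sub>R x \<in> Gr" unfolding Gr_def by force
  qed
  have orth: "V \<in> tangent S" if V: "\<And>w. w \<in> Gr \<Longrightarrow> orthogonal V w" for V
    unfolding tangent_def
  proof (intro CollectI ballI)
    fix p assume p: "p \<in> vanishing S"
    \<comment> \<open>The inner product sees only real parts; the multiple \<open>\<i> * p\<close>
      supplies the imaginary part.\<close>
    then have ip: "(\<lambda>A. \<i> * p A) \<in> vanishing S" by (auto simp: vanishing_def intro: pfun_cmult)
    have "Re (pder p (mat 1) V) = 0"
      using V[of "grad p"] p re[OF p, of V] by (auto simp: Gr_def orthogonal_def inner_commute)
    moreover have "Re (pder (\<lambda>A. \<i> * p A) (mat 1) V) = 0"
      using V[of "grad (\<lambda>A. \<i> * p A)"] ip re[OF ip, of V] by (auto simp: Gr_def orthogonal_def inner_commute)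
    then have "Im (pder p (mat 1) V) = 0" using p by (simp add: pder_cmult vanishing_def)
    ultimately show "pder p (mat 1) V = 0" by (simp add: complex_eq_iff)
  qed
  have "\<exists>X q. X \<in> tangent S \<and> q \<in> vanishing S \<and> unit_mat a b = grad q + X" for a b :: 'n
  proof -
    obtain y z where yz: "y \<in> span Gr" "\<And>w. w \<in> span Gr \<Longrightarrow> orthogonal z w" "unit_mat a b = y + z"
      using orthogonal_subspace_decomp_exists[of Gr "unit_mat a b"] by blast
    have "y \<in> Gr" using yz(1) subGr by (simp add: span_eq_iff[THEN iffD2])
    moreover have "z \<in> tangent S" by (rule orth) (use yz(2) span_base in blast)
    ultimately show ?thesis using yz(3) by (auto simp: Gr_def)
  qed
  then obtain X q where X: "\<And>a b. X a b \<in> tangent S" and q: "\<And>a b. q a b \<in> vanishing S"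
    and e: "\<And>a b. unit_mat a b = grad (q a b) + X a b" by metis
  \<comment> \<open>The differential of \<open>q c d\<close> kills \<open>X a b\<close>, so only a
    Gram matrix of gradients remains; its Hermitian symmetry exchanges the two index pairs in
    \<open>sym\<close>.\<close>
  have g: "pder (q c d) (mat 1) (unit_mat a b) = (\<Sum>i\<in>UNIV. \<Sum>j\<in>UNIV. cnj (grad (q c d) $ i $ j) * grad (q a b) $ i $ j)"
    for a b c d
  proof -
    have "pder (q c d) (mat 1) (unit_mat a b) = pder (q c d) (mat 1) (grad (q a b)) + pder (q c d) (mat 1) (X a b)"
      unfolding e[of a b] using q[of c d] by (simp add: linear_add[OF linear_pder] vanishing_def)
    moreover have "pder (q c d) (mat 1) (X a b) = 0" using X q by (auto simp: tangent_def)
    ultimately show ?thesis using pd[OF q[of c d]] by simp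
  qed
  have sym: "pder (q c d) (mat 1) (unit_mat a b) = grad (q a b) $ c $ d" for a b c d
  proof -
    have "cnj (grad (q a b) $ c $ d) = pder (q a b) (mat 1) (unit_mat c d)" by (simp add: grad_def)
    also have "\<dots> = cnj (pder (q c d) (mat 1) (unit_mat a b))" unfolding g by (simp add: mult.commute)
    finally show ?thesis by simp
  qed
  show ?thesis
  proof (rule that[OF X q])
    fix V :: "complex ^ 'n ^ 'n" and c d
    have "pder (q c d) (mat 1) V = (\<Sum>a\<in>UNIV. \<Sum>b\<in>UNIV. V $ a $ b * grad (q a b) $ c $ d)"
      using pder_expand[of "q c d" "mat 1" V] q[of c d] by (simp add: sym vanishing_def)
    also have "\<dots> = (\<Sum>a\<in>UNIV. \<Sum>b\<in>UNIV. V $ a $ b * unit_mat a b $ c $ d) - (\<Sum>a\<in>UNIV. \<Sum>b\<in>UNIV. V $ a $ b * X a b $ c $ d)"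
      by (simp add: e sum_subtractf[symmetric] algebra_simps)
    also have "(\<Sum>a\<in>UNIV. \<Sum>b\<in>UNIV. V $ a $ b * unit_mat a b $ c $ d) = V $ c $ d"
      using arg_cong[OF mat_unit_expansion[of V], of "\<lambda>W. W $ c $ d"] by simp
    finally show "V $ c $ d - (\<Sum>a\<in>UNIV. \<Sum>b\<in>UNIV. V $ a $ b * X a b $ c $ d) = pder (q c d) (mat 1) V" ..
  qed
qed

text \<open>The Rees algebra of the maximal ideal at the identity matrix: a polynomial \<open>p\<close> lies in the
  \<open>k\<close>-th power of that ideal when \<open>s\<^sup>k p(A)\<close> lies in the Rees algebra.\<close>

inductive_set rees :: "((complex ^ 'n ^ 'n) \<times> complex \<Rightarrow> complex) set" where
  const: "(\<lambda>_. c) \<in> rees"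
| entry: "(\<lambda>(A, s). A $ i $ j) \<in> rees"
| gen: "(\<lambda>(A, s). s * (A $ i $ j - mat 1 $ i $ j)) \<in> rees"
| add: "P \<in> rees \<Longrightarrow> Q \<in> rees \<Longrightarrow> (\<lambda>x. P x + Q x) \<in> rees"
| mult: "P \<in> rees \<Longrightarrow> Q \<in> rees \<Longrightarrow> (\<lambda>x. P x * Q x) \<in> rees"

lemma rees_cmult: "P \<in> rees \<Longrightarrow> (\<lambda>x. c * P x) \<in> rees"
  by (intro rees.mult rees.const)

lemma rees_diff: "P \<in> rees \<Longrightarrow> Q \<in> rees \<Longrightarrow> (\<lambda>x. P x - Q x) \<in> rees"
  using rees.add[OF _ rees_cmult[of Q "-1"], of P] by simp

lemma rees_sum: "finite I \<Longrightarrow> (\<And>i. i \<in> I \<Longrightarrow> P i \<in> rees) \<Longrightarrow> (\<lambda>x. \<Sum>i\<in>I. P i x) \<in> rees"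
  by (induction I rule: finite_induct) (auto intro: rees.intros)

lemma is_subring_rees: "is_subring rees"
  unfolding is_subring_def zero_fun_def one_fun_def plus_fun_def times_fun_def fun_Compl_def
  using rees_cmult[of _ "-1"] by (auto intro: rees.intros)

lemma noeth_rees: "noeth (rees :: ((complex ^ 'n ^ 'n) \<times> complex \<Rightarrow> complex) set)"
proof (rule noeth_finitely_generated[OF const_funs_noeth is_subring_rees])
  let ?E = "\<lambda>(i, j). (\<lambda>(A, s). A $ i $ j) :: (complex ^ 'n ^ 'n) \<times> complex \<Rightarrow> complex"
  let ?Z = "\<lambda>(i, j). (\<lambda>(A, s). s * (A $ i $ j - mat 1 $ i $ j)) :: (complex ^ 'n ^ 'n) \<times> complex \<Rightarrow> complex"
  show "range (\<lambda>c _. c) \<subseteq> rees" by (auto intro: rees.const)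
  show "finite (range ?E \<union> range ?Z)" by simp
  show "range ?E \<union> range ?Z \<subseteq> rees" by (auto intro: rees.entry rees.gen)
  fix S :: "((complex ^ 'n ^ 'n) \<times> complex \<Rightarrow> complex) set"
  assume S: "is_subring S" "range (\<lambda>c _. c) \<subseteq> S" "range ?E \<union> range ?Z \<subseteq> S"
  show "rees \<subseteq> S"
  proof
    fix p :: "(complex ^ 'n ^ 'n) \<times> complex \<Rightarrow> complex" assume "p \<in> rees"
    then show "p \<in> S"
    proof induction
      case (entry i j)
      have "?E (i, j) \<in> S" using S(3) by blast
      then show ?case by simp
    next
      case (gen i j)
      have "?Z (i, j) \<in> S" using S(3) by blast
      then show ?case by simp
    next
      case (add p q)
      then show ?case using is_subringD(3)[OF S(1), of p q] by (simp add: plus_fun_def)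
    next
      case (mult p q)
      then show ?case using is_subringD(4)[OF S(1), of p q] by (simp add: times_fun_def)
    qed (use S(2) in auto)
  qed
qed

lemma rees_pfun: "p \<in> pfun \<Longrightarrow> (\<lambda>(A, s). p A) \<in> rees"
proof (induction rule: poly_fun.induct)
  case (add p q)
  then show ?case using rees.add by (fastforce simp: case_prod_unfold)
next
  case (mult p q)
  then show ?case using rees.mult by (fastforce simp: case_prod_unfold)
next
  case (entry i j)
  then show ?case by (rule rees.entry)
qed (auto intro: rees.const simp: case_prod_unfold)

lemma rees_first_order: "p \<in> pfun \<Longrightarrow> (\<lambda>(A, s). s * (p A - p (mat 1))) \<in> rees"
proof (induction rule: poly_fun.induct)
  case (const c)
  show ?case using rees.const[of 0] by (simp add: case_prod_unfold)
next
  case (entry i j)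
  show ?case by (rule rees.gen)
next
  case (add p q)
  have "(\<lambda>x. (case x of (A, s) \<Rightarrow> s * (p A - p (mat 1))) + (case x of (A, s) \<Rightarrow> s * (q A - q (mat 1)))) \<in> rees"
    by (rule rees.add[OF add.IH])
  then show ?case by (simp add: case_prod_unfold algebra_simps)
next
  case (mult p q)
  have "(\<lambda>x. (case x of (A, s) \<Rightarrow> s * (p A - p (mat 1))) * (case x of (A, s) \<Rightarrow> q A)
      + p (mat 1) * (case x of (A, s) \<Rightarrow> s * (q A - q (mat 1)))) \<in> rees"
    by (intro rees.add rees.mult rees.const mult.IH rees_pfun mult.hyps)
  then show ?case by (simp add: case_prod_unfold algebra_simps)
qed

text \<open>Taylor's formula with remainder in the square of the maximal ideal. For a product, the
  only new remainder term is the product of the two first-order differences.\<close>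

lemma rees_second_order:
  "p \<in> pfun \<Longrightarrow> (\<lambda>(A, s). s\<^sup>2 * (p A - p (mat 1) - pder p (mat 1) (A - mat 1))) \<in> rees"
proof (induction rule: poly_fun.induct)
  case (const c)
  show ?case using rees.const[of 0] by (simp add: case_prod_unfold pder_const)
next
  case (entry i j)
  show ?case using rees.const[of 0] by (simp add: case_prod_unfold pder_entry)
next
  case (add p q)
  have "(\<lambda>x. (case x of (A, s) \<Rightarrow> s\<^sup>2 * (p A - p (mat 1) - pder p (mat 1) (A - mat 1)))
    + (case x of (A, s) \<Rightarrow> s\<^sup>2 * (q A - q (mat 1) - pder q (mat 1) (A - mat 1)))) \<in> rees"
    by (rule rees.add[OF add.IH])
  then show ?case by (simp add: case_prod_unfold algebra_simps pder_add add.hyps)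
next
  case (mult p q)
  have "(\<lambda>x. q (mat 1) * (case x of (A, s) \<Rightarrow> s\<^sup>2 * (p A - p (mat 1) - pder p (mat 1) (A - mat 1)))
      + p (mat 1) * (case x of (A, s) \<Rightarrow> s\<^sup>2 * (q A - q (mat 1) - pder q (mat 1) (A - mat 1)))
      + (case x of (A, s) \<Rightarrow> s * (p A - p (mat 1))) * (case x of (A, s) \<Rightarrow> s * (q A - q (mat 1)))) \<in> rees"
    by (intro rees.add rees.mult rees.const mult.IH rees_first_order mult.hyps)
  then show ?case by (simp add: case_prod_unfold algebra_simps pder_mult mult.hyps power2_eq_square)
qed

text \<open>The coefficient of the \<open>j\<close>-th power of \<open>s\<close> lies in the
  \<open>j\<close>-th power of the maximal ideal. What is kept of this is that it vanishes at the
  identity for \<open>j > 0\<close>, which is the condition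
  \<open>degree (C (mat 1)) = 0\<close>.\<close>

lemma rees_coeffs:
  "P \<in> rees \<Longrightarrow> \<exists>C. (\<forall>j. (\<lambda>A. coeff (C A) j) \<in> pfun) \<and> degree (C (mat 1)) = 0 \<and> (\<forall>A s. P (A, s) = poly (C A) s)"
proof (induction rule: rees.induct)
  case (const c)
  show ?case by (rule exI[of _ "\<lambda>_. [:c:]"]) (auto intro: pfun_const)
next
  case (entry i j)
  have "(\<lambda>A. coeff [:A $ i $ j:] k) \<in> pfun" for k
    by (cases k) (auto intro: pfun_const poly_fun.entry)
  then show ?case by (intro exI[of _ "\<lambda>A. [:A $ i $ j:]"]) auto
next
  case (gen i j)
  have "(\<lambda>A. coeff [:0, A $ i $ j - mat 1 $ i $ j:] k) \<in> pfun" for k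
  proof (cases k)
    case (Suc m)
    then show ?thesis by (cases m) (auto intro: pfun_const pfun_diff poly_fun.entry)
  qed (auto intro: pfun_const)
  then show ?case by (intro exI[of _ "\<lambda>A. [:0, A $ i $ j - mat 1 $ i $ j:]"]) auto
next
  case (add P Q)
  then obtain C D where CD: "\<forall>j. (\<lambda>A. coeff (C A) j) \<in> pfun" "degree (C (mat 1)) = 0" "\<forall>A s. P (A, s) = poly (C A) s"
    "\<forall>j. (\<lambda>A. coeff (D A) j) \<in> pfun" "degree (D (mat 1)) = 0" "\<forall>A s. Q (A, s) = poly (D A) s" by blast
  have "degree (C (mat 1) + D (mat 1)) = 0" using degree_add_le[of "C (mat 1)" 0 "D (mat 1)"] CD by simp
  then show ?case using CD by (intro exI[of _ "\<lambda>A. C A + D A"]) (auto intro: poly_fun.add)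
next
  case (mult P Q)
  then obtain C D where CD: "\<forall>j. (\<lambda>A. coeff (C A) j) \<in> pfun" "degree (C (mat 1)) = 0" "\<forall>A s. P (A, s) = poly (C A) s"
    "\<forall>j. (\<lambda>A. coeff (D A) j) \<in> pfun" "degree (D (mat 1)) = 0" "\<forall>A s. Q (A, s) = poly (D A) s" by blast
  have "degree (C (mat 1) * D (mat 1)) = 0" using degree_mult_le[of "C (mat 1)" "D (mat 1)"] CD by simp
  then show ?case using CD
    by (intro exI[of _ "\<lambda>A. C A * D A"]) (auto simp: coeff_mult intro!: poly_fun.mult pfun_sum)
qed

lemma idl_image_sum:
  assumes "x \<in> idl R (f ` {..<K::nat})" "is_subring R"
  shows "\<exists>Q. (\<forall>i. Q i \<in> R) \<and> x = (\<Sum>i<K. Q i * f i)"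
  using assms(1)
proof induction
  case zero
  show ?case by (rule exI[of _ "\<lambda>_. 0"]) (use is_subringD[OF assms(2)] in auto)
next
  case (step x c s)
  then obtain Q i where Q: "\<forall>i. Q i \<in> R" "x = (\<Sum>i<K. Q i * f i)" and i: "i < K" "s = f i" by auto
  have "(\<Sum>j<K. (Q(i := Q i + c)) j * f j) = (\<Sum>j<K. Q j * f j + (if j = i then c * f i else 0))"
    by (rule sum.cong) (auto simp: algebra_simps)
  also have "\<dots> = x + c * s" using i by (simp add: sum.distrib Q(2))
  finally show ?case using Q step is_subringD[OF assms(2)] by (intro exI[of _ "Q(i := Q i + c)"]) auto
qed

section \<open>Linear algebraic groups and their ideals near the identity\<close>

lemma linear_algebraic_groupD:
  assumes "linear_algebraic_group H"
  shows "mult_closed H" "\<And>A. A \<in> H \<Longrightarrow> invertible A"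
    "\<And>A. A \<in> zclosure H \<Longrightarrow> invertible A \<Longrightarrow> A \<in> H"
    "\<And>A. A \<in> H \<Longrightarrow> \<exists>B\<in>H. A ** B = mat 1 \<and> B ** A = mat 1"
proof -
  have sub: "subgroup H GL" and cl: "closedin (subtopology zariski (carrier GL)) H"
    using assms by (auto simp: linear_algebraic_group_def)
  show "mult_closed H"
    using subgroup.m_closed[OF sub] subgroup.one_closed[OF sub] by (auto simp: mult_closed_def GL_def)
  show inv: "invertible A" if "A \<in> H" for A
    using subgroup.subset[OF sub] that by (auto simp: GL_def)
  show "A \<in> H" if A: "A \<in> zclosure H" "invertible A" for A
  proof -
    obtain T where T: "closedin zariski T" "H = T \<inter> carrier GL" using cl by (auto simp: closedin_subtopology)
    then have "openin zariski (UNIV - T)" by (simp add: closedin_def)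
    then obtain P where P: "P \<subseteq> pfun" "UNIV - T = {A. \<exists>p\<in>P. p A \<noteq> 0}" unfolding openin_zariski by blast
    have "p A = 0" if "p \<in> P" for p
    proof -
      have "\<forall>B\<in>H. p B = 0" using P(2) T(2) that by blast
      then have "p \<in> vanishing H" using P(1) that by (auto simp: vanishing_def)
      then show ?thesis using A by (auto simp: zclosure_def)
    qed
    then have "A \<in> T" using P(2) by blast
    then show ?thesis using A T(2) by (auto simp: GL_def)
  qed
  show "\<exists>B\<in>H. A ** B = mat 1 \<and> B ** A = mat 1" if A: "A \<in> H" for A
  proof (rule bexI)
    have c: "A \<in> carrier GL" using subgroup.subset[OF sub] A by blast
    show "inv\<^bsub>GL\<^esub> A \<in> H" by (rule subgroup.m_inv_closed[OF sub A])
    show "A ** inv\<^bsub>GL\<^esub> A = mat 1 \<and> inv\<^bsub>GL\<^esub> A ** A = mat 1"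
      using group.r_inv[OF group_GL c] group.l_inv[OF group_GL c] by (simp add: GL_def)
  qed
qed

lemma gexp_in_group:
  assumes "linear_algebraic_group H" "X \<in> tangent H"
  shows "gexp X \<in> H"
proof (rule linear_algebraic_groupD(3)[OF assms(1)])
  show "gexp X \<in> zclosure H"
    by (rule gexp_in_zclosure[OF linear_algebraic_groupD(1)[OF assms(1)] assms(2)])
  show "invertible (gexp X)" using gexp_inverse unfolding invertible_def by blast
qed

text \<open>The vector field \<open>A \<mapsto> A lp(A - 1)\<close>, with \<open>lp\<close> a projection onto the tangent space, is
  tangent to \<open>H\<close> and acts on the \<open>k\<close>-th power of the maximal ideal modulo the next one as
  multiplication by \<open>k\<close>, while it raises the order of elements of \<open>vanishing S\<close> by one.\<close>

lemma vanishing_in_rees: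
  fixes H S :: "(complex ^ 'n ^ 'n) set"
  assumes H: "linear_algebraic_group H" and S: "mult_closed S" and T: "tangent H \<subseteq> tangent S"
    and p: "p \<in> vanishing S"
  shows "\<exists>P\<in>rees. \<forall>A\<in>H. \<forall>s. P (A, s) = s ^ k * p A"
proof -
  obtain X q where X: "\<And>a b. X a b \<in> tangent H" and q: "\<And>c d. q c d \<in> vanishing H"
    and Xq: "\<And>V c d. V $ c $ d - (\<Sum>a\<in>UNIV. \<Sum>b\<in>UNIV. V $ a $ b * X a b $ c $ d) = pder (q c d) (mat 1) V"
    using tangent_complement[of H] by blast
  define lp where "lp Z = (\<Sum>a\<in>UNIV. \<Sum>b\<in>UNIV. map_matrix ((*) (Z $ a $ b)) (X a b))" for Z :: "complex ^ 'n ^ 'n"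
  have lp_entry: "lp Z $ c $ d = (\<Sum>a\<in>UNIV. \<Sum>b\<in>UNIV. Z $ a $ b * X a b $ c $ d)" for Z c d
    by (simp add: lp_def)
  have lpT: "lp Z \<in> tangent H" for Z
    unfolding lp_def by (intro subspace_sum subspace_tangent tangent_cscale X)
  have slp: "(\<lambda>(A, s). s * lp (A - mat 1) $ c $ d) \<in> rees" for c d
  proof -
    have "(\<lambda>x. \<Sum>a\<in>UNIV. \<Sum>b\<in>UNIV. X a b $ c $ d * (case x of (A, s) \<Rightarrow> s * (A $ a $ b - mat 1 $ a $ b))) \<in> rees"
      by (intro rees_sum rees.mult rees.const rees.gen) auto
    then show ?thesis by (simp add: case_prod_unfold lp_entry sum_distrib_left mult_ac)
  qed
  have sZlp: "(\<lambda>(A, s). s\<^sup>2 * ((A - mat 1) ** lp (A - mat 1)) $ c $ d) \<in> rees" for c d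
  proof -
    have "(\<lambda>x. \<Sum>k\<in>UNIV. (case x of (A, s) \<Rightarrow> s * (A $ c $ k - mat 1 $ c $ k)) * (case x of (A, s) \<Rightarrow> s * lp (A - mat 1) $ k $ d)) \<in> rees"
      by (intro rees_sum rees.mult rees.gen slp) auto
    then show ?thesis
      by (simp add: case_prod_unfold matrix_matrix_mult_def sum_distrib_left power2_eq_square mult_ac)
  qed
  \<comment> \<open>\<open>D\<close> is the derivative along \<open>A lp(A - 1)\<close> in the
    matrix variable and \<open>- s\<close> in the other, so an element \<open>s^k p\<close> goes to
    \<open>s^k\<close> times (derivative of \<open>p\<close> minus \<open>k p\<close>). The second
    conjunct says that, on \<open>H\<close>, this gains one order.\<close>
  have derivation: "\<exists>D. (\<forall>A s \<gamma>. \<gamma> 0 = A \<longrightarrow>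
        (\<forall>i j. ((\<lambda>t. \<gamma> t $ i $ j) has_field_derivative (A ** lp (A - mat 1)) $ i $ j) (at 0)) \<longrightarrow>
        ((\<lambda>t. P (\<gamma> t, s - t * s)) has_field_derivative D (A, s)) (at 0)) \<and>
      (\<exists>Q\<in>rees. \<forall>A\<in>H. \<forall>s. Q (A, s) = s * D (A, s))" if "P \<in> rees" for P
    using that
  proof induction
    case (const c)
    show ?case
      by (rule exI[of _ "\<lambda>_. 0"]) (auto intro!: bexI[of _ "\<lambda>_. 0"] rees.const)
  next
    case (entry i j)
    let ?D = "\<lambda>(A, s::complex). (A ** lp (A - mat 1)) $ i $ j"
    have "(\<lambda>x. \<Sum>k\<in>UNIV. (case x of (A, s) \<Rightarrow> A $ i $ k) * (case x of (A, s) \<Rightarrow> s * lp (A - mat 1) $ k $ j)) \<in> rees"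
      by (intro rees_sum rees.mult rees.entry slp) auto
    then have "(\<lambda>x. (case x of (A, s) \<Rightarrow> s) * ?D x) \<in> rees"
      by (simp add: case_prod_unfold matrix_matrix_mult_def sum_distrib_left mult_ac)
    then have "\<exists>Q\<in>rees. \<forall>A\<in>H. \<forall>s. Q (A, s) = s * ?D (A, s)"
      by (rule bexI[rotated]) auto
    then show ?case by (intro exI[of _ ?D]) auto
  next
    case (gen i j)
    let ?D = "\<lambda>(A, s). s * (A ** lp (A - mat 1)) $ i $ j - s * (A $ i $ j - mat 1 $ i $ j)"
    \<comment> \<open>On \<open>H\<close> the function \<open>q i j\<close> vanishes, so its linear
      part, which is the \<open>(i, j)\<close> entry of \<open>A - 1 - lp(A - 1)\<close>, equals
      minus a second-order remainder.\<close>
    let ?Q = "\<lambda>x. (case x of (A, s) \<Rightarrow> s\<^sup>2 * ((A - mat 1) ** lp (A - mat 1)) $ i $ j)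
       + (case x of (A, s) \<Rightarrow> s\<^sup>2 * (q i j A - q i j (mat 1) - pder (q i j) (mat 1) (A - mat 1)))"
    have "?Q \<in> rees"
      using q[of i j] by (intro rees.add sZlp rees_second_order) (simp add: vanishing_def)
    moreover have Qeq: "?Q (A, s) = s * ?D (A, s)" if A: "A \<in> H" for A s
    proof -
      have m1: "mat 1 \<in> H" using linear_algebraic_groupD(1)[OF H] by (simp add: mult_closed_def)
      have "q i j A = 0" "q i j (mat 1) = 0" using q[of i j] A m1 by (auto simp: vanishing_def)
      moreover have "pder (q i j) (mat 1) (A - mat 1) = (A $ i $ j - mat 1 $ i $ j) - lp (A - mat 1) $ i $ j"
        using Xq[of "A - mat 1" i j] by (simp add: lp_entry)
      moreover have "(A ** lp (A - mat 1)) $ i $ j = ((A - mat 1) ** lp (A - mat 1)) $ i $ j + lp (A - mat 1) $ i $ j"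
      proof -
        have "A ** lp (A - mat 1) = ((A - mat 1) + mat 1) ** lp (A - mat 1)" by simp
        also have "\<dots> = (A - mat 1) ** lp (A - mat 1) + lp (A - mat 1)"
          by (simp only: bounded_bilinear.add_left[OF bounded_bilinear_matrix_mult] matrix_mul_lid)
        finally show ?thesis by simp
      qed
      ultimately show ?thesis unfolding prod.case by (simp only: power2_eq_square) (simp add: algebra_simps)
    qed
    ultimately have "\<exists>Q\<in>rees. \<forall>A\<in>H. \<forall>s. Q (A, s) = s * ?D (A, s)"
      by (intro bexI[of _ ?Q]) auto
    moreover have "((\<lambda>t. (s - t * s) * (\<gamma> t $ i $ j - mat 1 $ i $ j)) has_field_derivative ?D (A, s)) (at 0)"
      if "\<gamma> 0 = A" "\<forall>i j. ((\<lambda>t. \<gamma> t $ i $ j) has_field_derivative (A ** lp (A - mat 1)) $ i $ j) (at 0)" for A s \<gamma>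
      using that by (auto intro!: derivative_eq_intros simp: algebra_simps)
    ultimately show ?case by (intro exI[of _ ?D]) auto
  next
    case (add P Q)
    then obtain D D' Q1 Q2 where D: "\<forall>A s \<gamma>. \<gamma> 0 = A \<longrightarrow>
        (\<forall>i j. ((\<lambda>t. \<gamma> t $ i $ j) has_field_derivative (A ** lp (A - mat 1)) $ i $ j) (at 0)) \<longrightarrow>
        ((\<lambda>t. P (\<gamma> t, s - t * s)) has_field_derivative D (A, s)) (at 0)"
      "\<forall>A s \<gamma>. \<gamma> 0 = A \<longrightarrow>
        (\<forall>i j. ((\<lambda>t. \<gamma> t $ i $ j) has_field_derivative (A ** lp (A - mat 1)) $ i $ j) (at 0)) \<longrightarrow>
        ((\<lambda>t. Q (\<gamma> t, s - t * s)) has_field_derivative D' (A, s)) (at 0)"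
      and Q: "Q1 \<in> rees" "\<forall>A\<in>H. \<forall>s. Q1 (A, s) = s * D (A, s)" "Q2 \<in> rees" "\<forall>A\<in>H. \<forall>s. Q2 (A, s) = s * D' (A, s)"
      by blast
    have "(\<lambda>x. Q1 x + Q2 x) \<in> rees" by (intro rees.add Q)
    then have "\<exists>R\<in>rees. \<forall>A\<in>H. \<forall>s. R (A, s) = s * (D (A, s) + D' (A, s))"
      by (rule bexI[rotated]) (use Q in \<open>auto simp: algebra_simps\<close>)
    then show ?case using D by (intro exI[of _ "\<lambda>x. D x + D' x"]) (auto intro!: DERIV_add)
  next
    case (mult P Q)
    then obtain D D' Q1 Q2 where D: "\<forall>A s \<gamma>. \<gamma> 0 = A \<longrightarrow>
        (\<forall>i j. ((\<lambda>t. \<gamma> t $ i $ j) has_field_derivative (A ** lp (A - mat 1)) $ i $ j) (at 0)) \<longrightarrow>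
        ((\<lambda>t. P (\<gamma> t, s - t * s)) has_field_derivative D (A, s)) (at 0)"
      "\<forall>A s \<gamma>. \<gamma> 0 = A \<longrightarrow>
        (\<forall>i j. ((\<lambda>t. \<gamma> t $ i $ j) has_field_derivative (A ** lp (A - mat 1)) $ i $ j) (at 0)) \<longrightarrow>
        ((\<lambda>t. Q (\<gamma> t, s - t * s)) has_field_derivative D' (A, s)) (at 0)"
      and Q: "Q1 \<in> rees" "\<forall>A\<in>H. \<forall>s. Q1 (A, s) = s * D (A, s)" "Q2 \<in> rees" "\<forall>A\<in>H. \<forall>s. Q2 (A, s) = s * D' (A, s)"
      by blast
    let ?D = "\<lambda>x. D x * Q x + D' x * P x"
    have "(\<lambda>x. Q1 x * Q x + Q2 x * P x) \<in> rees" by (intro rees.add rees.mult Q mult.hyps)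
    then have "\<exists>R\<in>rees. \<forall>A\<in>H. \<forall>s. R (A, s) = s * ?D (A, s)"
      by (rule bexI[rotated]) (use Q in \<open>auto simp: algebra_simps\<close>)
    moreover have "((\<lambda>t. P (\<gamma> t, s - t * s) * Q (\<gamma> t, s - t * s)) has_field_derivative ?D (A, s)) (at 0)"
      if "\<gamma> 0 = A" "\<forall>i j. ((\<lambda>t. \<gamma> t $ i $ j) has_field_derivative (A ** lp (A - mat 1)) $ i $ j) (at 0)" for A s \<gamma>
      using DERIV_mult[OF D(1)[rule_format, of \<gamma> A s] D(2)[rule_format, of \<gamma> A s]] that by simp
    ultimately show ?case by (intro exI[of _ ?D]) auto
  qed
  \<comment> \<open>Write \<open>k p\<close> as the derivative of \<open>p\<close> minus (derivative
    of \<open>p\<close> minus \<open>k p\<close>). The first is a sum of entries of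
    \<open>A - 1\<close> times elements of \<open>vanishing S\<close>, of order \<open>k\<close> by
    induction; the second has gained an order by \<open>derivation\<close>. Division by
    \<open>k\<close> requires the case of order one to be settled separately.\<close>
  have step: "\<exists>P\<in>rees. \<forall>A\<in>H. \<forall>s. P (A, s) = s ^ Suc k * p A"
    if k: "k > 0" and IH: "\<And>p. p \<in> vanishing S \<Longrightarrow> \<exists>P\<in>rees. \<forall>A\<in>H. \<forall>s. P (A, s) = s ^ k * p A"
      and p: "p \<in> vanishing S" for k p
  proof -
    have pf: "p \<in> pfun" using p by (simp add: vanishing_def)
    obtain P where P: "P \<in> rees" "\<And>A s. A \<in> H \<Longrightarrow> P (A, s) = s ^ k * p A" using IH[OF p] by blast
    have "\<exists>R\<in>rees. \<forall>A\<in>H. \<forall>s. R (A, s) = s ^ k * pder p A (A ** X a b)" for a b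
      using X T by (intro IH tangent_derivation[OF S _ p]) auto
    then obtain R where R: "\<And>a b. R a b \<in> rees" "\<And>a b A s. A \<in> H \<Longrightarrow> R a b (A, s) = s ^ k * pder p A (A ** X a b)"
      by metis
    obtain D Q where D: "\<And>A s \<gamma>. \<gamma> 0 = A \<Longrightarrow>
        (\<forall>i j. ((\<lambda>t. \<gamma> t $ i $ j) has_field_derivative (A ** lp (A - mat 1)) $ i $ j) (at 0)) \<Longrightarrow>
        ((\<lambda>t. P (\<gamma> t, s - t * s)) has_field_derivative D (A, s)) (at 0)"
      and Q: "Q \<in> rees" "\<And>A s. A \<in> H \<Longrightarrow> Q (A, s) = s * D (A, s)"
      using derivation[OF P(1)] by blast
    have D_eq: "D (A, s) = s ^ k * pder p A (A ** lp (A - mat 1)) - of_nat k * s ^ k * p A" if A: "A \<in> H" for A s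
    proof -
      let ?Y = "lp (A - mat 1)"
      \<comment> \<open>This curve has the required velocity and stays in \<open>H\<close>, where
        \<open>P\<close> is known to be \<open>s^k p\<close>; so \<open>D\<close> can be computed by
        the product rule.\<close>
      let ?\<gamma> = "\<lambda>t. A ** gexp (map_matrix ((*) t) ?Y)"
      have \<gamma>0: "?\<gamma> 0 = A"
      proof -
        have "map_matrix ((*) 0) ?Y = 0" by (simp add: vec_eq_iff)
        then show ?thesis by (simp only: gexp_zero matrix_mul_rid)
      qed
      have g0: "gexp (map_matrix ((*) 0) ?Y) = mat 1"
      proof -
        have "map_matrix ((*) 0) ?Y = 0" by (simp add: vec_eq_iff)
        then show ?thesis by (simp only: gexp_zero)
      qed
      have der: "((\<lambda>t. ?\<gamma> t $ i $ j) has_field_derivative (A ** ?Y) $ i $ j) (at 0)" for i j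
      proof -
        have "((\<lambda>t. \<Sum>k\<in>UNIV. A $ i $ k * gexp (map_matrix ((*) t) ?Y) $ k $ j) has_field_derivative
           (\<Sum>k\<in>UNIV. A $ i $ k * (gexp (map_matrix ((*) 0) ?Y) ** ?Y) $ k $ j)) (at 0)"
          by (intro DERIV_sum DERIV_cmult gexp_deriv_entry)
        then show ?thesis unfolding g0 matrix_mul_lid by (simp add: matrix_matrix_mult_def)
      qed
      have inH: "?\<gamma> t \<in> H" for t
        using linear_algebraic_groupD(1)[OF H] A gexp_in_group[OF H tangent_cscale[OF lpT]]
        by (simp add: mult_closed_def)
      have "((\<lambda>t. P (?\<gamma> t, s - t * s)) has_field_derivative D (A, s)) (at 0)"
        by (rule D) (use \<gamma>0 der in auto)
      then have d1: "((\<lambda>t. (s - t * s) ^ k * p (?\<gamma> t)) has_field_derivative D (A, s)) (at 0)"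
        by (simp add: P(2)[OF inH])
      have dp: "((\<lambda>t. p (?\<gamma> t)) has_field_derivative pder p A (A ** ?Y)) (at 0)"
        using pfun_field_derivative[OF pf der] unfolding \<gamma>0 .
      have ds: "((\<lambda>t. (s - t * s) ^ k) has_field_derivative (of_nat k * s ^ (k - 1) * (- s))) (at 0)"
        by (auto intro!: derivative_eq_intros)
      have "((\<lambda>t. (s - t * s) ^ k * p (?\<gamma> t)) has_field_derivative
          (of_nat k * s ^ (k - 1) * (- s)) * p A + pder p A (A ** ?Y) * s ^ k) (at 0)"
        using DERIV_mult[OF ds dp] unfolding \<gamma>0 by simp
      with d1 have "D (A, s) = (of_nat k * s ^ (k - 1) * (- s)) * p A + pder p A (A ** ?Y) * s ^ k"
        by (rule DERIV_unique)
      moreover have "(of_nat k * s ^ (k - 1) * (- s)) * p A = - (of_nat k * s ^ k * p A)"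
        using k by (cases k) auto
      ultimately show ?thesis by (simp only:) (simp add: algebra_simps)
    qed
    have Dp: "pder p A (A ** lp (A - mat 1)) = (\<Sum>a\<in>UNIV. \<Sum>b\<in>UNIV. (A $ a $ b - mat 1 $ a $ b) * pder p A (A ** X a b))" for A
    proof -
      have "A ** lp (A - mat 1) = (\<Sum>a\<in>UNIV. \<Sum>b\<in>UNIV. map_matrix ((*) ((A - mat 1) $ a $ b)) (A ** X a b))"
      proof -
        have *: "A ** map_matrix ((*) c) Y = map_matrix ((*) c) (A ** Y)" for c and Y :: "complex ^ 'n ^ 'n"
          by (simp add: vec_eq_iff matrix_matrix_mult_def sum_distrib_left mult_ac)
        show ?thesis unfolding lp_def bounded_bilinear.sum_right[OF bounded_bilinear_matrix_mult] * ..
      qed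
      then show ?thesis by (simp add: pder_sum[OF pf] pder_cscale[OF pf])
    qed
    let ?R = "\<lambda>x. inverse (of_nat k) * ((\<Sum>a\<in>UNIV. \<Sum>b\<in>UNIV. (case x of (A, s) \<Rightarrow> s * (A $ a $ b - mat 1 $ a $ b)) * R a b x) - Q x)"
    have R1: "?R \<in> rees" by (intro rees_cmult rees_diff rees_sum rees.mult rees.gen R Q) auto
    have R2: "?R (A, s) = s ^ Suc k * p A" if A: "A \<in> H" for A s
    proof -
      have "(\<Sum>a\<in>UNIV. \<Sum>b\<in>UNIV. (s * (A $ a $ b - mat 1 $ a $ b)) * R a b (A, s)) = s ^ Suc k * pder p A (A ** lp (A - mat 1))"
        unfolding Dp by (simp add: R(2)[OF A] sum_distrib_left mult_ac)
      then show ?thesis using k by (simp add: Q(2)[OF A] D_eq[OF A] field_simps)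
    qed
    show ?thesis by (intro bexI[OF _ R1] ballI allI) (rule R2)
  qed
  have base: "\<exists>P\<in>rees. \<forall>A\<in>H. \<forall>s. P (A, s) = s ^ 1 * p A" if "p \<in> vanishing S" for p
  proof (rule bexI)
    show "(\<lambda>(A, s). s * (p A - p (mat 1))) \<in> rees" using that by (intro rees_first_order) (simp add: vanishing_def)
    show "\<forall>A\<in>H. \<forall>s. (case (A, s) of (A, s) \<Rightarrow> s * (p A - p (mat 1))) = s ^ 1 * p A"
      using that S by (auto simp: vanishing_def mult_closed_def)
  qed
  show ?thesis
  proof (cases k)
    case 0
    show ?thesis using rees_pfun[of p] p 0 by (intro bexI[of _ "\<lambda>(A, s). p A"]) (auto simp: vanishing_def)
  next
    case (Suc m)
    have "\<exists>P\<in>rees. \<forall>A\<in>H. \<forall>s. P (A, s) = s ^ Suc m * p A" using p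
    proof (induction m arbitrary: p)
      case 0
      then show ?case using base by simp
    next
      case (Suc m)
      show ?case by (rule step[OF _ _ Suc.prems]) (use Suc.IH in auto)
    qed
    then show ?thesis using Suc by simp
  qed
qed

text \<open>This is Krull's intersection theorem: a relation \<open>s\<^sup>K p = \<Sum>i<K. Q\<^sub>i s\<^sup>i p\<close> in the Noetherian Rees algebra
  gives \<open>(1 - q) p = 0\<close> on comparing the coefficients of \<open>s\<^sup>K\<close>, where \<open>q\<close> vanishes at the identity.\<close>

lemma vanishing_locally_zero:
  fixes H S :: "(complex ^ 'n ^ 'n) set"
  assumes H: "linear_algebraic_group H" and S: "mult_closed S" and T: "tangent H \<subseteq> tangent S"
    and p: "p \<in> vanishing S"
  shows "\<exists>f\<in>pfun. f (mat 1) = 1 \<and> (\<forall>A\<in>H. f A * p A = 0)"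
proof -
  obtain P where P: "\<And>k. P k \<in> rees" "\<And>k A s. A \<in> H \<Longrightarrow> P k (A, s) = s ^ k * p A"
    using vanishing_in_rees[OF assms] by metis
  obtain K where K: "P K \<in> idl rees (P ` {..<K})"
    using noeth_rees P(1) by (auto simp: noeth_def image_subset_iff)
  obtain Q where Q: "\<And>i. Q i \<in> rees" "P K = (\<Sum>i<K. Q i * P i)"
    using idl_image_sum[OF K is_subring_rees] by blast
  obtain C where C: "\<And>i j. (\<lambda>A. coeff (C i A) j) \<in> pfun" "\<And>i. degree (C i (mat 1)) = 0"
    "\<And>i A s. Q i (A, s) = poly (C i A) s"
    using rees_coeffs[OF Q(1)] by metis
  let ?f = "\<lambda>A. 1 - (\<Sum>i<K. coeff (C i A) (K - i))"
  have "?f \<in> pfun" by (intro pfun_diff pfun_const pfun_sum C) auto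
  moreover have "?f (mat 1) = 1"
    using C(2) by (auto intro!: sum.neutral coeff_eq_0)
  moreover have "?f A * p A = 0" if A: "A \<in> H" for A
  proof -
    have "poly (monom (p A) K) s = poly (\<Sum>i<K. monom (p A) i * C i A) s" for s
    proof -
      have "P K (A, s) = (\<Sum>i<K. Q i (A, s) * P i (A, s))"
        unfolding Q(2) by (induction K) (simp_all add: zero_fun_def)
      then show ?thesis by (simp add: P(2)[OF A] C(3) poly_sum poly_monom mult_ac)
    qed
    then have "monom (p A) K = (\<Sum>i<K. monom (p A) i * C i A)"
      by (simp add: poly_eq_poly_eq_iff[symmetric] fun_eq_iff)
    then have "coeff (monom (p A) K) K = coeff (\<Sum>i<K. monom (p A) i * C i A) K" by simp
    then have "p A = (\<Sum>i<K. p A * coeff (C i A) (K - i))"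
      by (simp add: coeff_sum coeff_monom_mult)
    then show ?thesis by (simp add: sum_distrib_left[symmetric] algebra_simps)
  qed
  ultimately show ?thesis by (intro bexI[of _ ?f]) auto
qed

text \<open>Finitely many generators of the ideal of \<open>S\<close> vanish on \<open>H\<close>
  near the identity, and translation spreads this over the intersection of \<open>H\<close> with the
  closure. That intersection is therefore open and closed in \<open>H\<close>.\<close>

theorem connected_group_subset_zclosure:
  fixes H S :: "(complex ^ 'n ^ 'n) set"
  assumes H: "linear_algebraic_group H" "connectedin zariski H"
    and S: "mult_closed S" and T: "tangent H \<subseteq> tangent S"
  shows "H \<subseteq> zclosure S"
proof -
  note Hd = linear_algebraic_groupD[OF H(1)]
  obtain F where F: "finite F" "F \<subseteq> vanishing S" "vanishing S \<subseteq> idl pfun F"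
    using noeth_imp_finite_basis[OF is_subring_pfun noeth_pfun, of "vanishing S"] by (auto simp: vanishing_def)
  have "\<exists>f\<in>pfun. f (mat 1) = 1 \<and> (\<forall>A\<in>H. f A * p A = 0)" if "p \<in> F" for p
    using F(2) that by (intro vanishing_locally_zero[OF H(1) S T]) auto
  then obtain f where f: "\<And>p. p \<in> F \<Longrightarrow> f p \<in> pfun" "\<And>p. p \<in> F \<Longrightarrow> f p (mat 1) = 1"
    "\<And>p A. p \<in> F \<Longrightarrow> A \<in> H \<Longrightarrow> f p A * p A = 0" by metis
  \<comment> \<open>A single function for all generators: where \<open>h\<close> is nonzero, so is
    every \<open>f p\<close>, and each generator vanishes.\<close>
  define h where "h A = (\<Prod>p\<in>F. f p A)" for A
  have h: "h \<in> pfun" unfolding h_def by (intro pfun_prod F f)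
  have h1: "h (mat 1) = 1" by (simp add: h_def f(2))
  have hz: "A \<in> zclosure S" if A: "A \<in> H" "h A \<noteq> 0" for A
  proof -
    have z: "p A = 0" if "p \<in> F" for p
      using f(3)[OF that A(1)] A(2) that F(1) by (auto simp: h_def)
    have "p A = 0" if "p \<in> idl pfun F" for p
      using that by induction (auto simp: z)
    then show ?thesis using F(3) by (auto simp: zclosure_def)
  qed
  let ?N = "H \<inter> zclosure S"
  have mS: "mult_closed (zclosure S)" by (rule mult_closed_zclosure[OF S])
  have invH: "\<exists>B'. B' \<in> H \<and> B ** B' = mat 1 \<and> B' ** B = mat 1" if "B \<in> H" for B
    using Hd(4)[OF that] by blast
  then obtain iv where iv: "\<And>B. B \<in> H \<Longrightarrow> iv B \<in> H" "\<And>B. B \<in> H \<Longrightarrow> B ** iv B = mat 1"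
    "\<And>B. B \<in> H \<Longrightarrow> iv B ** B = mat 1" by metis
  \<comment> \<open>The translates of the neighbourhood \<open>h A \<noteq> 0\<close> of the
    identity by all elements of \<open>?N\<close>.\<close>
  define U where "U = {A. \<exists>B\<in>?N. h (iv B ** A) \<noteq> 0}"
  have opU: "openin zariski U" unfolding openin_zariski
  proof (intro exI conjI)
    show "(\<lambda>B A. h (iv B ** A)) ` ?N \<subseteq> pfun" using pfun_ltrans[OF h] by auto
    show "U = {A. \<exists>p\<in>(\<lambda>B A. h (iv B ** A)) ` ?N. p A \<noteq> 0}" by (simp add: U_def)
  qed
  have clS: "closedin zariski (zclosure S)"
  proof -
    have "openin zariski (UNIV - zclosure S)" unfolding openin_zariski
      by (intro exI[of _ "vanishing S"]) (auto simp: vanishing_def zclosure_def)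
    then show ?thesis by (simp add: closedin_def)
  qed
  have UN: "H \<inter> U = ?N"
  proof (intro equalityI subsetI)
    fix A assume A: "A \<in> H \<inter> U"
    then obtain B where B: "B \<in> H" "B \<in> zclosure S" "h (iv B ** A) \<noteq> 0" by (auto simp: U_def)
    have "iv B ** A \<in> H" using iv(1)[OF B(1)] A Hd(1) by (auto simp: mult_closed_def)
    then have "iv B ** A \<in> zclosure S" using hz B by blast
    then have "B ** (iv B ** A) \<in> zclosure S" using mS B by (auto simp: mult_closed_def)
    then show "A \<in> ?N" using A iv(2)[OF B(1)] by (simp add: matrix_mul_assoc)
  next
    fix A assume A: "A \<in> ?N"
    then have "h (iv A ** A) \<noteq> 0" using iv(3)[of A] h1 by simp
    then show "A \<in> H \<inter> U" using A by (auto simp: U_def)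
  qed
  have op: "openin (subtopology zariski H) ?N"
    using opU unfolding UN[symmetric] by (rule openin_subtopology_Int2)
  have cl: "closedin (subtopology zariski H) ?N"
    using clS by (rule closedin_subtopology_Int_closed)
  have ne: "?N \<noteq> {}" using Hd(1) mS by (auto simp: mult_closed_def)
  have "connected_space (subtopology zariski H)" using H(2) by (simp add: connectedin_def)
  then have "?N = topspace (subtopology zariski H)"
    using op cl ne unfolding connected_space_clopen_in by metis
  then show ?thesis by auto
qed

section \<open>The Lie algebra of a real form\<close>

lemma real_pfun:
  fixes p :: "complex ^ 'a ^ 'a \<Rightarrow> complex"
  assumes "p \<in> poly_fun \<real>"
  shows "p \<in> pfun" "p (cmat A) \<in> \<real>" "pder p (cmat A) (cmat V) \<in> \<real>"
proof -
  have *: "p \<in> pfun" if "p \<in> poly_fun \<real>" for p :: "complex ^ 'a ^ 'a \<Rightarrow> complex"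
    using that by induction (auto intro: poly_fun.intros)
  show "p \<in> pfun" by (rule *[OF assms])
  have "p (cmat A) \<in> \<real> \<and> pder p (cmat A) (cmat V) \<in> \<real>"
    using assms
    by induction (auto simp: pder_const pder_entry pder_add pder_mult *)
  then show "p (cmat A) \<in> \<real>" "pder p (cmat A) (cmat V) \<in> \<real>" by auto
qed

text \<open>The equations may be taken real. Their differentials are real on real matrices, so they
  vanish on the real and the imaginary part of a tangent vector separately.\<close>

lemma tangent_real_parts:
  assumes H: "defined_over_reals H" and Z: "Z \<in> tangent H"
  shows "cmat (map_matrix Re Z) \<in> tangent H" "cmat (map_matrix Im Z) \<in> tangent H"
proof -
  have real: "pder q (mat 1) (cmat (map_matrix Re Z)) = 0 \<and> pder q (mat 1) (cmat (map_matrix Im Z)) = 0"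
    if q: "q \<in> poly_fun \<real>" "\<forall>A\<in>H. q A = 0" for q
  proof -
    have qp: "q \<in> pfun" by (rule real_pfun(1)[OF q(1)])
    have "Z = cmat (map_matrix Re Z) + map_matrix ((*) \<i>) (cmat (map_matrix Im Z))"
      by (simp add: vec_eq_iff complex_eq[symmetric])
    moreover have "pder q (mat 1) Z = 0" using Z q qp by (auto simp: tangent_def vanishing_def)
    ultimately have "pder q (mat 1) (cmat (map_matrix Re Z)) + \<i> * pder q (mat 1) (cmat (map_matrix Im Z)) = 0"
      by (metis linear_add[OF linear_pder[OF qp]] pder_cscale[OF qp])
    moreover have "pder q (mat 1) (cmat (map_matrix Re Z)) \<in> \<real>" "pder q (mat 1) (cmat (map_matrix Im Z)) \<in> \<real>"
      using real_pfun(3)[OF q(1), of "mat 1"] by auto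
    ultimately show ?thesis by (auto simp: complex_eq_iff complex_is_Real_iff)
  qed
  have "pder p (mat 1) (cmat (map_matrix Re Z)) = 0 \<and> pder p (mat 1) (cmat (map_matrix Im Z)) = 0"
    if p: "p \<in> vanishing H" for p
  proof -
    obtain q r where qr: "q \<in> poly_fun \<real>" "r \<in> poly_fun \<real>" "\<forall>A\<in>H. q A = 0" "\<forall>A\<in>H. r A = 0"
      "p = (\<lambda>A. q A + \<i> * r A)"
      using H p unfolding defined_over_reals_def vanishing_def by blast
    have qr': "q \<in> pfun" "r \<in> pfun" using qr real_pfun(1) by auto
    then have "pder p (mat 1) = (\<lambda>V. pder q (mat 1) V + \<i> * pder r (mat 1) V)"
      unfolding qr(5) by (simp add: pder_add pfun_cmult pder_cmult)
    then show ?thesis using real[of q] real[of r] qr by simp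
  qed
  then show "cmat (map_matrix Re Z) \<in> tangent H" "cmat (map_matrix Im Z) \<in> tangent H"
    by (auto simp: tangent_def)
qed

lemma tangent_subset_of_real:
  assumes H: "defined_over_reals H" and S: "\<And>X. cmat X \<in> tangent H \<Longrightarrow> cmat X \<in> tangent S"
  shows "tangent H \<subseteq> tangent S"
proof
  fix Z assume Z: "Z \<in> tangent H"
  have "cmat (map_matrix Re Z) + map_matrix ((*) \<i>) (cmat (map_matrix Im Z)) \<in> tangent S"
    by (intro subspace_add subspace_tangent tangent_cscale S tangent_real_parts[OF H Z])
  moreover have "Z = cmat (map_matrix Re Z) + map_matrix ((*) \<i>) (cmat (map_matrix Im Z))"
    by (simp add: vec_eq_iff complex_eq[symmetric])
  ultimately show "Z \<in> tangent S" by simp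
qed

lemma lie_algebra_gexp: "lie_algebra G = {X. \<forall>t. gexp (t *\<^sub>R X) \<in> G}"
  by (simp add: lie_algebra_def mat_exp_eq_gexp)

lemma GL_subgroupD:
  assumes "subgroup G (GL :: (real ^ 'n ^ 'n) monoid)"
  shows "mat 1 \<in> G" "\<And>A B. A \<in> G \<Longrightarrow> B \<in> G \<Longrightarrow> A ** B \<in> G"
  using subgroup.m_closed[OF assms] subgroup.one_closed[OF assms] by (auto simp: GL_def)

text \<open>For the converse, exponentials of tangent vectors are real points of \<open>H\<close>.
  Openness of \<open>G\<close> among these catches small times, and powers reach all others.\<close>

lemma lie_algebra_iff_tangent:
  fixes G :: "(real ^ 'n ^ 'n) set"
  assumes H: "linear_algebraic_group H" and G: "subgroup G GL" "openin (top_of_set (real_points H)) G"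
  shows "X \<in> lie_algebra G \<longleftrightarrow> cmat X \<in> tangent H"
proof
  assume X: "X \<in> lie_algebra G"
  have GH: "G \<subseteq> real_points H" using G(2) openin_imp_subset by blast
  have "gexp (t *\<^sub>R cmat X) \<in> zclosure H" for t
  proof -
    have "gexp (t *\<^sub>R X) \<in> real_points H" using X GH by (auto simp: lie_algebra_gexp)
    then have "gexp (cmat (t *\<^sub>R X)) \<in> H" by (simp add: real_points_def cmat_gexp)
    then show ?thesis using zclosure_superset by (auto simp: linear_scale[OF linear_cmat])
  qed
  then show "cmat X \<in> tangent H" using tangent_gexp_iff[OF linear_algebraic_groupD(1)[OF H]] by blast
next
  assume X: "cmat X \<in> tangent H"
  note Gd = GL_subgroupD[OF G(1)]
  have R: "gexp (t *\<^sub>R X) \<in> real_points H" for t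
  proof -
    have "t *\<^sub>R cmat X \<in> tangent H" by (intro subspace_scale subspace_tangent X)
    then have "gexp (cmat (t *\<^sub>R X)) \<in> H" using gexp_in_group[OF H] by (simp add: linear_scale[OF linear_cmat])
    then show ?thesis by (simp add: real_points_def cmat_gexp)
  qed
  obtain T where T: "open T" "G = real_points H \<inter> T" using G(2) by (auto simp: openin_open)
  have "isCont (\<lambda>t. gexp (t *\<^sub>R X)) 0"
    using gexp_vector_derivative_0[of X] has_vector_derivative_continuous by blast
  moreover have "gexp (0 *\<^sub>R X) \<in> T" using Gd(1) T by (simp add: gexp_zero)
  ultimately have "\<forall>\<^sub>F t in at 0. gexp (t *\<^sub>R X) \<in> T"
    using T(1) unfolding isCont_def by (auto dest: topological_tendstoD)
  then obtain d where d: "d > 0" "\<And>t. t \<noteq> 0 \<Longrightarrow> \<bar>t\<bar> < d \<Longrightarrow> gexp (t *\<^sub>R X) \<in> T"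
    by (auto simp: eventually_at)
  then have small: "gexp (t *\<^sub>R X) \<in> G" if "\<bar>t\<bar> < d" for t
    using R[of t] T Gd(1) that by (cases "t = 0") (auto simp: gexp_zero)
  have "gexp (t *\<^sub>R X) \<in> G" for t
  proof -
    \<comment> \<open>\<open>t / m\<close> is shorter than \<open>d\<close>, so \<open>small\<close>
      applies to it.\<close>
    obtain m :: nat where m: "\<bar>t\<bar> / d < real m" using reals_Archimedean2 by blast
    have m0: "m > 0" using m d(1) by (cases m) (auto simp: field_simps)
    have s: "gexp ((t / m) *\<^sub>R X) \<in> G"
      using m m0 d(1) by (intro small) (auto simp: field_simps abs_mult)
    have "gexp ((real k * (t / m)) *\<^sub>R X) \<in> G" for k
    proof (induction k)
      case (Suc k)
      have "real (Suc k) * (t / m) = real k * (t / m) + t / m" by (simp add: distrib_right add_divide_distrib)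
      then show ?case using Gd(2)[OF Suc s] by (simp only: gexp_add)
    qed (simp add: gexp_zero Gd)
    from this[of m] show ?thesis using m0 by simp
  qed
  then show "X \<in> lie_algebra G" by (simp add: lie_algebra_gexp)
qed

section \<open>Zariski density from the Lie algebra\<close>

lemma zariski_dense_inI:
  assumes "S \<subseteq> G" "cmat ` G \<subseteq> zclosure (cmat ` S)"
  shows "zariski_dense_in G S"
proof -
  let ?X = "pullback_topology G cmat zariski"
  have top: "topspace ?X = G" by (simp add: topspace_pullback_topology)
  have "x \<in> ?X closure_of S" if x: "x \<in> G" for x
    unfolding in_closure_of
  proof (intro conjI allI impI)
    show "x \<in> topspace ?X" using x top by simp
    fix T assume T: "x \<in> T \<and> openin ?X T"
    then obtain U where U: "openin zariski U" "T = cmat -` U \<inter> G"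
      unfolding openin_pullback_topology by blast
    then obtain P where P: "P \<subseteq> pfun" "U = {A. \<exists>p\<in>P. p A \<noteq> 0}" unfolding openin_zariski by blast
    then obtain p where p: "p \<in> P" "p (cmat x) \<noteq> 0" using T U by auto
    have "p \<notin> vanishing (cmat ` S)" using assms(2) x p(2) by (auto simp: zclosure_def)
    then obtain y where "y \<in> S" "p (cmat y) \<noteq> 0" using p P by (auto simp: vanishing_def)
    then show "\<exists>y. y \<in> S \<and> y \<in> T" using p P U assms(1) by auto
  qed
  moreover have "?X closure_of S \<subseteq> G" using closure_of_subset_topspace[of ?X S] top by simp
  ultimately show ?thesis using assms(1) by (auto simp: zariski_dense_in_def)
qed

lemma mult_closed_cmat_image:
  assumes "mat 1 \<in> S" "\<And>A B. A \<in> S \<Longrightarrow> B \<in> S \<Longrightarrow> A ** B \<in> S"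
  shows "mult_closed (cmat ` S)"
  using assms unfolding mult_closed_def by (force simp: cmat_mult[symmetric])

text \<open>Reduces density of a submonoid to a statement about real Lie algebra elements; the
  complex tangent space follows because \<open>H\<close> is defined over the reals.\<close>

theorem zariski_denseI_lie_algebra:
  assumes H: "linear_algebraic_group H" "connectedin zariski H" "defined_over_reals H"
    and G: "subgroup G GL" "openin (top_of_set (real_points H)) G"
    and S: "S \<subseteq> G" "mat 1 \<in> S" "\<And>A B. A \<in> S \<Longrightarrow> B \<in> S \<Longrightarrow> A ** B \<in> S"
    and L: "\<And>X. X \<in> lie_algebra G \<Longrightarrow> cmat X \<in> tangent (cmat ` S)"
  shows "zariski_dense_in G S"
proof (rule zariski_dense_inI[OF S(1)])
  have "mult_closed (cmat ` S)" by (rule mult_closed_cmat_image[OF S(2,3)])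
  moreover have "tangent H \<subseteq> tangent (cmat ` S)"
    using L by (intro tangent_subset_of_real[OF H(3)]) (simp add: lie_algebra_iff_tangent[OF H(1) G])
  ultimately have "H \<subseteq> zclosure (cmat ` S)" by (rule connected_group_subset_zclosure[OF H(1,2)])
  moreover have "G \<subseteq> real_points H" using G(2) openin_imp_subset by blast
  ultimately show "cmat ` G \<subseteq> zclosure (cmat ` S)" by (auto simp: real_points_def)
qed

lemma subspace_lie_algebra:
  assumes H: "linear_algebraic_group H" and G: "subgroup G GL" "openin (top_of_set (real_points H)) G"
  shows "subspace (lie_algebra G)"
  using subspace_tangent[of H] unfolding subspace_def
  by (auto simp: lie_algebra_iff_tangent[OF assms] linear_0[OF linear_cmat] linear_add[OF linear_cmat] linear_scale[OF linear_cmat])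

lemma lie_algebra_Ad:
  assumes "subgroup G GL" "X \<in> lie_algebra G" "g \<in> G" "g' \<in> G" "g ** g' = mat 1" "g' ** g = mat 1"
  shows "g ** X ** g' \<in> lie_algebra G"
proof -
  have "gexp (t *\<^sub>R (g ** X ** g')) = g ** gexp (t *\<^sub>R X) ** g'" for t
    using gexp_conj[of g' g "t *\<^sub>R X"] assms by (simp add: matrix_mul_scaleR_left matrix_mul_scaleR_right)
  then show ?thesis using assms(2-4) GL_subgroupD(2)[OF assms(1)] by (simp add: lie_algebra_gexp)
qed

section \<open>Elements of \<open>SL(2,\<real>)\<close>\<close>

definition mk :: "real \<Rightarrow> real \<Rightarrow> real \<Rightarrow> real \<Rightarrow> real ^ 2 ^ 2" where
  "mk a b c d = vector [vector [a, b], vector [c, d]]"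

lemma mk_nth [simp]: "mk a b c d $ 1 $ 1 = a" "mk a b c d $ 1 $ 2 = b" "mk a b c d $ 2 $ 1 = c" "mk a b c d $ 2 $ 2 = d"
  by (simp_all add: mk_def)

lemma mk_eq_iff: "A = mk a b c d \<longleftrightarrow> A $ 1 $ 1 = a \<and> A $ 1 $ 2 = b \<and> A $ 2 $ 1 = c \<and> A $ 2 $ 2 = d"
  by (auto simp: vec_eq_iff forall_2)

lemma mk_inject [simp]: "mk a b c d = mk a' b' c' d' \<longleftrightarrow> a = a' \<and> b = b' \<and> c = c' \<and> d = d'"
  by (simp add: mk_eq_iff)

lemma mk_cases: obtains a b c d where "A = mk a b c d"
  using mk_eq_iff[of A] by blast

lemma mk_mult [simp]: "mk a b c d ** mk a' b' c' d' = mk (a*a' + b*c') (a*b' + b*d') (c*a' + d*c') (c*b' + d*d')"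
  by (simp add: mk_eq_iff matrix_matrix_mult_def sum_2)

lemma mk_add [simp]: "mk a b c d + mk a' b' c' d' = mk (a + a') (b + b') (c + c') (d + d')"
  by (simp add: mk_eq_iff)

lemma mk_diff [simp]: "mk a b c d - mk a' b' c' d' = mk (a - a') (b - b') (c - c') (d - d')"
  by (simp add: mk_eq_iff)

lemma mk_scaleR [simp]: "t *\<^sub>R mk a b c d = mk (t * a) (t * b) (t * c) (t * d)"
  by (simp add: mk_eq_iff)

lemma mat_1_mk: "mat 1 = mk 1 0 0 1"
  by (simp add: mk_eq_iff mat_def)

lemma det_mk [simp]: "det (mk a b c d) = a * d - b * c"
  by (simp add: det_2)

definition upper :: "real \<Rightarrow> real ^ 2 ^ 2" where "upper t = mk 1 t 0 1"
definition lower :: "real \<Rightarrow> real ^ 2 ^ 2" where "lower t = mk 1 0 t 1"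
definition diag :: "real \<Rightarrow> real ^ 2 ^ 2" where "diag x = mk x 0 0 (1 / x)"

lemma det_upper [simp]: "det (upper t) = 1" by (simp add: upper_def)
lemma det_lower [simp]: "det (lower t) = 1" by (simp add: lower_def)
lemma det_diag [simp]: "x \<noteq> 0 \<Longrightarrow> det (diag x) = 1" by (simp add: diag_def)

lemma SL2R_inverse:
  fixes A :: "real ^ 2 ^ 2"
  assumes "det A = 1"
  obtains B where "det B = 1" "A ** B = mat 1" "B ** A = mat 1"
proof -
  obtain a b c d where A: "A = mk a b c d" by (rule mk_cases)
  show ?thesis
    by (rule that[of "mk d (-b) (-c) a"]) (use assms in \<open>auto simp: A mat_1_mk algebra_simps\<close>)
qed

text \<open>Induction over products of elementary matrices: a matrix with
  \<open>c \<noteq> 0\<close> is a product of three of them.\<close>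

lemma SL2R_generated:
  fixes A :: "real ^ 2 ^ 2"
  assumes "det A = 1" and one: "P (mat 1)"
    and up: "\<And>B t. det B = 1 \<Longrightarrow> P B \<Longrightarrow> P (upper t ** B)"
    and lo: "\<And>B t. det B = 1 \<Longrightarrow> P B \<Longrightarrow> P (lower t ** B)"
  shows "P A"
proof -
  have gen: "P (mk a b c d)" if "a * d - b * c = 1" "c \<noteq> 0" for a b c d
  proof -
    have "P (upper ((a - 1) / c) ** (lower c ** (upper ((d - 1) / c) ** mat 1)))"
      by (intro up lo one) (auto simp: det_mul)
    moreover have "upper ((a - 1) / c) ** (lower c ** (upper ((d - 1) / c) ** mat 1)) = mk a b c d"
    proof -
      have "b = (a * d - 1) / c" using that by (simp add: field_simps)
      then show ?thesis using that(2) by (simp add: upper_def lower_def) (simp add: field_simps)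
    qed
    ultimately show ?thesis by simp
  qed
  obtain a b c d where A: "A = mk a b c d" by (rule mk_cases)
  show ?thesis
  proof (cases "c = 0")
    case True
    then have ad: "a * d = 1" using assms(1) by (simp add: A)
    \<comment> \<open>Adding the first row to the second makes the lower left entry nonzero; the
      factor \<open>lower (-1)\<close> undoes it.\<close>
    have "P (mk a b a (b + d))" by (rule gen) (use ad in \<open>auto simp: algebra_simps\<close>)
    then have "P (lower (-1) ** mk a b a (b + d))" using ad by (intro lo) (auto simp: algebra_simps)
    then show ?thesis using True by (simp add: A lower_def)
  next
    case False
    then show ?thesis using gen[of a d b c] assms(1) by (simp add: A)
  qed
qed

text \<open>A trace of absolute value at least 2 gives a real eigenvalue, hence a triangular form.
  If the eigenvalues differ, a further shear diagonalizes.\<close>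

lemma SL2R_normal_form:
  fixes A :: "real ^ 2 ^ 2"
  assumes det: "det A = 1" and tr: "\<bar>A $ 1 $ 1 + A $ 2 $ 2\<bar> \<ge> 2" and ne: "A \<noteq> mat 1" "A \<noteq> - mat 1"
  obtains k k' where "det k = 1" "det k' = 1" "k ** k' = mat 1" "k' ** k = mat 1"
    "(\<exists>x. x \<noteq> 0 \<and> \<bar>x\<bar> \<noteq> 1 \<and> A = k ** diag x ** k') \<or>
     (\<exists>s t. \<bar>s\<bar> = 1 \<and> t \<noteq> 0 \<and> A = k ** (s *\<^sub>R upper t) ** k')"
proof -
  obtain p q r s where A: "A = mk p q r s" by (rule mk_cases)
  have d: "p * s - q * r = 1" and t: "\<bar>p + s\<bar> \<ge> 2" using det tr by (simp_all add: A)
  have triangular: "\<exists>k k' l b. det k = 1 \<and> det k' = 1 \<and> k ** k' = mat 1 \<and> k' ** k = mat 1 \<and> l \<noteq> 0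
     \<and> A = k ** mk l b 0 (1 / l) ** k'"
  proof (cases "r = 0")
    case True
    then have "p \<noteq> 0" using d by auto
    moreover from this have "s = 1 / p" using d True by (simp add: nonzero_eq_divide_eq mult.commute)
    ultimately show ?thesis using True
      by (intro exI[of _ "mat 1"] exI[of _ p] exI[of _ q]) (simp add: A)
  next
    case False
    \<comment> \<open>An eigenvalue; the discriminant is nonnegative by the bound on the
      trace.\<close>
    define l where "l = ((p + s) + sqrt ((p + s)\<^sup>2 - 4)) / 2"
    have "(p + s)\<^sup>2 \<ge> 2\<^sup>2" using t by (metis abs_le_square_iff abs_numeral)
    moreover have "2 * l - (p + s) = sqrt ((p + s)\<^sup>2 - 4)" by (simp add: l_def field_simps)
    ultimately have "(2 * l - (p + s))\<^sup>2 = (p + s)\<^sup>2 - 4" by simp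
    then have l: "l * l - (p + s) * l + 1 = 0" by (simp add: power2_eq_square algebra_simps)
    then have l0: "l \<noteq> 0" by auto
    \<comment> \<open>The first column \<open>(l - s, r)\<close> is an eigenvector for
      \<open>l\<close>; the second is chosen to make the determinant 1.\<close>
    define k where "k = mk (l - s) (- 1 / r) r 0"
    define k' where "k' = mk 0 (1 / r) (- r) (l - s)"
    have kk: "det k = 1" "det k' = 1" "k ** k' = mat 1" "k' ** k = mat 1"
      using False by (auto simp: k_def k'_def mat_1_mk)
    have il: "1 / l = p + s - l" using l l0 by (simp add: field_simps)
    have "k ** mk l (- 1 / r) 0 (1 / l) = A ** k"
    proof -
      have "q = (p * s - 1) / r" using d False by (simp add: field_simps)
      moreover have "l * l = (p + s) * l - 1" using l by simp
      ultimately show ?thesis using False unfolding il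
        by (simp add: k_def A) (simp add: field_simps)
    qed
    then have "k ** mk l (- 1 / r) 0 (1 / l) ** k' = A" using kk by (simp add: matrix_mul_assoc[symmetric])
    then show ?thesis using kk l0 by metis
  qed
  then obtain k k' l b where k: "det k = 1" "det k' = 1" "k ** k' = mat 1" "k' ** k = mat 1" "l \<noteq> 0"
    and A': "A = k ** mk l b 0 (1 / l) ** k'" by blast
  show ?thesis
  proof (cases "\<bar>l\<bar> = 1")
    case True
    then have l2: "1 / l = l" "l * l = 1" by (auto simp: abs_if split: if_splits)
    have m: "mk l b 0 (1 / l) = l *\<^sub>R upper (l * b)" using l2 by (simp add: upper_def mult.assoc[symmetric])
    have "b \<noteq> 0"
    proof
      assume "b = 0"
      then have "mk l b 0 (1 / l) = l *\<^sub>R mat 1" by (simp add: l2 mat_1_mk)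
      then have "A = l *\<^sub>R mat 1"
        using A' k by (simp add: matrix_mul_scaleR_left matrix_mul_scaleR_right)
      then show False using ne True by (auto simp: abs_if split: if_splits)
    qed
    then have "\<exists>s t. \<bar>s\<bar> = 1 \<and> t \<noteq> 0 \<and> A = k ** (s *\<^sub>R upper t) ** k'"
      using A' True k(5) unfolding m by (intro exI[of _ l] exI[of _ "l * b"]) auto
    then show ?thesis using k by (intro that[of k k']) auto
  next
    case False
    \<comment> \<open>The shear whose conjugation action on \<open>diag l\<close> creates the upper
      right entry \<open>b\<close>.\<close>
    define y where "y = - b / (l - 1 / l)"
    have nz: "l - 1 / l \<noteq> 0" using False k(5) by (auto simp: field_simps abs_if square_eq_1_iff split: if_splits)
    have "mk l b 0 (1 / l) = upper y ** diag l ** upper (- y)"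
    proof -
      have "- l * y + y / l = - (y * (l - 1 / l))" by (simp add: algebra_simps)
      also have "\<dots> = b" using nz by (simp add: y_def)
      finally have "- l * y + y / l = b" .
      then show ?thesis by (simp add: upper_def diag_def)
    qed
    then have "A = (k ** upper y) ** diag l ** (upper (- y) ** k')" using A' by (simp add: matrix_mul_assoc)
    moreover have uu: "upper y ** upper (- y) = mat 1" "upper (- y) ** upper y = mat 1"
      by (simp_all add: upper_def mat_1_mk)
    have "(k ** upper y) ** (upper (- y) ** k') = k ** (upper y ** upper (- y)) ** k'"
      "(upper (- y) ** k') ** (k ** upper y) = upper (- y) ** (k' ** k) ** upper y"
      by (simp_all add: matrix_mul_assoc)
    then have "(k ** upper y) ** (upper (- y) ** k') = mat 1" "(upper (- y) ** k') ** (k ** upper y) = mat 1"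
      using k uu by simp_all
    ultimately show ?thesis using k False
      by (intro that[of "k ** upper y" "upper (- y) ** k'"]) (auto simp: det_mul)
  qed
qed

text \<open>By Cayley-Hamilton the powers satisfy the recurrence of the Chebyshev polynomials,
  solved by sines of multiples of the angle.\<close>

lemma elliptic_pow:
  fixes A :: "real ^ 2 ^ 2"
  assumes det: "det A = 1" and \<theta>: "A $ 1 $ 1 + A $ 2 $ 2 = 2 * cos \<theta>" "sin \<theta> \<noteq> 0"
  shows "mat_pow A n = (sin (real n * \<theta>) / sin \<theta>) *\<^sub>R A - (sin (real n * \<theta> - \<theta>) / sin \<theta>) *\<^sub>R mat 1"
proof (induction n)
  case 0
  show ?case using \<theta>(2) by simp
next
  case (Suc n)
  obtain p q r s where A: "A = mk p q r s" by (rule mk_cases)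
  have d: "p * s - q * r = 1" "p + s = 2 * cos \<theta>" using det \<theta> by (simp_all add: A)
  have AA: "A ** A = (2 * cos \<theta>) *\<^sub>R A - mat 1"
  proof -
    have "A ** A = (p + s) *\<^sub>R A - (p * s - q * r) *\<^sub>R mat 1" by (simp add: A mat_1_mk algebra_simps)
    then show ?thesis by (simp add: d)
  qed
  have "mat_pow A (Suc n) = (sin (real n * \<theta>) / sin \<theta>) *\<^sub>R (A ** A) - (sin (real n * \<theta> - \<theta>) / sin \<theta>) *\<^sub>R A"
    unfolding mat_pow_Suc Suc
    by (simp add: bounded_bilinear.diff_right[OF bounded_bilinear_matrix_mult] matrix_mul_scaleR_right)
  also have "\<dots> = ((sin (real n * \<theta>) * (2 * cos \<theta>) - sin (real n * \<theta> - \<theta>)) / sin \<theta>) *\<^sub>R A - (sin (real n * \<theta>) / sin \<theta>) *\<^sub>R mat 1"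
    unfolding AA by (simp add: algebra_simps diff_divide_distrib)
  also have "sin (real n * \<theta>) * (2 * cos \<theta>) - sin (real n * \<theta> - \<theta>) = sin (real n * \<theta> + \<theta>)"
    by (simp add: sin_add sin_diff)
  finally show ?case by (simp add: algebra_simps)
qed

text \<open>The powers of an elliptic element lie on a circle and return arbitrarily close to the
  identity; in a discrete set such a power must equal the identity.\<close>

lemma elliptic_finite_order:
  fixes A :: "real ^ 2 ^ 2"
  assumes "discrete \<Gamma>" "mat 1 \<in> \<Gamma>" and pow: "\<And>n. mat_pow A n \<in> \<Gamma>"
    and det: "det A = 1" and tr: "\<bar>A $ 1 $ 1 + A $ 2 $ 2\<bar> < 2"
  shows "\<exists>n>0. mat_pow A n = mat 1"
proof -
  define \<theta> where "\<theta> = arccos ((A $ 1 $ 1 + A $ 2 $ 2) / 2)"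
  have c: "cos \<theta> = (A $ 1 $ 1 + A $ 2 $ 2) / 2" unfolding \<theta>_def by (rule cos_arccos) (use tr in auto)
  have "\<theta> > 0" "\<theta> < pi" unfolding \<theta>_def using tr by (auto intro!: arccos_lt_bounded[THEN conjunct1] arccos_lt_bounded[THEN conjunct2])
  then have s: "sin \<theta> \<noteq> 0" using sin_gt_zero by force
  have pw: "mat_pow A n = (sin (real n * \<theta>) / sin \<theta>) *\<^sub>R A - (sin (real n * \<theta> - \<theta>) / sin \<theta>) *\<^sub>R mat 1" for n
    by (rule elliptic_pow[OF det _ s]) (simp add: c)
  \<comment> \<open>The formula for the powers at a continuous angle; it has period
    \<open>2 * pi\<close>.\<close>
  define g where "g \<delta> = (sin \<delta> / sin \<theta>) *\<^sub>R A - (sin (\<delta> - \<theta>) / sin \<theta>) *\<^sub>R mat 1" for \<delta>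
  obtain T where T: "open T" "T \<inter> \<Gamma> = {mat 1}"
    using discreteD[OF assms(1,2)] by (auto simp: isolated_in_def)
  have "isCont g 0" unfolding g_def using s by (intro continuous_intros) auto
  moreover have "g 0 = mat 1" using s by (simp add: g_def)
  ultimately have "\<forall>\<^sub>F \<delta> in at 0. g \<delta> \<in> T"
    using T unfolding isCont_def by (auto dest: topological_tendstoD)
  then obtain \<eta> where \<eta>: "\<eta> > 0" "\<And>\<delta>. \<bar>\<delta>\<bar> < \<eta> \<Longrightarrow> g \<delta> \<in> T"
    using T \<open>g 0 = mat 1\<close> unfolding eventually_at by (auto, metis IntE insertI1)
  \<comment> \<open>With this \<open>N\<close>, Dirichlet approximation of the angle by multiples of
    a full turn has error below \<open>\<eta>\<close>.\<close>
  obtain N :: nat where N: "2 * pi / \<eta> < real N" using reals_Archimedean2 by blast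
  have N0: "N > 0" using N \<eta>(1) pi_gt_zero by (cases N) (auto simp: field_simps)
  obtain h k where hk: "0 < k" "k \<le> int N" "\<bar>of_int k * (\<theta> / (2 * pi)) - of_int h\<bar> < 1 / N"
    using Dirichlet_approx[OF N0, of "\<theta> / (2 * pi)"] by blast
  define \<delta> where "\<delta> = of_int k * \<theta> - 2 * pi * of_int h"
  have "\<delta> = 2 * pi * (of_int k * (\<theta> / (2 * pi)) - of_int h)" by (simp add: \<delta>_def field_simps)
  then have "\<bar>\<delta>\<bar> = 2 * pi * \<bar>of_int k * (\<theta> / (2 * pi)) - of_int h\<bar>" by (simp add: abs_mult)
  also have "\<dots> < 2 * pi * (1 / N)" using hk(3) by (intro mult_strict_left_mono) auto
  also have "\<dots> < \<eta>" using N \<eta>(1) N0 by (simp add: field_simps)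
  finally have "g \<delta> \<in> T" by (rule \<eta>(2))
  moreover have "g \<delta> = mat_pow A (nat k)"
  proof -
    have k: "real (nat k) = of_int k" using hk(1) by simp
    have "sin (of_int k * \<theta>) = sin \<delta>" "sin (of_int k * \<theta> - \<theta>) = sin (\<delta> - \<theta>)"
    proof -
      have "sin (of_int k * \<theta>) = sin (\<delta> + 2 * pi * of_int h)" by (simp add: \<delta>_def)
      also have "\<dots> = sin \<delta>" unfolding sin_add by (simp only: sin_int_2pin cos_int_2pin mult_1_right mult_zero_right add_0_right)
      finally show "sin (of_int k * \<theta>) = sin \<delta>" .
      have "sin (of_int k * \<theta> - \<theta>) = sin ((\<delta> - \<theta>) + 2 * pi * of_int h)" by (simp add: \<delta>_def)
      also have "\<dots> = sin (\<delta> - \<theta>)" unfolding sin_add[of "\<delta> - \<theta>"] by (simp only: sin_int_2pin cos_int_2pin mult_1_right mult_zero_right add_0_right)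
      finally show "sin (of_int k * \<theta> - \<theta>) = sin (\<delta> - \<theta>)" .
    qed
    then show ?thesis by (simp add: pw k g_def)
  qed
  ultimately have "mat_pow A (nat k) = mat 1" using pow[of "nat k"] T(2) by auto
  then show ?thesis using hk(1) by (intro exI[of _ "nat k"]) auto
qed

text \<open>Commutators of triangular matrices are unipotent triangular, and in size two those
  commute. The lemma is used to show that two non-metabelian generators have no common invariant
  line.\<close>

lemma triangular_metabelian:
  fixes A B A' B' k k' :: "real ^ 2 ^ 2"
  assumes AB: "A = k ** mk p q r s ** k'" "B = k ** mk p' q' r' s' ** k'" and k: "k' ** k = mat 1"
    and tri: "(r = 0 \<and> r' = 0) \<or> (q = 0 \<and> q' = 0)"
    and det: "p * s - q * r = 1" "p' * s' - q' * r' = 1"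
    and inv: "A ** A' = mat 1" "A' ** A = mat 1" "B ** B' = mat 1" "B' ** B = mat 1" "k ** k' = mat 1"
  shows "(A ** B ** A' ** B') ** (A' ** B ** A ** B') = (A' ** B ** A ** B') ** (A ** B ** A' ** B')"
proof -
  have uniq: "X' = Y" if "X ** X' = mat 1" "X' ** X = mat 1" "X ** Y = mat 1" for X X' Y :: "real ^ 2 ^ 2"
    by (metis that matrix_mul_assoc matrix_mul_lid matrix_mul_rid)
  have cancel: "(k ** X ** k') ** (k ** Y ** k') = k ** (X ** Y) ** k'" for X Y
  proof -
    have "(k ** X ** k') ** (k ** Y ** k') = k ** X ** (k' ** k) ** Y ** k'" by (simp add: matrix_mul_assoc)
    then show ?thesis using k by (simp add: matrix_mul_assoc)
  qed
  have A': "A' = k ** mk s (-q) (-r) p ** k'"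
  proof (rule uniq[OF inv(1,2)])
    have "mk p q r s ** mk s (-q) (-r) p = mat 1" using det by (simp add: mat_1_mk algebra_simps)
    then show "A ** (k ** mk s (-q) (-r) p ** k') = mat 1" unfolding AB(1) cancel using inv(5) by simp
  qed
  have B': "B' = k ** mk s' (-q') (-r') p' ** k'"
  proof (rule uniq[OF inv(3,4)])
    have "mk p' q' r' s' ** mk s' (-q') (-r') p' = mat 1" using det by (simp add: mat_1_mk algebra_simps)
    then show "B ** (k ** mk s' (-q') (-r') p' ** k') = mat 1" unfolding AB(2) cancel using inv(5) by simp
  qed
  show ?thesis unfolding A' B' unfolding AB cancel
    using tri
  proof
    assume "r = 0 \<and> r' = 0"
    then have z: "r = 0" "r' = 0" "s * p = 1" "s' * p' = 1" using det by (auto simp: mult.commute)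
    then have "p \<noteq> 0" "p' \<noteq> 0" by auto
    with z have "s = 1 / p" "s' = 1 / p'" by (simp_all add: nonzero_eq_divide_eq)
    with z \<open>p \<noteq> 0\<close> \<open>p' \<noteq> 0\<close> show "k ** (mk p q r s ** mk p' q' r' s' ** mk s (-q) (-r) p ** mk s' (-q') (-r') p' ** (mk s (-q) (-r) p ** mk p' q' r' s' ** mk p q r s ** mk s' (-q') (-r') p')) ** k' =
      k ** (mk s (-q) (-r) p ** mk p' q' r' s' ** mk p q r s ** mk s' (-q') (-r') p' ** (mk p q r s ** mk p' q' r' s' ** mk s (-q) (-r) p ** mk s' (-q') (-r') p')) ** k'"
      by (simp add: field_simps)
  next
    assume "q = 0 \<and> q' = 0"
    then have z: "q = 0" "q' = 0" "s * p = 1" "s' * p' = 1" using det by (auto simp: mult.commute)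
    then have "p \<noteq> 0" "p' \<noteq> 0" by auto
    with z have "s = 1 / p" "s' = 1 / p'" by (simp_all add: nonzero_eq_divide_eq)
    with z \<open>p \<noteq> 0\<close> \<open>p' \<noteq> 0\<close> show "k ** (mk p q r s ** mk p' q' r' s' ** mk s (-q) (-r) p ** mk s' (-q') (-r') p' ** (mk s (-q) (-r) p ** mk p' q' r' s' ** mk p q r s ** mk s' (-q') (-r') p')) ** k' =
      k ** (mk s (-q) (-r) p ** mk p' q' r' s' ** mk p q r s ** mk s' (-q') (-r') p' ** (mk p q r s ** mk p' q' r' s' ** mk s (-q) (-r) p ** mk s' (-q') (-r') p')) ** k'"
      by (simp add: field_simps)
  qed
qed

section \<open>Laurent polynomials in a real variable\<close>

text \<open>The value at \<open>0\<close> is left free, as the parameter runs through the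
  multiplicative group.\<close>

definition laurent :: "(real \<Rightarrow> 'v::real_vector) \<Rightarrow> bool" where
  "laurent \<phi> \<longleftrightarrow> (\<exists>F C. finite F \<and> (\<forall>x. x \<noteq> 0 \<longrightarrow> \<phi> x = (\<Sum>m\<in>F. (x powi m) *\<^sub>R C m)))"

lemma laurentI_index:
  assumes "finite I" "\<And>x. x \<noteq> 0 \<Longrightarrow> \<phi> x = (\<Sum>i\<in>I. (x powi w i) *\<^sub>R C i)"
  shows "laurent \<phi>"
  unfolding laurent_def
proof (intro exI conjI allI impI)
  show "finite (w ` I)" using assms by simp
  fix x :: real assume x: "x \<noteq> 0"
  have "(\<Sum>i\<in>I. (x powi w i) *\<^sub>R C i) = (\<Sum>m\<in>w ` I. \<Sum>i\<in>{i \<in> I. w i = m}. (x powi w i) *\<^sub>R C i)"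
    by (rule sum.image_gen[OF assms(1)])
  also have "\<dots> = (\<Sum>m\<in>w ` I. (x powi m) *\<^sub>R (\<Sum>i\<in>{i \<in> I. w i = m}. C i))"
    unfolding scaleR_sum_right by (intro sum.cong refl) auto
  finally show "\<phi> x = (\<Sum>m\<in>w ` I. (x powi m) *\<^sub>R (\<Sum>i\<in>{i \<in> I. w i = m}. C i))"
    using assms(2)[OF x] by simp
qed

lemma laurent_cong: "laurent \<psi> \<Longrightarrow> (\<And>x. x \<noteq> 0 \<Longrightarrow> \<phi> x = \<psi> x) \<Longrightarrow> laurent \<phi>"
  unfolding laurent_def by metis

lemma laurent_monom: "laurent (\<lambda>x. (x powi m) *\<^sub>R c)"
  by (rule laurentI_index[of "{()}" _ "\<lambda>_. m" "\<lambda>_. c"]) auto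

lemma laurent_const: "laurent (\<lambda>x. c)"
  using laurent_monom[of 0 c] by simp

lemma laurent_add:
  assumes "laurent \<phi>" "laurent \<psi>" shows "laurent (\<lambda>x. \<phi> x + \<psi> x)"
proof -
  obtain F C F' C' where F: "finite F" "\<And>x. x \<noteq> 0 \<Longrightarrow> \<phi> x = (\<Sum>m\<in>F. (x powi m) *\<^sub>R C m)"
    "finite F'" "\<And>x. x \<noteq> 0 \<Longrightarrow> \<psi> x = (\<Sum>m\<in>F'. (x powi m) *\<^sub>R C' m)"
    using assms unfolding laurent_def by metis
  show ?thesis
  proof (rule laurentI_index[of "F <+> F'" _ "case_sum id id" "case_sum C C'"])
    show "finite (F <+> F')" using F by simp
    fix x :: real assume "x \<noteq> 0"
    then show "\<phi> x + \<psi> x = (\<Sum>i\<in>F <+> F'. (x powi case_sum id id i) *\<^sub>R case_sum C C' i)"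
      using F by (simp add: sum.Plus)
  qed
qed

lemma laurent_linear:
  assumes "laurent \<phi>" "linear T" shows "laurent (\<lambda>x. T (\<phi> x))"
proof -
  obtain F C where F: "finite F" "\<And>x. x \<noteq> 0 \<Longrightarrow> \<phi> x = (\<Sum>m\<in>F. (x powi m) *\<^sub>R C m)"
    using assms(1) unfolding laurent_def by metis
  show ?thesis
    by (rule laurentI_index[of F _ id "\<lambda>m. T (C m)"])
      (use F assms(2) in \<open>auto simp: linear_sum linear_scale\<close>)
qed

lemma laurent_bilinear:
  assumes "laurent \<phi>" "laurent \<psi>" "bounded_bilinear B" shows "laurent (\<lambda>x. B (\<phi> x) (\<psi> x))"
proof -
  interpret bounded_bilinear B by fact
  obtain F C F' C' where F: "finite F" "\<And>x. x \<noteq> 0 \<Longrightarrow> \<phi> x = (\<Sum>m\<in>F. (x powi m) *\<^sub>R C m)"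
    "finite F'" "\<And>x. x \<noteq> 0 \<Longrightarrow> \<psi> x = (\<Sum>m\<in>F'. (x powi m) *\<^sub>R C' m)"
    using assms unfolding laurent_def by metis
  show ?thesis
  proof (rule laurentI_index[of "F \<times> F'" _ "\<lambda>(m, m'). m + m'" "\<lambda>(m, m'). B (C m) (C' m')"])
    show "finite (F \<times> F')" using F by simp
    fix x :: real assume x: "x \<noteq> 0"
    have "B (\<phi> x) (\<psi> x) = (\<Sum>m\<in>F. \<Sum>m'\<in>F'. (x powi m * x powi m') *\<^sub>R B (C m) (C' m'))"
      unfolding F(2)[OF x] F(4)[OF x] sum_left unfolding sum_right
      by (simp add: scaleR_left scaleR_right mult.commute)
    also have "\<dots> = (\<Sum>(m, m')\<in>F \<times> F'. (x powi m * x powi m') *\<^sub>R B (C m) (C' m'))"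
      by (simp add: sum.cartesian_product)
    finally show "B (\<phi> x) (\<psi> x) = (\<Sum>i\<in>F \<times> F'. (x powi (case i of (m, m') \<Rightarrow> m + m')) *\<^sub>R (case i of (m, m') \<Rightarrow> B (C m) (C' m')))"
      using x by (simp add: case_prod_unfold power_int_add)
  qed
qed

lemmas laurent_matmul = laurent_bilinear[OF _ _ bounded_bilinear_matrix_mult]

text \<open>Multiplication by a high power of \<open>x\<close> gives an ordinary polynomial with
  infinitely many roots.\<close>

lemma laurent_zero_coeffs:
  fixes c :: "int \<Rightarrow> real"
  assumes "finite F" "infinite X" "\<And>x. x \<in> X \<Longrightarrow> x \<noteq> 0 \<and> (\<Sum>m\<in>F. (x powi m) * c m) = 0"
  shows "m \<in> F \<Longrightarrow> c m = 0"
proof -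
  assume m: "m \<in> F"
  obtain N :: nat where N: "\<And>m. m \<in> F \<Longrightarrow> m + int N \<ge> 0"
  proof (rule that)
    fix m assume "m \<in> F"
    then have "nat \<bar>m\<bar> \<le> (\<Sum>m\<in>F. nat \<bar>m\<bar>)" using assms(1) by (intro member_le_sum) auto
    then show "m + int (\<Sum>m\<in>F. nat \<bar>m\<bar>) \<ge> 0" by linarith
  qed
  define P where "P = (\<Sum>m\<in>F. monom (c m) (nat (m + int N)))"
  have "poly P x = 0" if x: "x \<in> X" for x
  proof -
    have "poly P x = (\<Sum>m\<in>F. c m * x ^ nat (m + int N))" by (simp add: P_def poly_sum poly_monom)
    also have "\<dots> = (\<Sum>m\<in>F. x ^ N * ((x powi m) * c m))"
    proof (rule sum.cong)
      fix m assume "m \<in> F"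
      then have "x ^ nat (m + int N) = x powi (m + int N)" using N by (simp add: power_int_def)
      also have "\<dots> = x powi m * x ^ N" using assms(3)[OF x] by (simp add: power_int_add)
      finally show "c m * x ^ nat (m + int N) = x ^ N * ((x powi m) * c m)" by simp
    qed simp
    also have "\<dots> = 0" using assms(3)[OF x] by (simp add: sum_distrib_left[symmetric])
    finally show ?thesis .
  qed
  then have "X \<subseteq> {x. poly P x = 0}" by auto
  then have "P = 0" using poly_roots_finite[of P] assms(2) finite_subset by blast
  have "coeff P (nat (m + int N)) = (\<Sum>m'\<in>F. if m' = m then c m' else 0)"
    unfolding P_def coeff_sum
  proof (rule sum.cong)
    fix m' assume "m' \<in> F"
    then have "nat (m' + int N) = nat (m + int N) \<longleftrightarrow> m' = m" using N[of m'] N[OF m] by auto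
    then show "coeff (monom (c m') (nat (m' + int N))) (nat (m + int N)) = (if m' = m then c m' else 0)"
      by simp
  qed simp
  then show "c m = 0" using \<open>P = 0\<close> m assms(1) by simp
qed

text \<open>Pairing with the component of \<open>C m\<close> orthogonal to \<open>V\<close> reduces
  the claim to scalar Laurent polynomials.\<close>

lemma laurent_coeffs_in_subspace:
  fixes C :: "int \<Rightarrow> 'v::euclidean_space"
  assumes F: "finite F" and X: "infinite X" "0 \<notin> X" and V: "subspace V"
    and s: "\<And>x. x \<in> X \<Longrightarrow> (\<Sum>m\<in>F. (x powi m) *\<^sub>R C m) \<in> V" and m: "m \<in> F"
  shows "C m \<in> V"
proof -
  obtain y z where yz: "y \<in> span V" "\<And>w. w \<in> span V \<Longrightarrow> orthogonal z w" "C m = y + z"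
    using orthogonal_subspace_decomp_exists[of V "C m"] by blast
  have yV: "y \<in> V" using yz(1) V by (simp add: span_eq_iff[THEN iffD2])
  have z: "w \<bullet> z = 0" if "w \<in> V" for w
    using yz(2)[of w] that by (simp add: span_base orthogonal_def inner_commute)
  have "C m \<bullet> z = 0"
  proof (rule laurent_zero_coeffs[OF F X(1) _ m, of "\<lambda>m. C m \<bullet> z"])
    fix x assume x: "x \<in> X"
    have "(\<Sum>m\<in>F. (x powi m) * (C m \<bullet> z)) = (\<Sum>m\<in>F. (x powi m) *\<^sub>R C m) \<bullet> z" by (simp add: inner_sum_left)
    then show "x \<noteq> 0 \<and> (\<Sum>m\<in>F. (x powi m) * (C m \<bullet> z)) = 0" using z[OF s[OF x]] x X(2) by auto
  qed
  then have "z = 0" using yz(3) z[OF yV] by (simp add: inner_add_left)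
  then show ?thesis using yz yV by simp
qed

lemma laurent_vanishing:
  fixes \<phi> :: "real \<Rightarrow> 'v::euclidean_space"
  assumes "laurent \<phi>" "infinite X" "0 \<notin> X" "\<And>x. x \<in> X \<Longrightarrow> \<phi> x = 0" "x \<noteq> 0"
  shows "\<phi> x = 0"
proof -
  obtain F C where F: "finite F" "\<And>x. x \<noteq> 0 \<Longrightarrow> \<phi> x = (\<Sum>m\<in>F. (x powi m) *\<^sub>R C m)"
    using assms(1) unfolding laurent_def by metis
  have "C m \<in> {0}" if "m \<in> F" for m
  proof (rule laurent_coeffs_in_subspace[OF F(1) assms(2,3) _ _ that])
    fix y assume y: "y \<in> X"
    then have "y \<noteq> 0" using assms(3) by auto
    then show "(\<Sum>m\<in>F. (y powi m) *\<^sub>R C m) \<in> {0}" using F(2)[of y] assms(4)[OF y] by simp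
  qed simp
  then show ?thesis using F(2)[OF assms(5)] by simp
qed

lemma laurent_pfun:
  assumes "p \<in> pfun" "laurent \<phi>" shows "laurent (\<lambda>x. p (\<phi> x))"
  using assms(1)
proof induction
  case (entry i j)
  have "linear (\<lambda>A :: complex ^ 'a ^ 'a. A $ i $ j)" by (rule linearI) auto
  from laurent_linear[OF assms(2) this] show ?case by simp
next
  case (mult p q)
  then show ?case by (intro laurent_bilinear[OF _ _ bounded_bilinear_mult])
qed (auto intro: laurent_const laurent_add)

text \<open>An infinite set of parameters is Zariski-dense in the multiplicative group: this carries
  powers of one matrix to a whole one-parameter family.\<close>

lemma laurent_in_zclosure:
  assumes "laurent \<phi>" "infinite X" "0 \<notin> X" "\<And>x. x \<in> X \<Longrightarrow> \<phi> x \<in> zclosure S" "x \<noteq> 0"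
  shows "\<phi> x \<in> zclosure S"
  unfolding zclosure_def
proof (intro CollectI ballI)
  fix p assume p: "p \<in> vanishing S"
  show "p (\<phi> x) = 0"
  proof (rule laurent_vanishing[OF _ assms(2,3) _ assms(5)])
    show "laurent (\<lambda>x. p (\<phi> x))" using p assms(1) by (intro laurent_pfun) (auto simp: vanishing_def)
    fix y assume "y \<in> X"
    then show "p (\<phi> y) = 0" using assms(4) p by (auto simp: zclosure_def)
  qed
qed

section \<open>Weight arguments for \<open>sl(2)\<close>-modules\<close>

text \<open>\<open>W m\<close> plays the role of the weight space of weight \<open>m\<close>; the operator \<open>ef - fe\<close> is the
  action of the diagonal element.\<close>

locale sl2_weights =
  fixes e f :: "'v::euclidean_space \<Rightarrow> 'v" and W :: "int \<Rightarrow> 'v set"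
  assumes le: "linear e" and lf: "linear f" and subW: "subspace (W m)"
    and eW: "v \<in> W m \<Longrightarrow> e v \<in> W (m + 2)" and fW: "v \<in> W m \<Longrightarrow> f v \<in> W (m - 2)"
    and ef: "v \<in> W m \<Longrightarrow> e (f v) - f (e v) = of_int m *\<^sub>R v"
begin

lemma opposite: "sl2_weights f e (\<lambda>m. W (- m))"
proof (rule sl2_weights.intro)
  fix v m assume v: "v \<in> W (- m)"
  show "f v \<in> W (- (m + 2))" using fW[OF v] by (simp add: algebra_simps)
  show "e v \<in> W (- (m - 2))" using eW[OF v] by (simp add: algebra_simps)
  show "f (e v) - e (f v) = of_int m *\<^sub>R v" using ef[OF v] by (simp add: algebra_simps)
qed (rule le lf subW)+

text \<open>A nonzero weight space makes its weight an eigenvalue of the bounded operator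
  \<open>ef - fe\<close>.\<close>

lemma weight_bound: "\<exists>C. \<forall>m. C < \<bar>real_of_int m\<bar> \<longrightarrow> W m \<subseteq> {0}"
proof -
  have "linear (\<lambda>v. e (f v) - f (e v))"
    using linear_compose_sub[OF linear_compose[OF lf le] linear_compose[OF le lf]] by (simp add: o_def)
  then obtain C where C: "\<And>v. norm (e (f v) - f (e v)) \<le> C * norm v"
    using linear_bounded by blast
  have "v = 0" if "C < \<bar>real_of_int m\<bar>" "v \<in> W m" for m v
  proof (rule ccontr)
    assume "v \<noteq> 0"
    have "\<bar>real_of_int m\<bar> * norm v \<le> C * norm v" using C[of v] ef[OF that(2)] by simp
    then show False using that(1) \<open>v \<noteq> 0\<close> by simp
  qed
  then show ?thesis by blast
qed

lemma e_pow: "v \<in> W m \<Longrightarrow> (e ^^ r) v \<in> W (m + 2 * int r)"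
proof (induction r)
  case (Suc r)
  then have "e ((e ^^ r) v) \<in> W (m + 2 * int r + 2)" by (intro eW)
  then show ?case by (simp add: algebra_simps)
qed simp

lemma f_e_pow: "v \<in> W m \<Longrightarrow>
  f ((e ^^ Suc r) v) = (e ^^ Suc r) (f v) - (real (Suc r) * (of_int m + real r)) *\<^sub>R (e ^^ r) v"
proof (induction r)
  case 0
  then show ?case using ef[of v m] by (simp add: algebra_simps)
next
  case (Suc r)
  let ?u = "(e ^^ Suc r) v"
  have "f (e ?u) = e (f ?u) - of_int (m + 2 * int (Suc r)) *\<^sub>R ?u"
    using ef[OF e_pow[OF Suc.prems, of "Suc r"]] by (simp add: algebra_simps)
  also have "e (f ?u) = (e ^^ Suc (Suc r)) (f v) - (real (Suc r) * (of_int m + real r)) *\<^sub>R ?u"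
    unfolding Suc.IH[OF Suc.prems] by (simp add: linear_diff[OF le] linear_scale[OF le])
  also have "(e ^^ Suc (Suc r)) (f v) - (real (Suc r) * (of_int m + real r)) *\<^sub>R ?u - of_int (m + 2 * int (Suc r)) *\<^sub>R ?u
    = (e ^^ Suc (Suc r)) (f v) - (real (Suc r) * (of_int m + real r) + of_int (m + 2 * int (Suc r))) *\<^sub>R ?u"
    by (simp only: scaleR_left_distrib diff_diff_eq)
  also have "real (Suc r) * (of_int m + real r) + of_int (m + 2 * int (Suc r)) = real (Suc (Suc r)) * (of_int m + real (Suc r))"
    by (simp add: algebra_simps)
  finally show ?case by simp
qed

text \<open>High powers of \<open>e\<close> kill \<open>v\<close> by \<open>weight_bound\<close>. If
  \<open>e (f v) = 0\<close>, the commutation formula \<open>f_e_pow\<close> lowers the exponent,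
  its coefficient being positive for \<open>m > 0\<close>.\<close>

lemma ef_inj:
  assumes m: "m > 0" and v: "v \<in> W m" and 0: "e (f v) = 0"
  shows "v = 0"
proof -
  obtain C where C: "\<And>m. C < \<bar>real_of_int m\<bar> \<Longrightarrow> W m \<subseteq> {0}" using weight_bound by blast
  obtain r :: nat where r: "C < real r" using reals_Archimedean2 by blast
  have "(e ^^ r) v \<in> W (m + 2 * int r)" by (rule e_pow[OF v])
  moreover have "C < \<bar>real_of_int (m + 2 * int r)\<bar>" using r m by simp
  ultimately have "(e ^^ r) v = 0" using C by blast
  then show ?thesis
  proof (induction r)
    case (Suc r)
    have "(e ^^ Suc r) (f v) = (e ^^ r) (e (f v))" by (simp only: funpow_Suc_right o_apply)
    also have "\<dots> = 0" unfolding 0 by (induction r) (auto simp: linear_0[OF le])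
    finally have "(real (Suc r) * (of_int m + real r)) *\<^sub>R (e ^^ r) v = 0"
      using f_e_pow[OF v, of r] Suc.prems by (simp only: linear_0[OF lf]) simp
    moreover have "real (Suc r) * (of_int m + real r) \<noteq> 0" using m by (simp add: add_pos_nonneg[THEN less_imp_neq[THEN not_sym]])
    ultimately have "(e ^^ r) v = 0" by (metis scaleR_eq_0_iff)
    then show ?case by (rule Suc.IH)
  qed simp
qed

text \<open>An injective endomorphism of the finite-dimensional space \<open>W m\<close> is
  onto.\<close>

lemma ef_surj:
  assumes m: "m > 0" and v: "v \<in> W m"
  obtains w where "w \<in> W m" "e (f w) = v"
proof -
  let ?T = "\<lambda>v. e (f v)"
  have lT: "linear ?T" using linear_compose[OF lf le] by (simp add: o_def)
  have "?T ` W m = W m"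
  proof (rule subspace_dim_equal)
    show "subspace (?T ` W m)" by (rule linear_subspace_image[OF lT subW])
    show "?T ` W m \<subseteq> W m" using eW[OF fW] by force
    have "inj_on ?T (span (W m))"
      unfolding span_eq_iff[THEN iffD2, OF subW] linear_inj_on_iff_eq_0[OF lT subW]
      using ef_inj[OF m] by blast
    then have "dim (?T ` W m) = dim (W m)" by (rule dim_image_eq[OF lT])
    then show "dim (W m) \<le> dim (?T ` W m)" by simp
  qed (rule subW)
  then show ?thesis using v that by (metis imageE)
qed

text \<open>By \<open>ef_surj\<close> every vector of positive even weight is \<open>e\<close>
  applied to one whose weight is lower by 2.\<close>

lemma generated_by_zero_weight_pos:
  assumes L: "\<And>v. v \<in> L \<Longrightarrow> e v \<in> L" "W 0 \<subseteq> L"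
  shows "W (2 * int k) \<subseteq> L"
proof (induction k)
  case (Suc k)
  show ?case
  proof
    fix v assume "v \<in> W (2 * int (Suc k))"
    then obtain w where w: "w \<in> W (2 * int (Suc k))" "e (f w) = v" by (rule ef_surj[rotated]) auto
    have "f w \<in> W (2 * int k)" using fW[OF w(1)] by simp
    then show "v \<in> L" using Suc L(1)[of "f w"] w(2) by auto
  qed
qed (use L in simp)

lemma generated_by_zero_weight:
  assumes L: "\<And>v. v \<in> L \<Longrightarrow> e v \<in> L" "\<And>v. v \<in> L \<Longrightarrow> f v \<in> L" "W 0 \<subseteq> L" and m: "even m"
  shows "W m \<subseteq> L"
proof -
  interpret op: sl2_weights f e "\<lambda>m. W (- m)" by (rule opposite)
  obtain n where n: "m = 2 * n" using m by blast
  show ?thesis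
  proof (cases "n \<ge> 0")
    case True
    then show ?thesis using generated_by_zero_weight_pos[OF L(1,3), of "nat n"] n by simp
  next
    case False
    then show ?thesis using op.generated_by_zero_weight_pos[of L "nat (- n)"] L n by simp
  qed
qed

text \<open>Descending induction on the weight, starting above all weights. Modulo the image of
  \<open>f\<close> from the next higher weight, a vector is killed by \<open>e\<close> or is
  zero.\<close>

lemma generated_by_highest_weight:
  assumes sL: "subspace L" and L: "\<And>v. v \<in> L \<Longrightarrow> f v \<in> L"
    and ker: "\<And>v m. v \<in> W m \<Longrightarrow> e v = 0 \<Longrightarrow> v \<in> L"
  shows "W m \<subseteq> L"
proof -
  interpret op: sl2_weights f e "\<lambda>m. W (- m)" by (rule opposite)
  obtain C where C: "\<And>m. C < \<bar>real_of_int m\<bar> \<Longrightarrow> W m \<subseteq> {0}" using weight_bound by blast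
  obtain N :: nat where N: "C < real N" using reals_Archimedean2 by blast
  \<comment> \<open>\<open>k\<close> counts the distance below the bound and drops by two per step;
    the shift \<open>j\<close> lets \<open>k = 1\<close> appeal to \<open>k = 0\<close>.\<close>
  have "W (int N + j - int k) \<subseteq> L" if "j \<ge> 0" for j k
    using that
  proof (induction k arbitrary: j rule: less_induct)
    case (less k)
    let ?m = "int N + j - int k"
    show ?case
    proof (cases "k = 0")
      case True
      then have "W ?m \<subseteq> {0}" using N less.prems by (intro C) simp
      then show ?thesis using subspace_0[OF sL] by auto
    next
      case False
      have up: "W (?m + 2) \<subseteq> L"
      proof (cases "k = 1")
        case True
        then show ?thesis using less.IH[of 0 "j + 1"] less.prems by (simp add: algebra_simps)
      next
        case False
        then show ?thesis using less.IH[of "k - 2" j] less.prems \<open>k \<noteq> 0\<close> by (simp add: algebra_simps of_nat_diff)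
      qed
      show ?thesis
      proof
        fix v assume v: "v \<in> W ?m"
        show "v \<in> L"
        \<comment> \<open>For positive \<open>?m + 2\<close>, \<open>f w\<close> corrects
          \<open>v\<close> by a vector with the same image under \<open>e\<close>. Otherwise
          \<open>?m\<close> is negative and \<open>f\<close> already maps onto \<open>W ?m\<close>
          by the opposite version of \<open>ef_surj\<close>.\<close>
        proof (cases "?m + 2 > 0")
          case True
          obtain w where w: "w \<in> W (?m + 2)" "e (f w) = e v" using ef_surj[OF True eW[OF v]] by blast
          have fw: "f w \<in> W ?m" using fW[OF w(1)] by simp
          have "v - f w \<in> L"
            by (rule ker[of _ ?m]) (use v fw w subspace_diff[OF subW] in \<open>auto simp: linear_diff[OF le]\<close>)
          moreover have "f w \<in> L" using w up L by blast
          ultimately have "(v - f w) + f w \<in> L" by (intro subspace_add sL)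
          then show ?thesis by simp
        next
          case False
          then have "- ?m > 0" by simp
          moreover have "v \<in> W (- (- ?m))" using v by simp
          ultimately obtain w where w: "w \<in> W (- (- ?m))" "f (e w) = v" by (rule op.ef_surj)
          have "e w \<in> W (?m + 2)" using eW[OF w(1)] by simp
          then have "e w \<in> L" using up by blast
          then show ?thesis using L w(2) by blast
        qed
      qed
    qed
  qed
  note * = this
  show ?thesis
  proof (cases "m \<ge> int N")
    case True
    then show ?thesis using *[of "m - int N" 0] by simp
  next
    case False
    then show ?thesis using *[of 0 "nat (int N - m)"] by simp
  qed
qed

end

section \<open>Homomorphisms from \<open>SL(2,\<real>)\<close>\<close>

lemma mk_has_vector_derivative:
  assumes "(a has_real_derivative a') (at t)" "(b has_real_derivative b') (at t)"
    "(c has_real_derivative c') (at t)" "(d has_real_derivative d') (at t)"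
  shows "((\<lambda>t. mk (a t) (b t) (c t) (d t)) has_vector_derivative mk a' b' c' d') (at t)"
proof (rule has_vector_derivative_matI)
  fix i j :: 2
  show "((\<lambda>t. mk (a t) (b t) (c t) (d t) $ i $ j) has_vector_derivative mk a' b' c' d' $ i $ j) (at t)"
    using exhaust_2[of i] exhaust_2[of j] assms
    by (auto simp: has_real_derivative_iff_has_vector_derivative)
qed

lemma gexp_nilpotent:
  assumes "\<And>k. k \<ge> N \<Longrightarrow> mat_pow X k = 0"
  shows "gexp (t *\<^sub>R X) = (\<Sum>k<N. (t ^ k / fact k) *\<^sub>R mat_pow (X :: real ^ 'n ^ 'n) k)"
proof -
  have "gexp (t *\<^sub>R X) $ i $ j = (\<Sum>k<N. (t ^ k / fact k) *\<^sub>R mat_pow X k) $ i $ j" for i j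
  proof -
    have pw: "mat_pow (t *\<^sub>R X) k = (t ^ k) *\<^sub>R mat_pow X k" for k
      unfolding scaleR_eq_map_matrix by (simp add: mat_pow_scale)
    have "(\<lambda>k. mat_pow (t *\<^sub>R X) k $ i $ j / fact k) sums (\<Sum>k<N. mat_pow (t *\<^sub>R X) k $ i $ j / fact k)"
      by (rule sums_finite) (auto simp: pw assms)
    with gexp_sums[of "t *\<^sub>R X" i j] have "gexp (t *\<^sub>R X) $ i $ j = (\<Sum>k<N. mat_pow (t *\<^sub>R X) k $ i $ j / fact k)"
      by (rule sums_unique2)
    then show ?thesis by (simp add: pw)
  qed
  then show ?thesis by (simp add: vec_eq_iff)
qed

text \<open>The \<open>k\<close>-th power of \<open>e\<close> would be an eigenvector of the bounded
  operator \<open>ad h\<close> for the eigenvalue \<open>k c\<close>, hence it is zero for large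
  \<open>k\<close>.\<close>

lemma nilpotent_of_eigenvector:
  fixes h e :: "real ^ 'n ^ 'n"
  assumes he: "h ** e - e ** h = c *\<^sub>R e" and c: "c \<noteq> 0"
  obtains N where "\<And>k. k \<ge> N \<Longrightarrow> mat_pow e k = 0"
proof -
  have pw: "h ** mat_pow e k - mat_pow e k ** h = (real k * c) *\<^sub>R mat_pow e k" for k
  proof (induction k)
    case (Suc k)
    have "h ** mat_pow e (Suc k) - mat_pow e (Suc k) ** h
        = (h ** e - e ** h) ** mat_pow e k + e ** (h ** mat_pow e k - mat_pow e k ** h)"
      by (simp add: mat_pow_Suc bounded_bilinear.diff_left[OF bounded_bilinear_matrix_mult]
          bounded_bilinear.diff_right[OF bounded_bilinear_matrix_mult] matrix_mul_assoc)
    also have "\<dots> = (real (Suc k) * c) *\<^sub>R mat_pow e (Suc k)"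
      unfolding he Suc by (simp add: matrix_mul_scaleR_left matrix_mul_scaleR_right mat_pow_Suc algebra_simps)
    finally show ?case .
  qed simp
  have "linear (\<lambda>X. h ** X - X ** h)"
    by (rule linearI) (simp_all add: bounded_bilinear.add_left[OF bounded_bilinear_matrix_mult]
        bounded_bilinear.add_right[OF bounded_bilinear_matrix_mult] matrix_mul_scaleR_left matrix_mul_scaleR_right algebra_simps)
  then obtain C where C: "\<And>X. norm (h ** X - X ** h) \<le> C * norm X" using linear_bounded by blast
  obtain N :: nat where N: "C / \<bar>c\<bar> < real N" using reals_Archimedean2 by blast
  show ?thesis
  proof (rule that[of N], rule ccontr)
    fix k assume k: "k \<ge> N" and nz: "mat_pow e k \<noteq> 0"
    have "real k * \<bar>c\<bar> * norm (mat_pow e k) \<le> C * norm (mat_pow e k)"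
      using C[of "mat_pow e k"] by (simp add: pw abs_mult)
    then have "real k * \<bar>c\<bar> \<le> C" using nz by simp
    then have "real k \<le> C / \<bar>c\<bar>" using c by (simp add: field_simps)
    then show False using N k by linarith
  qed
qed

text \<open>\<open>L\<close> comes from a local extension of \<open>\<rho>\<close> to all matrices
  near the identity, so it is linear on the full matrix space; \<open>chain\<close> ties it to
  \<open>\<rho>\<close> only along curves in the group.\<close>

locale sl2_hom =
  fixes \<rho> :: "real ^ 2 ^ 2 \<Rightarrow> real ^ 'n ^ 'n" and L :: "real ^ 2 ^ 2 \<Rightarrow> real ^ 'n ^ 'n"
  assumes hom_mult: "det A = 1 \<Longrightarrow> det B = 1 \<Longrightarrow> \<rho> (A ** B) = \<rho> A ** \<rho> B"
    and hom_one: "\<rho> (mat 1) = mat 1"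
    and linL: "linear L"
    and chain: "(\<gamma> has_vector_derivative X) (at 0) \<Longrightarrow> \<gamma> 0 = mat 1 \<Longrightarrow> (\<And>t. det (\<gamma> t) = 1) \<Longrightarrow>
      ((\<lambda>t. \<rho> (\<gamma> t)) has_vector_derivative L X) (at 0)"

lemma sl2_hom_exists:
  assumes "lie_group_hom_SL2R G \<rho>" "subgroup G GL"
  obtains L where "sl2_hom \<rho> L"
proof -
  have h: "\<rho> \<in> hom SL2R (GL\<lparr>carrier := G\<rparr>)" and s: "smooth_map_on (carrier SL2R) \<rho>"
    using assms by (auto simp: lie_group_hom_SL2R_def)
  have mult: "\<rho> (A ** B) = \<rho> A ** \<rho> B" if "det A = 1" "det B = 1" for A B
    using hom_mult[OF h, of A B] that unfolding SL2R_def GL_def by simp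
  have inG: "\<rho> (mat 1) \<in> G" using hom_in_carrier[OF h, of "mat 1"] by (simp add: SL2R_def GL_def)
  have m1: "mat 1 \<in> carrier SL2R" by (simp add: SL2R_def)
  obtain U F where UF: "open U" "mat 1 \<in> U" "\<forall>k. Ck_on k U F" "\<forall>y\<in>U \<inter> carrier SL2R. F y = \<rho> y"
    using s[unfolded smooth_map_on_def, THEN bspec, OF m1] by (elim exE conjE)
  have "Ck_on (Suc 0) U F" by (rule UF(3)[THEN spec])
  then have "F differentiable_on U" unfolding Ck_on.simps by (rule conjunct1)
  then have "F differentiable (at (mat 1))" using differentiable_on_eq_differentiable_at[OF UF(1)] UF(2) by metis
  then obtain L where L: "(F has_derivative L) (at (mat 1))" unfolding differentiable_def by (rule exE)
  have linL: "linear L" using L by (rule has_derivative_linear)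
  have chain: "((\<lambda>t. \<rho> (\<gamma> t)) has_vector_derivative L X) (at 0)"
    if \<gamma>: "(\<gamma> has_vector_derivative X) (at 0)" "\<gamma> 0 = mat 1" "\<And>t. det (\<gamma> t) = 1" for \<gamma> X
  proof -
    have "((\<lambda>t. F (\<gamma> t)) has_derivative (\<lambda>t. L (t *\<^sub>R X))) (at 0)"
      using has_derivative_compose[OF \<gamma>(1)[unfolded has_vector_derivative_def], of F L] L \<gamma>(2) by simp
    then have 1: "((\<lambda>t. F (\<gamma> t)) has_vector_derivative L X) (at 0)"
      by (simp add: has_vector_derivative_def linear_scale[OF linL])
    have "isCont \<gamma> 0" using \<gamma>(1) has_vector_derivative_continuous by blast
    then have "(\<gamma> \<longlongrightarrow> mat 1) (at 0)" unfolding isCont_def \<gamma>(2) .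
    then have "\<forall>\<^sub>F t in at 0. \<gamma> t \<in> U" using UF(1,2) by (rule topological_tendstoD)
    then have ev: "\<forall>\<^sub>F t in at 0. F (\<gamma> t) = \<rho> (\<gamma> t)"
      by eventually_elim (use UF(4) \<gamma>(3) in \<open>simp add: SL2R_def\<close>)
    have "((\<lambda>t. F (\<gamma> t)) has_derivative (\<lambda>t. t *\<^sub>R L X)) (at 0)" using 1 by (simp add: has_vector_derivative_def)
    then have "((\<lambda>t. \<rho> (\<gamma> t)) has_derivative (\<lambda>t. t *\<^sub>R L X)) (at 0)"
    proof (rule has_derivative_transform_eventually[OF _ ev])
      show "F (\<gamma> 0) = \<rho> (\<gamma> 0)" using UF(2,4) \<gamma>(2) by (simp add: SL2R_def)
    qed simp
    then show ?thesis by (simp add: has_vector_derivative_def)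
  qed
  have one: "\<rho> (mat 1) = mat 1"
  proof -
    have idem: "\<rho> (mat 1) ** \<rho> (mat 1) = \<rho> (mat 1)" using mult[of "mat 1" "mat 1"] by simp
    have "invertible (\<rho> (mat 1))" using inG subgroup.subset[OF assms(2)] by (auto simp: GL_def)
    then obtain B where B: "B ** \<rho> (mat 1) = mat 1" by (auto simp: invertible_def)
    have "B ** (\<rho> (mat 1) ** \<rho> (mat 1)) = \<rho> (mat 1)" using B by (simp add: matrix_mul_assoc)
    then show ?thesis unfolding idem B by simp
  qed
  show ?thesis by (rule that, rule sl2_hom.intro) (fact mult one linL chain)+
qed

context sl2_hom
begin

abbreviation (input) "Ee \<equiv> mk 0 1 0 0"
abbreviation (input) "Ff \<equiv> mk 0 0 1 0"
abbreviation (input) "Hh \<equiv> mk 1 0 0 (-1)"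

definition e where "e = L Ee"
definition f where "f = L Ff"
definition h where "h = L Hh"

lemma L_mk: "L (mk a b c (- a)) = a *\<^sub>R h + b *\<^sub>R e + c *\<^sub>R f"
proof -
  have "mk a b c (- a) = a *\<^sub>R Hh + b *\<^sub>R Ee + c *\<^sub>R Ff" by simp
  then show ?thesis by (simp only: e_def f_def h_def linear_add[OF linL] linear_scale[OF linL])
qed

lemma upper_deriv: "(upper has_vector_derivative Ee) (at 0)"
  unfolding upper_def by (rule mk_has_vector_derivative) (auto intro!: derivative_eq_intros)

lemma lower_deriv: "(lower has_vector_derivative Ff) (at 0)"
  unfolding lower_def by (rule mk_has_vector_derivative) (auto intro!: derivative_eq_intros)

lemma diag_deriv: "((\<lambda>t. diag (exp t)) has_vector_derivative Hh) (at 0)"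
  unfolding diag_def by (rule mk_has_vector_derivative) (auto intro!: derivative_eq_intros)

lemma rho_inverse:
  assumes "det k = 1" "det k' = 1" "k ** k' = mat 1"
  shows "\<rho> k ** \<rho> k' = mat 1"
  using hom_mult[OF assms(1,2)] assms(3) hom_one by simp

lemma equivariant_curve:
  assumes \<gamma>: "(\<gamma> has_vector_derivative X) (at 0)" "\<gamma> 0 = mat 1" "\<And>t. det (\<gamma> t) = 1"
    and k: "det k = 1" "det k' = 1" "k ** k' = mat 1"
  shows "\<rho> k ** L X ** \<rho> k' = L (k ** X ** k')"
proof -
  have "((\<lambda>t. k ** \<gamma> t ** k') has_vector_derivative (k ** X ** k')) (at 0)"
    by (intro has_vector_derivative_matmul_right has_vector_derivative_matmul_left \<gamma>)
  then have 1: "((\<lambda>t. \<rho> (k ** \<gamma> t ** k')) has_vector_derivative L (k ** X ** k')) (at 0)"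
    by (rule chain) (use \<gamma> k in \<open>auto simp: det_mul\<close>)
  have "((\<lambda>t. \<rho> k ** \<rho> (\<gamma> t) ** \<rho> k') has_vector_derivative (\<rho> k ** L X ** \<rho> k')) (at 0)"
    by (intro has_vector_derivative_matmul_right has_vector_derivative_matmul_left chain \<gamma>)
  moreover have "\<rho> (k ** \<gamma> t ** k') = \<rho> k ** \<rho> (\<gamma> t) ** \<rho> k'" for t
    using \<gamma>(3) k by (simp add: hom_mult det_mul)
  ultimately show ?thesis using 1 by (simp add: vector_derivative_unique_at)
qed

text \<open>Linearity reduces this to the three basis elements, each the velocity of an explicit
  curve.\<close>

lemma equivariant:
  assumes k: "det k = 1" "det k' = 1" "k ** k' = mat 1"
  shows "\<rho> k ** L (mk a b c (- a)) ** \<rho> k' = L (k ** mk a b c (- a) ** k')"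
proof -
  have X: "mk a b c (- a) = a *\<^sub>R Hh + b *\<^sub>R Ee + c *\<^sub>R Ff" by simp
  have E: "\<rho> k ** L Ee ** \<rho> k' = L (k ** Ee ** k')"
    by (rule equivariant_curve[OF upper_deriv _ _ k]) (auto simp: upper_def mat_1_mk)
  have F: "\<rho> k ** L Ff ** \<rho> k' = L (k ** Ff ** k')"
    by (rule equivariant_curve[OF lower_deriv _ _ k]) (auto simp: lower_def mat_1_mk)
  have H: "\<rho> k ** L Hh ** \<rho> k' = L (k ** Hh ** k')"
    by (rule equivariant_curve[OF diag_deriv _ _ k]) (auto simp: diag_def mat_1_mk)
  show ?thesis unfolding X
    by (simp only: linear_add[OF linL] linear_scale[OF linL] matrix_mul_scaleR_left matrix_mul_scaleR_right
      bounded_bilinear.add_left[OF bounded_bilinear_matrix_mult] bounded_bilinear.add_right[OF bounded_bilinear_matrix_mult] E F H)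
qed

text \<open>Differentiating equivariance along \<open>\<gamma>\<close> shows that \<open>L\<close>
  respects brackets.\<close>

lemma bracket_curve:
  assumes \<gamma>: "(\<gamma> has_vector_derivative X) (at 0)" "\<gamma> 0 = mat 1" "\<And>t. det (\<gamma> t) = 1"
    "\<And>t. \<gamma> t ** \<gamma> (- t) = mat 1" and Y: "Y = mk a b c (- a)"
  shows "L X ** L Y - L Y ** L X = L (X ** Y - Y ** X)"
proof -
  have neg: "((\<lambda>t. \<phi> (- t)) has_vector_derivative - V) (at 0)"
    if "(\<phi> has_vector_derivative V) (at 0)" for \<phi> :: "real \<Rightarrow> real ^ 'b ^ 'b" and V
  proof -
    have "((\<lambda>t::real. - t) has_vector_derivative -1) (at 0)" by (auto intro!: derivative_eq_intros)
    from vector_diff_chain_at[OF this, of \<phi> V] that show ?thesis by (simp add: o_def)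
  qed
  have 1: "((\<lambda>t. \<gamma> t ** Y ** \<gamma> (- t)) has_vector_derivative (X ** Y - Y ** X)) (at 0)"
    using has_vector_derivative_matmul[OF has_vector_derivative_matmul_right[OF \<gamma>(1), of Y] neg[OF \<gamma>(1)]]
    by (simp add: \<gamma>(2) matrix_mul_uminus_right)
  have bl: "bounded_linear L" using linL by (simp add: linear_conv_bounded_linear)
  have 2: "((\<lambda>t. L (\<gamma> t ** Y ** \<gamma> (- t))) has_vector_derivative L (X ** Y - Y ** X)) (at 0)"
    by (rule bounded_linear.has_vector_derivative[OF bl 1])
  have c: "((\<lambda>t. \<rho> (\<gamma> t)) has_vector_derivative L X) (at 0)" by (rule chain[OF \<gamma>(1-3)])
  have 3: "((\<lambda>t. \<rho> (\<gamma> t) ** L Y ** \<rho> (\<gamma> (- t))) has_vector_derivative (L X ** L Y - L Y ** L X)) (at 0)"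
    using has_vector_derivative_matmul[OF has_vector_derivative_matmul_right[OF c, of "L Y"] neg[OF c]]
    by (simp add: \<gamma>(2) hom_one matrix_mul_uminus_right)
  have "\<rho> (\<gamma> t) ** L Y ** \<rho> (\<gamma> (- t)) = L (\<gamma> t ** Y ** \<gamma> (- t))" for t
    unfolding Y by (rule equivariant) (use \<gamma> in auto)
  then show ?thesis using 2 3 by (simp add: vector_derivative_unique_at)
qed

lemma bracket_E: "e ** L (mk a b c (- a)) - L (mk a b c (- a)) ** e = L (Ee ** mk a b c (- a) - mk a b c (- a) ** Ee)"
  unfolding e_def by (rule bracket_curve[OF upper_deriv]) (auto simp: upper_def mat_1_mk)

lemma bracket_H: "h ** L (mk a b c (- a)) - L (mk a b c (- a)) ** h = L (Hh ** mk a b c (- a) - mk a b c (- a) ** Hh)"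
  unfolding h_def by (rule bracket_curve[OF diag_deriv]) (auto simp: diag_def mat_1_mk exp_minus)

lemma he: "h ** e - e ** h = 2 *\<^sub>R e" and hf: "h ** f - f ** h = (- 2) *\<^sub>R f" and ef: "e ** f - f ** e = h"
proof -
  show "h ** e - e ** h = 2 *\<^sub>R e"
    using bracket_H[of 0 1 0] L_mk[of 0 2 0] L_mk[of 0 1 0] by simp
  show "h ** f - f ** h = (- 2) *\<^sub>R f"
    using bracket_H[of 0 0 1] L_mk[of 0 0 "-2"] L_mk[of 0 0 1] by simp
  show "e ** f - f ** e = h"
    using bracket_E[of 0 0 1] L_mk[of 1 0 0] L_mk[of 0 0 1] by simp
qed

lemma rho_upper: "\<rho> (upper t) = gexp (t *\<^sub>R e)"
proof (rule one_param_eq_gexp)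
  show "\<rho> (upper (s + t)) = \<rho> (upper s) ** \<rho> (upper t)" for s t
    by (simp add: hom_mult[symmetric]) (simp add: upper_def add.commute)
  show "((\<lambda>t. \<rho> (upper t)) has_vector_derivative e) (at 0)"
    unfolding e_def by (rule chain[OF upper_deriv]) (auto simp: upper_def mat_1_mk)
  show "\<rho> (upper 0) = mat 1" using hom_one by (simp add: upper_def mat_1_mk)
qed

lemma rho_lower: "\<rho> (lower t) = gexp (t *\<^sub>R f)"
proof (rule one_param_eq_gexp)
  show "\<rho> (lower (s + t)) = \<rho> (lower s) ** \<rho> (lower t)" for s t
    by (simp add: hom_mult[symmetric]) (simp add: lower_def add.commute)
  show "((\<lambda>t. \<rho> (lower t)) has_vector_derivative f) (at 0)"
    unfolding f_def by (rule chain[OF lower_deriv]) (auto simp: lower_def mat_1_mk)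
  show "\<rho> (lower 0) = mat 1" using hom_one by (simp add: lower_def mat_1_mk)
qed

lemma differential_A0: "differential \<rho> A0 = h"
proof -
  have "A0 = Hh" by (simp add: A0_def mk_def)
  have "diag (exp t) = gexp (t *\<^sub>R Hh)" for t
    by (rule one_param_eq_gexp[of "\<lambda>t. diag (exp t)", OF _ diag_deriv])
      (simp_all add: diag_def mat_1_mk exp_add)
  then have "(\<lambda>t. \<rho> (mat_exp (t *\<^sub>R A0))) = (\<lambda>t. \<rho> (diag (exp t)))"
    by (simp only: mat_exp_eq_gexp \<open>A0 = Hh\<close>)
  moreover have "((\<lambda>t. \<rho> (diag (exp t))) has_vector_derivative h) (at 0)"
    unfolding h_def by (rule chain[OF diag_deriv]) (auto simp: diag_def mat_1_mk)
  ultimately show ?thesis by (simp add: differential_def vector_derivative_at)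
qed

lemma laurent_upper: "laurent (\<lambda>t. \<rho> (upper t))"
proof -
  obtain N where N: "\<And>k. k \<ge> N \<Longrightarrow> mat_pow e k = 0"
    using nilpotent_of_eigenvector[OF he] by auto
  show ?thesis
    by (rule laurentI_index[of "{..<N}" _ int "\<lambda>k. (1 / fact k) *\<^sub>R mat_pow e k"])
      (auto simp: rho_upper gexp_nilpotent[OF N])
qed

lemma laurent_lower_inverse: "laurent (\<lambda>x. \<rho> (lower (- 1 / x)))"
proof -
  obtain N where N: "\<And>k. k \<ge> N \<Longrightarrow> mat_pow f k = 0"
    using nilpotent_of_eigenvector[OF hf] by auto
  show ?thesis
  proof (rule laurentI_index[of "{..<N}" _ "\<lambda>k. - int k" "\<lambda>k. ((- 1) ^ k / fact k) *\<^sub>R mat_pow f k"])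
    fix x :: real assume "x \<noteq> 0"
    have "(- 1 / x) ^ k / fact k = (x powi (- int k)) * ((- 1) ^ k / fact k)" for k
      by (simp add: power_int_minus power_minus[of "1 / x"] power_one_over field_simps)
    then show "\<rho> (lower (- 1 / x)) = (\<Sum>k<N. (x powi (- int k)) *\<^sub>R ((- 1) ^ k / fact k) *\<^sub>R mat_pow f k)"
      by (simp only: rho_lower gexp_nilpotent[OF N] scaleR_scaleR)
  qed simp
qed

text \<open>\<open>diag x\<close> is a product of elementary matrices with parameters
  \<open>x\<close> and \<open>-1/x\<close> and a Weyl element. As \<open>e\<close> and
  \<open>f\<close> have nilpotent images, integrality of the weights follows without diagonalizing
  \<open>h\<close>.\<close>

lemma laurent_diag: "laurent (\<lambda>x. \<rho> (diag x))"
proof (rule laurent_cong)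
  show "laurent (\<lambda>x. \<rho> (upper x) ** \<rho> (lower (- 1 / x)) ** \<rho> (upper x) ** \<rho> (mk 0 (-1) 1 0))"
    by (intro laurent_matmul laurent_upper laurent_lower_inverse laurent_const)
  fix x :: real assume x: "x \<noteq> 0"
  have "diag x = upper x ** lower (- 1 / x) ** upper x ** mk 0 (-1) 1 0"
    using x by (simp add: diag_def upper_def lower_def)
  then show "\<rho> (diag x) = \<rho> (upper x) ** \<rho> (lower (- 1 / x)) ** \<rho> (upper x) ** \<rho> (mk 0 (-1) 1 0)"
    by (simp add: hom_mult det_mul)
qed

end

section \<open>The adjoint module of an even homomorphism\<close>

lemmas matmul_simps =
  bounded_bilinear.add_left[OF bounded_bilinear_matrix_mult]
  bounded_bilinear.add_right[OF bounded_bilinear_matrix_mult]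
  bounded_bilinear.diff_left[OF bounded_bilinear_matrix_mult]
  bounded_bilinear.diff_right[OF bounded_bilinear_matrix_mult]
  matrix_mul_scaleR_left matrix_mul_scaleR_right

locale even_sl2_hom = sl2_hom \<rho> L for \<rho> :: "real ^ 2 ^ 2 \<Rightarrow> real ^ 'n ^ 'n" and L +
  fixes G :: "(real ^ 'n ^ 'n) set"
  assumes subg: "subspace (lie_algebra G)" and subG: "subgroup G GL"
    and rho_G: "det A = 1 \<Longrightarrow> \<rho> A \<in> G"
    and even: "even_nilpotent_hom G \<rho>"
begin

lemma Ad_closed:
  assumes "X \<in> lie_algebra G" "det k = 1" "det k' = 1" "k ** k' = mat 1" "k' ** k = mat 1"
  shows "\<rho> k ** X ** \<rho> k' \<in> lie_algebra G"
  using assms rho_inverse by (intro lie_algebra_Ad[OF subG]) (auto intro: rho_G)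

text \<open>Weights of the torus in the group, not eigenspaces of \<open>ad h\<close>: negative
  \<open>x\<close> are included, so the parity of \<open>m\<close> records how
  \<open>diag (- 1)\<close> acts.\<close>

definition W :: "int \<Rightarrow> (real ^ 'n ^ 'n) set" where
  "W m = {X \<in> lie_algebra G. \<forall>x. x \<noteq> 0 \<longrightarrow> \<rho> (diag x) ** X = (x powi m) *\<^sub>R (X ** \<rho> (diag x))}"

lemma subspace_W: "subspace (W m)"
  using subg unfolding subspace_def W_def by (auto simp: matmul_simps algebra_simps)

lemma diag_inverse:
  assumes "x \<noteq> 0" shows "diag x ** diag (1 / x) = mat 1" "diag (1 / x) ** diag x = mat 1"
  using assms by (simp_all add: diag_def mat_1_mk)

lemma rho_diag_inverse:
  assumes "x \<noteq> 0"
  shows "\<rho> (diag x) ** \<rho> (diag (1 / x)) = mat 1" "\<rho> (diag (1 / x)) ** \<rho> (diag x) = mat 1"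
  using assms diag_inverse[OF assms] by (auto intro!: rho_inverse)

lemma rho_diag_mult: "x \<noteq> 0 \<Longrightarrow> y \<noteq> 0 \<Longrightarrow> \<rho> (diag x) ** \<rho> (diag y) = \<rho> (diag (x * y))"
  by (simp add: hom_mult[symmetric]) (simp add: diag_def)

text \<open>The weight components of \<open>X\<close> are the coefficients of the Laurent polynomial
  that describes its orbit under the torus; at \<open>x = 1\<close> they add up to
  \<open>X\<close>.\<close>

lemma weight_decomposition:
  assumes X: "X \<in> lie_algebra G"
  obtains F C where "finite F" "\<And>m. m \<in> F \<Longrightarrow> C m \<in> W m" "X = (\<Sum>m\<in>F. C m)"
proof -
  let ?\<phi> = "\<lambda>x. \<rho> (diag x) ** X ** \<rho> (diag (1 / x))"
  have inv: "laurent (\<lambda>x. \<rho> (diag (1 / x)))"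
  proof -
    obtain F C where F: "finite F" "\<And>x. x \<noteq> 0 \<Longrightarrow> \<rho> (diag x) = (\<Sum>m\<in>F. (x powi m) *\<^sub>R C m)"
      using laurent_diag unfolding laurent_def by metis
    show ?thesis
    proof (rule laurentI_index[of F _ uminus C])
      fix x :: real assume "x \<noteq> 0"
      then show "\<rho> (diag (1 / x)) = (\<Sum>i\<in>F. (x powi (- i)) *\<^sub>R C i)"
        using F(2)[of "1 / x"] by (simp add: power_int_minus power_int_one_over inverse_eq_divide)
    qed (rule F)
  qed
  have "laurent ?\<phi>" by (intro laurent_matmul laurent_diag inv laurent_const)
  then obtain F C where F: "finite F" "\<And>x. x \<noteq> 0 \<Longrightarrow> ?\<phi> x = (\<Sum>m\<in>F. (x powi m) *\<^sub>R C m)"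
    unfolding laurent_def by metis
  have inf: "infinite ({0<..} :: real set)" by (rule infinite_Ioi)
  \<comment> \<open>All values lie in the Lie algebra, so the coefficients do.\<close>
  have Cg: "C m \<in> lie_algebra G" if "m \<in> F" for m
  proof (rule laurent_coeffs_in_subspace[OF F(1) inf _ subg _ that])
    fix x :: real assume "x \<in> {0<..}"
    then have "x \<noteq> 0" by simp
    from Ad_closed[OF X, of "diag x" "diag (1 / x)"] diag_inverse[OF this] this
    show "(\<Sum>m\<in>F. (x powi m) *\<^sub>R C m) \<in> lie_algebra G" by (simp add: F(2)[symmetric])
  qed simp
  have CW: "C m \<in> W m" if m: "m \<in> F" for m
  proof -
    have "\<rho> (diag y) ** C m = (y powi m) *\<^sub>R (C m ** \<rho> (diag y))" if y: "y \<noteq> 0" for y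
    proof -
      have "\<rho> (diag y) ** C m ** \<rho> (diag (1 / y)) - (y powi m) *\<^sub>R C m \<in> {0}"
      \<comment> \<open>Coefficients in \<open>x\<close> are compared between the torus element
        \<open>y\<close> applied to the orbit at \<open>x\<close> and the orbit at
        \<open>x * y\<close>.\<close>
      proof (rule laurent_coeffs_in_subspace[OF F(1) inf _ _ _ m,
            of "{0}" "\<lambda>m. \<rho> (diag y) ** C m ** \<rho> (diag (1 / y)) - (y powi m) *\<^sub>R C m"])
        fix x :: real assume "x \<in> {0<..}"
        then have x: "x \<noteq> 0" by simp
        have "(\<Sum>m\<in>F. (x powi m) *\<^sub>R (\<rho> (diag y) ** C m ** \<rho> (diag (1 / y)) - (y powi m) *\<^sub>R C m))
          = \<rho> (diag y) ** (\<Sum>m\<in>F. (x powi m) *\<^sub>R C m) ** \<rho> (diag (1 / y)) - (\<Sum>m\<in>F. ((x * y) powi m) *\<^sub>R C m)"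
          by (simp add: bounded_bilinear.sum_right[OF bounded_bilinear_matrix_mult]
              bounded_bilinear.sum_left[OF bounded_bilinear_matrix_mult] matmul_simps sum_subtractf
              scaleR_diff_right power_int_mult_distrib)
        also have "\<dots> = \<rho> (diag y) ** ?\<phi> x ** \<rho> (diag (1 / y)) - ?\<phi> (x * y)"
          using F(2)[of x] F(2)[of "x * y"] x y by simp
        also have "\<rho> (diag y) ** ?\<phi> x ** \<rho> (diag (1 / y)) = (\<rho> (diag y) ** \<rho> (diag x)) ** X ** (\<rho> (diag (1 / x)) ** \<rho> (diag (1 / y)))"
          by (simp add: matrix_mul_assoc)
        also have "\<dots> = ?\<phi> (x * y)" using x y by (simp add: rho_diag_mult mult.commute)
        finally show "(\<Sum>m\<in>F. (x powi m) *\<^sub>R (\<rho> (diag y) ** C m ** \<rho> (diag (1 / y)) - (y powi m) *\<^sub>R C m)) \<in> {0}"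
          by simp
      qed auto
      then have "\<rho> (diag y) ** C m ** \<rho> (diag (1 / y)) = (y powi m) *\<^sub>R C m" by simp
      then have "\<rho> (diag y) ** C m ** (\<rho> (diag (1 / y)) ** \<rho> (diag y)) = (y powi m) *\<^sub>R (C m ** \<rho> (diag y))"
        by (simp add: matrix_mul_assoc matrix_mul_scaleR_left)
      then show ?thesis using rho_diag_inverse[OF y] by simp
    qed
    then show ?thesis using Cg[OF m] by (simp add: W_def)
  qed
  have "diag 1 = mat 1" by (simp add: diag_def mat_1_mk)
  then have "X = (\<Sum>m\<in>F. C m)" using F(2)[of 1] by (simp add: hom_one)
  then show ?thesis using that F(1) CW by blast
qed

lemma ad_h_weight:
  assumes X: "X \<in> W m" shows "h ** X - X ** h = of_int m *\<^sub>R X"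
proof -
  have c: "((\<lambda>t. \<rho> (diag (exp t))) has_vector_derivative h) (at 0)"
    unfolding h_def by (rule chain[OF diag_deriv]) (auto simp: diag_def mat_1_mk)
  have d1: "diag 1 = mat 1" by (simp add: diag_def mat_1_mk)
  have s: "((\<lambda>t. exp t powi m) has_real_derivative of_int m) (at 0)"
  proof -
    have "(\<lambda>t::real. exp t powi m) = (\<lambda>t. exp (of_int m * t))"
      by (simp add: exp_power_int mult.commute)
    moreover have "((\<lambda>t. exp (of_int m * t)) has_real_derivative of_int m) (at 0)"
      by (auto intro!: derivative_eq_intros)
    ultimately show ?thesis by simp
  qed
  have "((\<lambda>t. \<rho> (diag (exp t)) ** X) has_vector_derivative h ** X) (at 0)"
    by (rule has_vector_derivative_matmul_right[OF c])
  moreover have "((\<lambda>t. (exp t powi m) *\<^sub>R (X ** \<rho> (diag (exp t)))) has_vector_derivative (X ** h + of_int m *\<^sub>R X)) (at 0)"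
    using has_vector_derivative_scaleR[OF s has_vector_derivative_matmul_left[OF c, of X]]
    by (simp add: d1 hom_one)
  moreover have "(\<lambda>t. \<rho> (diag (exp t)) ** X) = (\<lambda>t. (exp t powi m) *\<^sub>R (X ** \<rho> (diag (exp t))))"
    using X by (auto simp: W_def)
  ultimately have "h ** X = X ** h + of_int m *\<^sub>R X" by (simp add: vector_derivative_unique_at)
  then show ?thesis by simp
qed

text \<open>The evenness hypothesis enters here: a vector of weight \<open>m\<close> is an
  eigenvector of \<open>ad (d\<rho> A0)\<close> for \<open>m\<close>.\<close>

lemma W_odd:
  assumes X: "X \<in> W m" and m: "odd m" shows "X = 0"
proof (rule ccontr)
  assume "X \<noteq> 0"
  let ?Z = "cmat X"
  have re: "map_matrix Re ?Z = X" "map_matrix Im ?Z = 0" by (simp_all add: vec_eq_iff)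
  have "?Z \<in> complexified_lie_algebra G"
    using X subspace_0[OF subg] unfolding complexified_lie_algebra_def re by (simp add: W_def re)
  moreover have "?Z \<noteq> 0" using \<open>X \<noteq> 0\<close> by (auto simp: vec_eq_iff)
  moreover have "commutator (cmat (differential \<rho> A0)) ?Z = map_matrix ((*) (of_int m)) ?Z"
  proof -
    have "commutator (cmat (differential \<rho> A0)) ?Z = cmat (h ** X - X ** h)"
      by (simp add: commutator_def differential_A0 linear_diff[OF linear_cmat] cmat_mult)
    also have "\<dots> = map_matrix ((*) (of_int m)) ?Z" unfolding ad_h_weight[OF X] by (simp add: vec_eq_iff)
    finally show ?thesis .
  qed
  ultimately obtain k :: int where "(of_int m :: complex) = of_int (2 * k)"
    using even unfolding even_nilpotent_hom_def by blast
  then have "m = 2 * k" by (simp only: of_int_eq_iff)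
  then show False using m by simp
qed

text \<open>\<open>diag (- 1)\<close> acts by the sign of the parity on each weight space, and only
  even weights occur. Parabolic elements with sign -1 can then be treated like unipotent
  ones.\<close>

lemma rho_minus_central:
  assumes X: "X \<in> lie_algebra G" shows "\<rho> (diag (- 1)) ** X = X ** \<rho> (diag (- 1))"
proof -
  obtain F C where F: "finite F" "\<And>m. m \<in> F \<Longrightarrow> C m \<in> W m" "X = (\<Sum>m\<in>F. C m)"
    using weight_decomposition[OF X] by metis
  have "\<rho> (diag (- 1)) ** C m = C m ** \<rho> (diag (- 1))" if "m \<in> F" for m
  proof (cases "even m")
    case True
    then show ?thesis using F(2)[OF that] by (auto simp: W_def)
  next
    case False
    then show ?thesis using W_odd[OF F(2)[OF that]] by simp
  qed
  then show ?thesis unfolding F(3)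
    by (simp add: bounded_bilinear.sum_right[OF bounded_bilinear_matrix_mult]
        bounded_bilinear.sum_left[OF bounded_bilinear_matrix_mult])
qed

lemma ad_closed:
  assumes X: "X \<in> lie_algebra G"
  shows "e ** X - X ** e \<in> lie_algebra G" "f ** X - X ** f \<in> lie_algebra G"
proof -
  show "e ** X - X ** e \<in> lie_algebra G"
  proof (rule subspace_closed_derivative[OF subg _ ad_vector_derivative])
    show "gexp (t *\<^sub>R e) ** X ** gexp ((- t) *\<^sub>R e) \<in> lie_algebra G" for t
      using Ad_closed[OF X, of "upper t" "upper (- t)"] unfolding rho_upper by (simp add: upper_def mat_1_mk)
  qed
  show "f ** X - X ** f \<in> lie_algebra G"
  proof (rule subspace_closed_derivative[OF subg _ ad_vector_derivative])
    show "gexp (t *\<^sub>R f) ** X ** gexp ((- t) *\<^sub>R f) \<in> lie_algebra G" for t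
      using Ad_closed[OF X, of "lower t" "lower (- t)"] unfolding rho_lower by (simp add: lower_def mat_1_mk)
  qed
qed

lemma rho_diag_e:
  assumes x: "x \<noteq> 0" shows "\<rho> (diag x) ** e = (x powi 2) *\<^sub>R (e ** \<rho> (diag x))"
    "\<rho> (diag x) ** f = (x powi (- 2)) *\<^sub>R (f ** \<rho> (diag x))"
proof -
  have *: "\<rho> (diag x) ** L (mk 0 b c 0) = L (mk 0 (x\<^sup>2 * b) (c / x\<^sup>2) 0) ** \<rho> (diag x)" for b c
  proof -
    have "\<rho> (diag x) ** L (mk 0 b c 0) ** \<rho> (diag (1 / x)) = L (mk 0 (x\<^sup>2 * b) (c / x\<^sup>2) 0)"
      using equivariant[of "diag x" "diag (1 / x)" 0 b c] x diag_inverse[OF x]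
      by (simp add: diag_def power2_eq_square mult_ac)
    then have "\<rho> (diag x) ** L (mk 0 b c 0) ** (\<rho> (diag (1 / x)) ** \<rho> (diag x)) = L (mk 0 (x\<^sup>2 * b) (c / x\<^sup>2) 0) ** \<rho> (diag x)"
      by (simp add: matrix_mul_assoc)
    then show ?thesis using rho_diag_inverse[OF x] by simp
  qed
  show "\<rho> (diag x) ** e = (x powi 2) *\<^sub>R (e ** \<rho> (diag x))"
    using *[of 1 0] L_mk[of 0 1 0] L_mk[of 0 "x\<^sup>2" 0] by (simp add: matrix_mul_scaleR_left)
  show "\<rho> (diag x) ** f = (x powi (- 2)) *\<^sub>R (f ** \<rho> (diag x))"
    using *[of 0 1] L_mk[of 0 0 1] L_mk[of 0 0 "1 / x\<^sup>2"]
    by (simp add: matrix_mul_scaleR_left power_int_minus divide_inverse)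
qed

lemma ad_weight:
  assumes Y: "\<And>x. x \<noteq> 0 \<Longrightarrow> \<rho> (diag x) ** Y = (x powi n) *\<^sub>R (Y ** \<rho> (diag x))"
    and X: "X \<in> W m" and g: "Y ** X - X ** Y \<in> lie_algebra G"
  shows "Y ** X - X ** Y \<in> W (m + n)"
proof -
  have "\<rho> (diag x) ** (Y ** X - X ** Y) = (x powi (m + n)) *\<^sub>R ((Y ** X - X ** Y) ** \<rho> (diag x))" if x: "x \<noteq> 0" for x
  proof -
    have Xx: "\<rho> (diag x) ** X = (x powi m) *\<^sub>R (X ** \<rho> (diag x))" using X x by (auto simp: W_def)
    have 1: "\<rho> (diag x) ** (Y ** X) = (x powi (m + n)) *\<^sub>R (Y ** X ** \<rho> (diag x))"
    proof -
      have "\<rho> (diag x) ** (Y ** X) = (\<rho> (diag x) ** Y) ** X" by (simp add: matrix_mul_assoc)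
      also have "\<dots> = (x powi n) *\<^sub>R (Y ** (\<rho> (diag x) ** X))" unfolding Y[OF x] by (simp add: matmul_simps matrix_mul_assoc)
      also have "\<dots> = (x powi n * x powi m) *\<^sub>R (Y ** X ** \<rho> (diag x))" unfolding Xx by (simp add: matmul_simps matrix_mul_assoc)
      finally show ?thesis using x by (simp add: power_int_add mult.commute)
    qed
    have 2: "\<rho> (diag x) ** (X ** Y) = (x powi (m + n)) *\<^sub>R (X ** Y ** \<rho> (diag x))"
    proof -
      have "\<rho> (diag x) ** (X ** Y) = (\<rho> (diag x) ** X) ** Y" by (simp add: matrix_mul_assoc)
      also have "\<dots> = (x powi m) *\<^sub>R (X ** (\<rho> (diag x) ** Y))" unfolding Xx by (simp add: matmul_simps matrix_mul_assoc)
      also have "\<dots> = (x powi m * x powi n) *\<^sub>R (X ** Y ** \<rho> (diag x))" unfolding Y[OF x] by (simp add: matmul_simps matrix_mul_assoc)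
      finally show ?thesis using x by (simp add: power_int_add)
    qed
    show ?thesis using 1 2 by (simp add: matmul_simps scaleR_diff_right)
  qed
  then show ?thesis using g by (simp add: W_def)
qed

lemma weights: "sl2_weights (\<lambda>X. e ** X - X ** e) (\<lambda>X. f ** X - X ** f) W"
proof (rule sl2_weights.intro)
  show "linear (\<lambda>X. e ** X - X ** e)" "linear (\<lambda>X. f ** X - X ** f)"
    by (rule linearI; simp add: matmul_simps algebra_simps)+
  show "subspace (W m)" for m by (rule subspace_W)
  fix X m assume X: "X \<in> W m"
  then have g: "X \<in> lie_algebra G" by (simp add: W_def)
  show "e ** X - X ** e \<in> W (m + 2)" by (rule ad_weight[OF rho_diag_e(1) X ad_closed(1)[OF g]])
  show "f ** X - X ** f \<in> W (m - 2)"
    using ad_weight[OF rho_diag_e(2) X ad_closed(2)[OF g]] by simp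
  have "e ** (f ** X - X ** f) - (f ** X - X ** f) ** e - (f ** (e ** X - X ** e) - (e ** X - X ** e) ** f)
    = (e ** f - f ** e) ** X - X ** (e ** f - f ** e)"
    by (simp add: matmul_simps matrix_mul_assoc)
  then show "e ** (f ** X - X ** f) - (f ** X - X ** f) ** e - (f ** (e ** X - X ** e) - (e ** X - X ** e) ** f) = of_int m *\<^sub>R X"
    unfolding ef ad_h_weight[OF X] .
qed

text \<open>The two alternatives in \<open>gen\<close> correspond to bending along hyperbolic and
  along parabolic generators.\<close>

lemma lie_algebra_generated:
  assumes S: "subspace S" "\<And>X. X \<in> S \<Longrightarrow> e ** X - X ** e \<in> S" "\<And>X. X \<in> S \<Longrightarrow> f ** X - X ** f \<in> S"
    and gen: "W 0 \<subseteq> S \<or> {X \<in> lie_algebra G. e ** X = X ** e} \<subseteq> S"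
  shows "lie_algebra G \<subseteq> S"
proof
  interpret w: sl2_weights "\<lambda>X. e ** X - X ** e" "\<lambda>X. f ** X - X ** f" W by (rule weights)
  have W: "W m \<subseteq> S" for m
    using gen
  proof
    assume 0: "W 0 \<subseteq> S"
    show ?thesis
    proof (cases "even m")
      case True
      then show ?thesis using w.generated_by_zero_weight[of S m] S 0 by blast
    next
      case False
      then show ?thesis using W_odd[of _ m] subspace_0[OF S(1)] by auto
    qed
  next
    assume "{X \<in> lie_algebra G. e ** X = X ** e} \<subseteq> S"
    then show ?thesis using S by (intro w.generated_by_highest_weight) (auto simp: W_def)
  qed
  fix X assume "X \<in> lie_algebra G"
  then obtain F C where F: "finite F" "\<And>m. m \<in> F \<Longrightarrow> C m \<in> W m" "X = (\<Sum>m\<in>F. C m)"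
    using weight_decomposition by metis
  show "X \<in> S" unfolding F(3) by (intro subspace_sum S) (use F(2) W in auto)
qed

lemma commute_diag: "X \<in> W 0 \<Longrightarrow> x \<noteq> 0 \<Longrightarrow> \<rho> (diag x) ** X = X ** \<rho> (diag x)"
  by (auto simp: W_def)

lemma commute_upper:
  assumes X: "X \<in> lie_algebra G" "e ** X = X ** e" and s: "\<bar>s\<bar> = 1"
  shows "\<rho> (s *\<^sub>R upper t) ** X = X ** \<rho> (s *\<^sub>R upper t)"
proof -
  have u: "\<rho> (upper t) ** X = X ** \<rho> (upper t)"
    unfolding rho_upper by (rule gexp_commute[symmetric]) (simp add: matmul_simps X(2))
  consider "s = 1" | "s = - 1" using s by linarith
  then show ?thesis
  proof cases
    case 1
    then show ?thesis using u by simp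
  next
    case 2
    have "s *\<^sub>R upper t = diag (- 1) ** upper t" by (simp add: 2 diag_def upper_def)
    then have "\<rho> (s *\<^sub>R upper t) = \<rho> (diag (- 1)) ** \<rho> (upper t)" by (simp add: hom_mult)
    then show ?thesis using u rho_minus_central[OF X(1)] by (metis matrix_mul_assoc)
  qed
qed

end

section \<open>Surface groups\<close>

primrec weval :: "('a, 'b) monoid_scheme \<Rightarrow> (nat \<Rightarrow> 'a) \<Rightarrow> word \<Rightarrow> 'a" where
  "weval K x [] = \<one>\<^bsub>K\<^esub>"
| "weval K x (l # w) = (if snd l then x (fst l) else inv\<^bsub>K\<^esub> (x (fst l))) \<otimes>\<^bsub>K\<^esub> weval K x w"

lemma surface_words_Cons: "(k, s) # w \<in> surface_words g \<longleftrightarrow> k < 2 * g \<and> w \<in> surface_words g"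
  by (auto simp: surface_words_def)

lemma surface_words_append: "u @ v \<in> surface_words g \<longleftrightarrow> u \<in> surface_words g \<and> v \<in> surface_words g"
  by (auto simp: surface_words_def)

lemma surface_words_Nil: "[] \<in> surface_words g"
  by (auto simp: surface_words_def)

context
  fixes K :: "('a, 'b) monoid_scheme" and x :: "nat \<Rightarrow> 'a" and g :: nat
  assumes K: "group K" and x: "\<And>k. k < 2 * g \<Longrightarrow> x k \<in> carrier K"
begin

lemma weval_closed: "w \<in> surface_words g \<Longrightarrow> weval K x w \<in> carrier K"
proof (induction w)
  case Nil
  then show ?case using K by (simp add: group.is_monoid)
next
  case (Cons l w)
  obtain k s where l: "l = (k, s)" by (cases l)
  show ?case using Cons x K unfolding l surface_words_Cons
    by (auto intro!: monoid.m_closed group.is_monoid group.inv_closed)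
qed

lemma weval_append:
  "u \<in> surface_words g \<Longrightarrow> v \<in> surface_words g \<Longrightarrow> weval K x (u @ v) = weval K x u \<otimes>\<^bsub>K\<^esub> weval K x v"
proof (induction u)
  case Nil
  then show ?case using K weval_closed by (simp add: group.is_monoid monoid.l_one)
next
  case (Cons l u)
  obtain k s where l: "l = (k, s)" by (cases l)
  have "k < 2 * g" "u \<in> surface_words g" using Cons.prems unfolding l surface_words_Cons by auto
  moreover from this have "x k \<in> carrier K" "inv\<^bsub>K\<^esub> x k \<in> carrier K" using x K by (simp_all add: group.inv_closed)
  ultimately show ?case using Cons.IH Cons.prems(2) weval_closed
    by (simp add: l monoid.m_assoc[OF group.is_monoid[OF K]])
qed

lemma surface_rel_weval:
  assumes rel: "weval K x (surface_relator g) = \<one>\<^bsub>K\<^esub>"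
  shows "(v, w) \<in> surface_rel g \<Longrightarrow> weval K x v = weval K x w"
proof (induction rule: surface_rel.induct)
  case (cancel u v k s)
  have kx: "x k \<in> carrier K" using cancel x by simp
  have "weval K x [(k, s), (k, \<not> s)] = \<one>\<^bsub>K\<^esub>"
    using kx K by (cases s) (simp_all add: group.is_monoid monoid.r_one group.r_inv group.l_inv group.inv_closed)
  moreover have "[(k, s), (k, \<not> s)] \<in> surface_words g" using cancel by (simp add: surface_words_def)
  ultimately show ?case using cancel K weval_closed
    by (simp add: weval_append surface_words_append group.is_monoid monoid.l_one del: append_Cons append.simps weval.simps)
next
  case (relator u v)
  then show ?case using K weval_closed rel surface_relator_in_words[of g]
    by (simp add: weval_append surface_words_append group.is_monoid monoid.l_one)
qed auto

end

lemma weval_concat_cong: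
  assumes K: "group K" and x: "\<And>k. k < 2 * g \<Longrightarrow> x k \<in> carrier K" "\<And>k. k < 2 * g \<Longrightarrow> y k \<in> carrier K"
    and ls: "\<And>l. l \<in> set ls \<Longrightarrow> l \<in> surface_words g \<and> weval K x l = weval K y l"
  shows "weval K x (concat ls) = weval K y (concat ls)"
  using ls
proof (induction ls)
  case (Cons l ls)
  have "concat ls \<in> surface_words g" using Cons.prems
    by (induction ls) (auto simp: surface_words_Nil surface_words_append)
  then show ?case using Cons by (simp add: weval_append[OF K x(1)] weval_append[OF K x(2)])
qed simp

lemma weval_relator_cong:
  assumes K: "group K" and x: "\<And>k. k < 2 * g \<Longrightarrow> x k \<in> carrier K" "\<And>k. k < 2 * g \<Longrightarrow> y k \<in> carrier K"
    and b: "\<And>i. i < g \<Longrightarrow> weval K x [(2*i, True), (2*i+1, True), (2*i, False), (2*i+1, False)]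
       = weval K y [(2*i, True), (2*i+1, True), (2*i, False), (2*i+1, False)]"
  shows "weval K x (surface_relator g) = weval K y (surface_relator g)"
  unfolding surface_relator_def
  by (rule weval_concat_cong[where g = g, OF K x]) (use b in \<open>auto simp: surface_words_def\<close>)

lemma weval_one: "group K \<Longrightarrow> weval K (\<lambda>_. \<one>\<^bsub>K\<^esub>) w = \<one>\<^bsub>K\<^esub>"
  by (induction w) (auto simp: group.is_monoid monoid.l_one monoid.one_closed monoid.inv_one)

text \<open>The isomorphism with \<open>surface_group g\<close> in usable form:
  \<open>\<alpha>\<close> generates \<open>\<Gamma>\<close> and satisfies exactly the surface
  relations.\<close>

definition surface_gens :: "nat \<Rightarrow> (real ^ 2 ^ 2) set \<Rightarrow> (nat \<Rightarrow> real ^ 2 ^ 2) \<Rightarrow> bool" where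
  "surface_gens g \<Gamma> \<alpha> \<longleftrightarrow> (\<forall>k<2 * g. \<alpha> k \<in> \<Gamma>) \<and> \<Gamma> = weval SL2R \<alpha> ` surface_words g \<and>
     (\<forall>u\<in>surface_words g. \<forall>v\<in>surface_words g. weval SL2R \<alpha> u = weval SL2R \<alpha> v \<longleftrightarrow> (u, v) \<in> surface_rel g)"

lemma surface_gens_exist:
  assumes \<Gamma>: "subgroup \<Gamma> SL2R" and iso: "SL2R\<lparr>carrier := \<Gamma>\<rparr> \<cong> surface_group g"
  obtains \<alpha> where "surface_gens g \<Gamma> \<alpha>"
proof -
  let ?G = "SL2R\<lparr>carrier := \<Gamma>\<rparr>"
  have grp: "group ?G" by (rule subgroup.subgroup_is_group[OF \<Gamma> group_SL2R])
  obtain \<psi> where \<psi>: "\<psi> \<in> Group.iso ?G (surface_group g)" using iso by (auto simp: is_iso_def)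
  then have hom: "\<psi> \<in> hom ?G (surface_group g)" and bij: "bij_betw \<psi> \<Gamma> (carrier (surface_group g))"
    by (auto simp: Group.iso_def)
  interpret \<psi>: group_hom ?G "surface_group g" \<psi>
    by (rule group_hom.intro[OF grp group_surface_group]) (simp add: group_hom_axioms_def hom)
  let ?c = "\<lambda>u. surface_rel g `` {u}"
  have car: "?c u \<in> carrier (surface_group g)" if "u \<in> surface_words g" for u
    using that by (auto simp: surface_group_def quotient_def)
  define \<alpha> where "\<alpha> k = inv_into \<Gamma> \<psi> (?c [(k, True)])" for k
  have w1: "[(k, s)] \<in> surface_words g" if "k < 2 * g" for k s using that by (simp add: surface_words_def)
  have \<alpha>: "\<alpha> k \<in> \<Gamma>" "\<psi> (\<alpha> k) = ?c [(k, True)]" if "k < 2 * g" for k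
    using car[OF w1[OF that]] bij unfolding \<alpha>_def bij_betw_def
    by (metis inv_into_into, metis f_inv_into_f)
  have invG: "inv\<^bsub>SL2R\<^esub> a \<in> \<Gamma>" "inv\<^bsub>?G\<^esub> a = inv\<^bsub>SL2R\<^esub> a" if "a \<in> \<Gamma>" for a
    using subgroup.m_inv_closed[OF \<Gamma> that] group.m_inv_consistent[OF group_SL2R \<Gamma> that] by auto
  have ev: "weval SL2R \<alpha> u \<in> \<Gamma> \<and> \<psi> (weval SL2R \<alpha> u) = ?c u" if "u \<in> surface_words g" for u
    using that
  proof (induction u)
    case Nil
    have "\<psi> \<one>\<^bsub>SL2R\<^esub> = \<one>\<^bsub>surface_group g\<^esub>" using \<psi>.hom_one by simp
    then show ?case using subgroup.one_closed[OF \<Gamma>] by (simp add: surface_group_def)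
  next
    case (Cons l u)
    obtain k s where l: "l = (k, s)" by (cases l)
    have k: "k < 2 * g" and u: "u \<in> surface_words g" using Cons.prems unfolding l surface_words_Cons by auto
    note IH = Cons.IH[OF u]
    let ?a = "if s then \<alpha> k else inv\<^bsub>SL2R\<^esub> (\<alpha> k)"
    have a: "?a \<in> \<Gamma>" using \<alpha>(1)[OF k] invG by simp
    have "\<psi> ?a = ?c [(k, s)]"
    proof (cases s)
      case True
      then show ?thesis using \<alpha>(2)[OF k] by simp
    next
      case False
      have "?c [(k, False)] \<otimes>\<^bsub>surface_group g\<^esub> ?c [(k, True)] = \<one>\<^bsub>surface_group g\<^esub>"
      proof -
        have "([(k, False), (k, \<not> False)], []) \<in> surface_rel g"
          using surface_rel.cancel[of "[]" g "[]" k False] k by (simp add: surface_words_Nil)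
        then have "?c [(k, False), (k, True)] = ?c []" using equiv_class_eq[OF equiv_surface_rel] by simp
        then show ?thesis using surface_group_mult_class[OF w1[OF k] w1[OF k], of False True]
          by (simp add: surface_group_def)
      qed
      then have "inv\<^bsub>surface_group g\<^esub> (?c [(k, True)]) = ?c [(k, False)]"
        using car[OF w1[OF k]] by (intro group.inv_equality[OF group_surface_group]) auto
      moreover have "\<psi> (inv\<^bsub>?G\<^esub> (\<alpha> k)) = inv\<^bsub>surface_group g\<^esub> \<psi> (\<alpha> k)"
        using \<alpha>(1)[OF k] by (intro \<psi>.hom_inv) simp
      ultimately show ?thesis using False \<alpha>[OF k] invG by simp
    qed
    moreover have "\<psi> (?a \<otimes>\<^bsub>SL2R\<^esub> weval SL2R \<alpha> u) = \<psi> ?a \<otimes>\<^bsub>surface_group g\<^esub> \<psi> (weval SL2R \<alpha> u)"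
      using \<psi>.hom_mult[of ?a "weval SL2R \<alpha> u"] a IH by simp
    moreover have lu: "weval SL2R \<alpha> (l # u) = ?a \<otimes>\<^bsub>SL2R\<^esub> weval SL2R \<alpha> u" by (simp add: l)
    ultimately have "\<psi> (weval SL2R \<alpha> (l # u)) = ?c (l # u)"
      using IH surface_group_mult_class[OF w1[OF k] u, of s] by (simp only: l append.simps)
    moreover have "weval SL2R \<alpha> (l # u) \<in> \<Gamma>"
      using subgroup.m_closed[OF \<Gamma> a, of "weval SL2R \<alpha> u"] IH unfolding lu by blast
    ultimately show ?case by blast
  qed
  have inj: "inj_on \<psi> \<Gamma>" using bij by (simp add: bij_betw_def)
  have "surface_gens g \<Gamma> \<alpha>" unfolding surface_gens_def
  proof (intro conjI ballI allI impI equalityI subsetI)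
    show "\<alpha> k \<in> \<Gamma>" if "k < 2 * g" for k by (rule \<alpha>(1)[OF that])
    show "\<gamma> \<in> \<Gamma>" if "\<gamma> \<in> weval SL2R \<alpha> ` surface_words g" for \<gamma> using that ev by auto
    show "\<gamma> \<in> weval SL2R \<alpha> ` surface_words g" if \<gamma>: "\<gamma> \<in> \<Gamma>" for \<gamma>
    proof -
      have "\<psi> \<gamma> \<in> carrier (surface_group g)" using bij \<gamma> by (auto simp: bij_betw_def)
      then obtain u where u: "u \<in> surface_words g" "\<psi> \<gamma> = ?c u" by (auto simp: surface_group_def quotient_def)
      then have "\<gamma> = weval SL2R \<alpha> u" using inj_onD[OF inj, of \<gamma> "weval SL2R \<alpha> u"] ev[OF u(1)] \<gamma> by simp
      then show ?thesis using u by blast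
    qed
    fix u v assume u: "u \<in> surface_words g" and v: "v \<in> surface_words g"
    have "weval SL2R \<alpha> u = weval SL2R \<alpha> v \<longleftrightarrow> ?c u = ?c v"
      using inj_on_eq_iff[OF inj, of "weval SL2R \<alpha> u" "weval SL2R \<alpha> v"] ev[OF u] ev[OF v] by simp
    also have "\<dots> \<longleftrightarrow> (u, v) \<in> surface_rel g" by (rule eq_equiv_class_iff[OF equiv_surface_rel u v])
    finally show "weval SL2R \<alpha> u = weval SL2R \<alpha> v \<longleftrightarrow> (u, v) \<in> surface_rel g" .
  qed
  then show ?thesis by (rule that)
qed

text \<open>The universal property of the presentation. Any word representing an element may be
  evaluated, since two such words are related and hence have equal values in
  \<open>K\<close>.\<close>

lemma surface_gens_hom:
  assumes \<alpha>: "surface_gens g \<Gamma> \<alpha>" and \<Gamma>: "subgroup \<Gamma> SL2R" and K: "group K"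
    and x: "\<And>k. k < 2 * g \<Longrightarrow> x k \<in> carrier K" and rel: "weval K x (surface_relator g) = \<one>\<^bsub>K\<^esub>"
  obtains \<Phi> where "\<Phi> \<in> hom (SL2R\<lparr>carrier := \<Gamma>\<rparr>) K" "\<And>u. u \<in> surface_words g \<Longrightarrow> \<Phi> (weval SL2R \<alpha> u) = weval K x u"
proof -
  define \<Phi> where "\<Phi> \<gamma> = weval K x (SOME u. u \<in> surface_words g \<and> weval SL2R \<alpha> u = \<gamma>)" for \<gamma>
  have ev: "\<Phi> (weval SL2R \<alpha> u) = weval K x u" if u: "u \<in> surface_words g" for u
  proof -
    let ?v = "SOME v. v \<in> surface_words g \<and> weval SL2R \<alpha> v = weval SL2R \<alpha> u"
    have "?v \<in> surface_words g \<and> weval SL2R \<alpha> ?v = weval SL2R \<alpha> u" by (rule someI[of _ u]) (simp add: u)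
    then have "(?v, u) \<in> surface_rel g" using \<alpha> u unfolding surface_gens_def by blast
    then show ?thesis unfolding \<Phi>_def using surface_rel_weval[of K g x, OF K _ rel] x by blast
  qed
  have sub: "\<Gamma> \<subseteq> carrier SL2R" by (rule subgroup.subset[OF \<Gamma>])
  have \<alpha>c: "\<alpha> k \<in> carrier SL2R" if "k < 2 * g" for k using \<alpha> sub that by (auto simp: surface_gens_def)
  have im: "\<Gamma> = weval SL2R \<alpha> ` surface_words g" using \<alpha> by (simp add: surface_gens_def)
  have "\<Phi> \<in> hom (SL2R\<lparr>carrier := \<Gamma>\<rparr>) K"
  proof (rule homI)
    fix a assume "a \<in> carrier (SL2R\<lparr>carrier := \<Gamma>\<rparr>)"
    then obtain u where u: "u \<in> surface_words g" "a = weval SL2R \<alpha> u" using im by auto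
    then show "\<Phi> a \<in> carrier K" using ev weval_closed[OF K x] by simp
    fix b assume "b \<in> carrier (SL2R\<lparr>carrier := \<Gamma>\<rparr>)"
    then obtain v where v: "v \<in> surface_words g" "b = weval SL2R \<alpha> v" using im by auto
    have "a \<otimes>\<^bsub>SL2R\<^esub> b = weval SL2R \<alpha> (u @ v)" using u v by (simp add: weval_append[OF group_SL2R \<alpha>c])
    moreover have "weval K x (u @ v) = weval K x u \<otimes>\<^bsub>K\<^esub> weval K x v" using u v by (simp add: weval_append[OF K x])
    ultimately show "\<Phi> (a \<otimes>\<^bsub>SL2R\<lparr>carrier := \<Gamma>\<rparr>\<^esub> b) = \<Phi> a \<otimes>\<^bsub>K\<^esub> \<Phi> b"
      using u v ev[of "u @ v"] ev by (simp add: surface_words_append)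
  qed
  then show ?thesis using that ev by blast
qed

section \<open>Discrete surface groups in SL(2,R)\<close>

lemma SL2R_simps [simp]: "A \<otimes>\<^bsub>SL2R\<^esub> B = A ** B" "\<one>\<^bsub>SL2R\<^esub> = mat 1" "A \<in> carrier SL2R \<longleftrightarrow> det A = 1"
  by (simp_all add: SL2R_def)

lemma SL2R_inv_eq: "det A = 1 \<Longrightarrow> det B = 1 \<Longrightarrow> B ** A = mat 1 \<Longrightarrow> inv\<^bsub>SL2R\<^esub> A = B"
  by (intro group.inv_equality[OF group_SL2R]) auto

lemma inv_upper: "inv\<^bsub>SL2R\<^esub> (upper t) = upper (- t)" and inv_lower: "inv\<^bsub>SL2R\<^esub> (lower t) = lower (- t)"
  and inv_mat1: "inv\<^bsub>SL2R\<^esub> (mat 1) = mat 1"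
  by (intro SL2R_inv_eq; simp add: upper_def lower_def mat_1_mk)+

context
  fixes g :: nat and \<Gamma> :: "(real ^ 2 ^ 2) set" and \<alpha> :: "nat \<Rightarrow> real ^ 2 ^ 2"
  assumes \<alpha>: "surface_gens g \<Gamma> \<alpha>" and \<Gamma>: "subgroup \<Gamma> SL2R"
begin

lemma gens_in: "k < 2 * g \<Longrightarrow> \<alpha> k \<in> \<Gamma>"
  using \<alpha> unfolding surface_gens_def by blast

lemma gens_det: "k < 2 * g \<Longrightarrow> det (\<alpha> k) = 1"
  using gens_in[of k] subgroup.subset[OF \<Gamma>] by auto

text \<open>Sending one generator to \<open>upper 1\<close> and the others to the identity respects
  the relator, since each commutator in it has a trivial entry; the image has infinite
  order.\<close>

lemma gens_infinite_order:
  assumes k: "k < 2 * g" and n: "n > 0" shows "mat_pow (\<alpha> k) n \<noteq> mat 1"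
proof
  assume 1: "mat_pow (\<alpha> k) n = mat 1"
  let ?x = "\<lambda>j. if j = k then upper 1 else mat 1"
  have "weval SL2R ?x (surface_relator g) = weval SL2R (\<lambda>_. \<one>\<^bsub>SL2R\<^esub>) (surface_relator g)"
  proof (rule weval_relator_cong[OF group_SL2R])
    fix i
    have "upper 1 ** upper (- 1) = mat 1" by (simp add: upper_def mat_1_mk)
    then show "weval SL2R ?x [(2*i, True), (2*i+1, True), (2*i, False), (2*i+1, False)]
       = weval SL2R (\<lambda>_. \<one>\<^bsub>SL2R\<^esub>) [(2*i, True), (2*i+1, True), (2*i, False), (2*i+1, False)]"
      by (auto simp: inv_upper inv_mat1 matrix_mul_assoc)
  qed auto
  then have rel: "weval SL2R ?x (surface_relator g) = \<one>\<^bsub>SL2R\<^esub>" by (simp only: weval_one[OF group_SL2R])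
  obtain \<Phi> where \<Phi>: "\<And>u. u \<in> surface_words g \<Longrightarrow> \<Phi> (weval SL2R \<alpha> u) = weval SL2R ?x u"
    by (rule surface_gens_hom[OF \<alpha> \<Gamma> group_SL2R _ rel]) auto
  have rep: "weval SL2R y (replicate n (k, True)) = mat_pow (y k) n" for y and n
    by (induction n) (simp_all add: mat_pow_Suc)
  have w: "replicate n (k, True) \<in> surface_words g" using k by (auto simp: surface_words_def)
  have "mat_pow (upper 1) n = mat 1"
    using \<Phi>[OF w] \<Phi>[OF surface_words_Nil] by (simp add: rep 1)
  moreover have "mat_pow (upper 1) n = upper n"
    by (induction n) (simp_all add: mat_pow_Suc upper_def mat_1_mk)
  ultimately show False using n by (simp add: upper_def mat_1_mk)
qed

text \<open>The first handle is sent to \<open>upper 1, lower 1\<close> and the second to the same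
  pair in reverse order, so that the two commutators cancel. The commutators to be separated have
  images that do not commute.\<close>

lemma gens_not_metabelian:
  assumes g: "g \<ge> 2" and A': "\<alpha> 0 ** A' = mat 1" "A' ** \<alpha> 0 = mat 1" and B': "\<alpha> 1 ** B' = mat 1" "B' ** \<alpha> 1 = mat 1"
    and det': "det A' = 1" "det B' = 1"
  shows "(\<alpha> 0 ** \<alpha> 1 ** A' ** B') ** (A' ** \<alpha> 1 ** \<alpha> 0 ** B') \<noteq> (A' ** \<alpha> 1 ** \<alpha> 0 ** B') ** (\<alpha> 0 ** \<alpha> 1 ** A' ** B')"
proof
  assume eq: "(\<alpha> 0 ** \<alpha> 1 ** A' ** B') ** (A' ** \<alpha> 1 ** \<alpha> 0 ** B') = (A' ** \<alpha> 1 ** \<alpha> 0 ** B') ** (\<alpha> 0 ** \<alpha> 1 ** A' ** B')"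
  let ?x = "\<lambda>j::nat. if j = 0 \<or> j = 3 then upper 1 else if j = 1 \<or> j = 2 then lower 1 else mat 1"
  let ?c = "[(0, True), (1, True), (0, False), (1, False)] :: word"
  let ?d = "[(0, False), (1, True), (0, True), (1, False)] :: word"
  have xc: "?x k \<in> carrier SL2R" for k by simp
  have rel: "weval SL2R ?x (surface_relator g) = \<one>\<^bsub>SL2R\<^esub>"
  proof -
    let ?f = "\<lambda>i. [(2*i, True), (2*i+1, True), (2*i, False), (2*i+1, False)] :: word"
    obtain m where m: "g = Suc (Suc m)" using g by (metis add_2_eq_Suc le_Suc_ex)
    have "[0..<g] = 0 # 1 # map (\<lambda>i. i + 2) [0..<m]"
      unfolding m by (induction m) simp_all
    then have r: "surface_relator g = ?f 0 @ ?f 1 @ concat (map ?f (map (\<lambda>i. i + 2) [0..<m]))"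
      by (simp add: surface_relator_def)
    have tl: "concat (map ?f (map (\<lambda>i. i + 2) [0..<m])) \<in> surface_words g"
      by (auto simp: surface_words_def m)
    have "weval SL2R ?x (concat (map ?f (map (\<lambda>i. i + 2) [0..<m]))) = weval SL2R (\<lambda>_. \<one>\<^bsub>SL2R\<^esub>) (concat (map ?f (map (\<lambda>i. i + 2) [0..<m])))"
      by (rule weval_concat_cong[OF group_SL2R, where g = g])
        (auto simp: surface_words_def m inv_mat1)
    then have t1: "weval SL2R ?x (concat (map ?f (map (\<lambda>i. i + 2) [0..<m]))) = mat 1"
      by (simp only: weval_one[OF group_SL2R]) simp
    have w: "?f 0 @ ?f 1 \<in> surface_words g" "?f 0 \<in> surface_words g" "?f 1 \<in> surface_words g" by (auto simp: surface_words_def m)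
    have "weval SL2R ?x (?f 0 @ ?f 1) = mat 1"
      by (simp add: inv_upper inv_lower) (simp add: upper_def lower_def mat_1_mk)
    then have "weval SL2R ?x ((?f 0 @ ?f 1) @ concat (map ?f (map (\<lambda>i. i + 2) [0..<m]))) = mat 1"
      unfolding weval_append[OF group_SL2R xc w(1) tl] t1 by simp
    then show ?thesis unfolding r append_assoc by simp
  qed
  obtain \<Phi> where "\<Phi> \<in> hom (SL2R\<lparr>carrier := \<Gamma>\<rparr>) SL2R"
    and \<Phi>: "\<And>u. u \<in> surface_words g \<Longrightarrow> \<Phi> (weval SL2R \<alpha> u) = weval SL2R ?x u"
    by (rule surface_gens_hom[OF \<alpha> \<Gamma> group_SL2R xc rel]) (rule that)
  have inv: "inv\<^bsub>SL2R\<^esub> (\<alpha> 0) = A'" "inv\<^bsub>SL2R\<^esub> (\<alpha> (Suc 0)) = B'"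
    using gens_det[of 0] gens_det[of 1] g A' B' det' by (auto intro!: SL2R_inv_eq)
  have w: "?c @ ?d \<in> surface_words g" "?d @ ?c \<in> surface_words g" using g by (auto simp: surface_words_def)
  have "weval SL2R \<alpha> (?c @ ?d) = weval SL2R \<alpha> (?d @ ?c)"
    using eq by (simp add: inv matrix_mul_assoc)
  then have "weval SL2R ?x (?c @ ?d) = weval SL2R ?x (?d @ ?c)" using \<Phi>[OF w(1)] \<Phi>[OF w(2)] by simp
  then show False by (simp add: inv_upper inv_lower) (simp add: upper_def lower_def mat_1_mk)
qed

lemma gens_pow_in: "k < 2 * g \<Longrightarrow> mat_pow (\<alpha> k) n \<in> \<Gamma>"
proof (induction n)
  case 0
  then show ?case using subgroup.one_closed[OF \<Gamma>] by simp
next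
  case (Suc n)
  then show ?case using subgroup.m_closed[OF \<Gamma>, of "\<alpha> k" "mat_pow (\<alpha> k) n"] gens_in[of k]
    by (simp add: mat_pow_Suc)
qed

text \<open>Infinite order excludes elliptic elements, which have finite order in a discrete group,
  and plus or minus the identity.\<close>

lemma gens_normal_form:
  assumes k: "k < 2 * g" and disc: "discrete \<Gamma>"
  obtains c c' where "det c = 1" "det c' = 1" "c ** c' = mat 1" "c' ** c = mat 1"
    "(\<exists>x. x \<noteq> 0 \<and> \<bar>x\<bar> \<noteq> 1 \<and> \<alpha> k = c ** diag x ** c') \<or>
     (\<exists>s t. \<bar>s\<bar> = 1 \<and> t \<noteq> 0 \<and> \<alpha> k = c ** (s *\<^sub>R upper t) ** c')"
proof (rule SL2R_normal_form[OF gens_det[OF k]])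
  show "\<bar>\<alpha> k $ 1 $ 1 + \<alpha> k $ 2 $ 2\<bar> \<ge> 2"
  proof (rule ccontr)
    assume "\<not> ?thesis"
    then obtain n where "n > 0" "mat_pow (\<alpha> k) n = mat 1"
      using elliptic_finite_order[OF disc _ gens_pow_in[OF k] gens_det[OF k]] subgroup.one_closed[OF \<Gamma>] by auto
    then show False using gens_infinite_order[OF k] by blast
  qed
  show "\<alpha> k \<noteq> mat 1" using gens_infinite_order[OF k, of 1] by (auto simp: mat_pow_Suc)
  show "\<alpha> k \<noteq> - mat 1"
    using gens_infinite_order[OF k, of 2]
    by (auto simp: mat_pow_Suc numeral_2_eq_2 matrix_mul_uminus_left matrix_mul_uminus_right)
qed (use that in blast)

end

section \<open>Generating the Lie algebra of the Zariski closure\<close>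

text \<open>Zeros of \<open>p (gexp (t X))\<close> that accumulate at \<open>t = 0\<close> force its
  derivative there to vanish.\<close>

lemma tangent_small_times:
  assumes T: "mult_closed T" and small: "\<And>\<delta>. \<delta> > 0 \<Longrightarrow> \<exists>t. t \<noteq> 0 \<and> \<bar>t\<bar> < \<delta> \<and> gexp (t *\<^sub>R X) \<in> zclosure T"
  shows "X \<in> tangent T"
  unfolding tangent_def
proof (intro CollectI ballI)
  fix p assume p: "p \<in> vanishing T"
  then have pf: "p \<in> pfun" by (simp add: vanishing_def)
  let ?D = "pder p (mat 1) X"
  let ?f = "\<lambda>t. p (gexp (t *\<^sub>R X))"
  have "(p has_derivative pder p (mat 1)) (at (gexp (0 *\<^sub>R X)))" using pfun_has_derivative[OF pf] by (simp add: gexp_zero)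
  from has_derivative_compose[OF gexp_vector_derivative_0[unfolded has_vector_derivative_def] this]
  have d: "(?f has_derivative (\<lambda>t. t *\<^sub>R ?D)) (at 0)"
    by (simp add: linear_scale[OF linear_pder[OF pf]])
  have f0: "?f 0 = 0" using p T by (simp add: gexp_zero vanishing_def mult_closed_def)
  show "?D = 0"
  proof (rule ccontr)
    assume D: "?D \<noteq> 0"
    then have "norm ?D / 2 > 0" by simp
    then obtain \<delta> where \<delta>: "\<delta> > 0" "\<And>t. norm (t - 0) < \<delta> \<Longrightarrow> norm (?f t - ?f 0 - (t - 0) *\<^sub>R ?D) \<le> norm ?D / 2 * norm (t - 0)"
      using d unfolding has_derivative_at_alt by blast
    obtain t where t: "t \<noteq> 0" "\<bar>t\<bar> < \<delta>" "gexp (t *\<^sub>R X) \<in> zclosure T" using small[OF \<delta>(1)] by blast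
    have "?f t = 0" using t(3) p by (auto simp: zclosure_def)
    then have "\<bar>t\<bar> * norm ?D \<le> norm ?D / 2 * \<bar>t\<bar>" using \<delta>(2)[of t] t(2) f0 by simp
    then have "\<bar>t\<bar> * norm ?D \<le> 0" by (simp add: field_simps)
    then show False using t(1) D by (simp add: mult_le_0_iff)
  qed
qed

lemma gexp_int_multiple:
  fixes X :: "complex ^ 'n ^ 'n"
  assumes T: "mult_closed T" and t: "gexp (t *\<^sub>R X) \<in> zclosure T" "gexp ((- t) *\<^sub>R X) \<in> zclosure T"
  shows "gexp ((of_int m * t) *\<^sub>R X) \<in> zclosure T"
proof -
  have T': "mult_closed (zclosure T)" by (rule mult_closed_zclosure[OF T])
  have nat: "gexp ((real k * s) *\<^sub>R X) \<in> zclosure T" if "gexp (s *\<^sub>R X) \<in> zclosure T" for k :: nat and s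
  proof (induction k)
    case (Suc k)
    have "real (Suc k) * s = real k * s + s" by (simp add: algebra_simps)
    then show ?case using Suc that T' unfolding mult_closed_def by (simp only: gexp_add)
  qed (use T' in \<open>simp add: gexp_zero mult_closed_def\<close>)
  show ?thesis
  proof (cases "m \<ge> 0")
    case True
    then show ?thesis using nat[OF t(1), of "nat m"] by simp
  next
    case False
    then show ?thesis using nat[OF t(2), of "nat (- m)"] by simp
  qed
qed

text \<open>Integer combinations of \<open>\<epsilon>\<close> and
  \<open>\<theta> * \<epsilon>\<close> come arbitrarily close to zero without being zero.\<close>

lemma tangent_incommensurable:
  assumes T: "mult_closed T" and \<epsilon>: "\<epsilon> \<noteq> 0" and \<theta>: "\<theta> \<notin> \<rat>"
    and 1: "gexp (\<epsilon> *\<^sub>R X) \<in> zclosure T" "gexp ((- \<epsilon>) *\<^sub>R X) \<in> zclosure T"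
    and 2: "gexp ((\<theta> * \<epsilon>) *\<^sub>R X) \<in> zclosure T" "gexp ((- (\<theta> * \<epsilon>)) *\<^sub>R X) \<in> zclosure T"
  shows "X \<in> tangent T"
proof (rule tangent_small_times[OF T])
  fix \<delta> :: real assume \<delta>: "\<delta> > 0"
  obtain N :: nat where N: "\<bar>\<epsilon>\<bar> / \<delta> < real N" using reals_Archimedean2 by blast
  have N0: "N > 0" using N \<delta> \<epsilon> by (cases N) (auto simp: field_simps)
  obtain h k where hk: "0 < k" "k \<le> int N" "\<bar>of_int k * \<theta> - of_int h\<bar> < 1 / N"
    using Dirichlet_approx[OF N0, of \<theta>] by blast
  \<comment> \<open>The error of a rational approximation of \<open>\<theta>\<close>, scaled by
    \<open>\<epsilon>\<close>; irrationality keeps it nonzero.\<close>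
  define t where "t = of_int k * (\<theta> * \<epsilon>) + of_int (- h) * \<epsilon>"
  have te: "t = (of_int k * \<theta> - of_int h) * \<epsilon>" by (simp add: t_def algebra_simps)
  have "of_int k * \<theta> - of_int h \<noteq> 0"
  proof
    assume "of_int k * \<theta> - of_int h = 0"
    then have "\<theta> = of_int h / of_int k" using hk(1) by (simp add: field_simps)
    then show False using \<theta> by simp
  qed
  then have "t \<noteq> 0" using te \<epsilon> by simp
  moreover have "\<bar>t\<bar> < \<delta>"
  proof -
    have "\<bar>t\<bar> = \<bar>of_int k * \<theta> - of_int h\<bar> * \<bar>\<epsilon>\<bar>" by (simp add: te abs_mult)
    also have "\<dots> \<le> 1 / N * \<bar>\<epsilon>\<bar>" using hk(3) by (intro mult_right_mono) auto
    also have "\<dots> < \<delta>" using N N0 \<delta> by (simp add: field_simps)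
    finally show ?thesis .
  qed
  moreover have "gexp (t *\<^sub>R X) \<in> zclosure T"
    unfolding t_def gexp_add
    using mult_closed_zclosure[OF T] gexp_int_multiple[OF T 2, of k] gexp_int_multiple[OF T 1, of "- h"]
    unfolding mult_closed_def by blast
  ultimately show "\<exists>t. t \<noteq> 0 \<and> \<bar>t\<bar> < \<delta> \<and> gexp (t *\<^sub>R X) \<in> zclosure T" by blast
qed

lemma mat_pow_conj_full:
  assumes "Q ** P = mat 1" "P ** Q = mat 1"
  shows "mat_pow (P ** X ** Q) k = P ** mat_pow X k ** Q"
proof -
  have "mat_pow (P ** X ** Q) k ** P ** Q = P ** mat_pow X k ** Q" by (simp add: mat_pow_conj[OF assms(1)])
  then show ?thesis using assms(2) by (simp add: matrix_mul_assoc[symmetric])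
qed

lemma trace_zero_mk: "trace Y = 0 \<Longrightarrow> \<exists>p q r. Y = mk p q r (- p)"
proof -
  assume "trace Y = 0"
  moreover obtain p q r s where "Y = mk p q r s" by (rule mk_cases)
  ultimately show ?thesis by (auto simp: trace_def sum_2 add_eq_0_iff)
qed

section \<open>Lie algebra elements obtained from powers of one matrix\<close>

context sl2_hom
begin

text \<open>The powers of \<open>x\<close> are infinitely many parameters of a Laurent curve, so the
  closure contains the whole curve and its velocity at the identity is tangent.\<close>

lemma hyperbolic_tangent:
  assumes T: "mult_closed T" and c: "det c = 1" "det c' = 1" "c ** c' = mat 1" "c' ** c = mat 1"
    and x: "x \<noteq> 0" "\<bar>x\<bar> \<noteq> 1" and a: "\<And>n. cmat (\<rho> (mat_pow (c ** diag x ** c') n)) \<in> zclosure T"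
  shows "cmat (\<rho> c ** h ** \<rho> c') \<in> tangent T"
proof -
  let ?\<phi> = "\<lambda>y. cmat (\<rho> c ** \<rho> (diag y) ** \<rho> c')"
  have lau: "laurent ?\<phi>"
    by (intro laurent_linear[OF _ linear_cmat] laurent_matmul laurent_const laurent_diag)
  have pw: "mat_pow (diag x) n = diag (x ^ n)" for n
    by (induction n) (simp_all add: mat_pow_Suc diag_def mat_1_mk)
  have in1: "?\<phi> y \<in> zclosure T" if "y \<noteq> 0" for y
  proof (rule laurent_in_zclosure[OF lau _ _ _ that])
    have "inj (\<lambda>n. x ^ Suc n)"
    proof (rule injI)
      fix m n assume "x ^ Suc m = x ^ Suc n"
      then have "\<bar>x\<bar> ^ Suc m = \<bar>x\<bar> ^ Suc n" by (simp only: power_abs[symmetric])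
      moreover have "\<bar>x\<bar> < 1 \<or> \<bar>x\<bar> > 1" using x by linarith
      ultimately have "Suc m = Suc n" using x(1)
        by (metis power_inject_exp power_strict_decreasing_iff[of "\<bar>x\<bar>"] less_irrefl nat_neq_iff zero_less_abs_iff)
      then show "m = n" by simp
    qed
    then show "infinite (range (\<lambda>n. x ^ Suc n))" by (rule range_inj_infinite)
    show "0 \<notin> range (\<lambda>n. x ^ Suc n)" using x by auto
    fix y assume "y \<in> range (\<lambda>n. x ^ Suc n)"
    then obtain n where y: "y = x ^ Suc n" by auto
    have "\<rho> (mat_pow (c ** diag x ** c') (Suc n)) = \<rho> c ** \<rho> (diag y) ** \<rho> c'"
      unfolding mat_pow_conj_full[OF c(4,3)] pw y using c x by (simp add: hom_mult det_mul)
    then show "?\<phi> y \<in> zclosure T" using a[of "Suc n"] by simp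
  qed
  have ch: "((\<lambda>t. \<rho> (diag (exp t))) has_vector_derivative h) (at 0)"
    unfolding h_def by (rule chain[OF diag_deriv]) (auto simp: diag_def mat_1_mk)
  have "((\<lambda>t. ?\<phi> (exp t)) has_vector_derivative cmat (\<rho> c ** h ** \<rho> c')) (at 0)"
    by (intro bounded_linear.has_vector_derivative[OF bounded_linear_cmat]
        has_vector_derivative_matmul_right has_vector_derivative_matmul_left ch)
  then show ?thesis
  proof (rule tangent_curve[of _ _ 1])
    have "diag (exp 0) = mat 1" by (simp add: diag_def mat_1_mk)
    then show "?\<phi> (exp 0) = mat 1" using rho_inverse[OF c(1-3)] by (simp add: hom_one)
    show "?\<phi> (exp t) \<in> zclosure T" for t by (rule in1) simp
  qed (use T in \<open>auto simp: mult_closed_def\<close>)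
qed

text \<open>As in the hyperbolic case, with even powers only, because these remove the sign
  \<open>s\<close>.\<close>

lemma parabolic_tangent:
  assumes T: "mult_closed T" and c: "det c = 1" "det c' = 1" "c ** c' = mat 1" "c' ** c = mat 1"
    and s: "\<bar>s\<bar> = 1" and t: "t \<noteq> 0" and a: "\<And>n. cmat (\<rho> (mat_pow (c ** (s *\<^sub>R upper t) ** c') n)) \<in> zclosure T"
  shows "cmat (\<rho> c ** e ** \<rho> c') \<in> tangent T"
proof -
  let ?\<phi> = "\<lambda>y. cmat (\<rho> c ** \<rho> (upper y) ** \<rho> c')"
  have lau: "laurent ?\<phi>"
    by (intro laurent_linear[OF _ linear_cmat] laurent_matmul laurent_const laurent_upper)
  have pw: "mat_pow (s *\<^sub>R upper t) n = (s ^ n) *\<^sub>R upper (real n * t)" for n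
    by (induction n) (simp_all add: mat_pow_Suc upper_def mat_1_mk algebra_simps)
  have s2: "s ^ (2 * n) = 1" for n using s by (metis power_mult power_one power2_abs power_one)
  have in1: "?\<phi> y \<in> zclosure T" if "y \<noteq> 0" for y
  proof (rule laurent_in_zclosure[OF lau _ _ _ that])
    have "inj (\<lambda>n. real (2 * Suc n) * t)" using t by (auto intro!: injI)
    then show "infinite (range (\<lambda>n. real (2 * Suc n) * t))" by (rule range_inj_infinite)
    show "0 \<notin> range (\<lambda>n. real (2 * Suc n) * t)" using t by auto
    fix y assume "y \<in> range (\<lambda>n. real (2 * Suc n) * t)"
    then obtain n where y: "y = real (2 * Suc n) * t" by auto
    have "mat_pow (c ** (s *\<^sub>R upper t) ** c') (2 * Suc n) = c ** upper y ** c'"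
      unfolding mat_pow_conj_full[OF c(4,3)] pw y s2 by (simp only: scaleR_one)
    then have "\<rho> (mat_pow (c ** (s *\<^sub>R upper t) ** c') (2 * Suc n)) = \<rho> c ** \<rho> (upper y) ** \<rho> c'"
      using c by (simp add: hom_mult det_mul)
    then show "?\<phi> y \<in> zclosure T" using a[of "2 * Suc n"] by simp
  qed
  have ch: "((\<lambda>t. \<rho> (upper t)) has_vector_derivative e) (at 0)"
    unfolding e_def by (rule chain[OF upper_deriv]) (auto simp: upper_def mat_1_mk)
  have "((\<lambda>t. ?\<phi> t) has_vector_derivative cmat (\<rho> c ** e ** \<rho> c')) (at 0)"
    by (intro bounded_linear.has_vector_derivative[OF bounded_linear_cmat]
        has_vector_derivative_matmul_right has_vector_derivative_matmul_left ch)
  then show ?thesis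
  proof (rule tangent_curve[of _ _ 1])
    have "upper 0 = mat 1" by (simp add: upper_def mat_1_mk)
    then show "?\<phi> 0 = mat 1" using rho_inverse[OF c(1-3)] by (simp add: hom_one)
    show "?\<phi> t \<in> zclosure T" if "t \<noteq> 0" for t by (rule in1[OF that])
  qed (use T in \<open>auto simp: mult_closed_def\<close>)
qed

lemma rho_in_zclosure:
  assumes T: "mult_closed T" and e: "cmat e \<in> tangent T" and f: "cmat f \<in> tangent T" and A: "det A = 1"
  shows "cmat (\<rho> A) \<in> zclosure T"
proof (rule SL2R_generated[OF A, where P = "\<lambda>A. cmat (\<rho> A) \<in> zclosure T"])
  have T': "mult_closed (zclosure T)" by (rule mult_closed_zclosure[OF T])
  then show "cmat (\<rho> (mat 1)) \<in> zclosure T" by (simp add: hom_one mult_closed_def)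
  have u: "cmat (\<rho> (upper t)) \<in> zclosure T" "cmat (\<rho> (lower t)) \<in> zclosure T" for t
    using e f unfolding tangent_gexp_iff[OF T]
    by (simp_all add: rho_upper rho_lower cmat_gexp linear_scale[OF linear_cmat])
  fix B :: "real ^ 2 ^ 2" and t assume B: "det B = 1" "cmat (\<rho> B) \<in> zclosure T"
  show "cmat (\<rho> (upper t ** B)) \<in> zclosure T" "cmat (\<rho> (lower t ** B)) \<in> zclosure T"
    using u[of t] B T' by (auto simp: hom_mult cmat_mult mult_closed_def)
qed

lemma conj_bracket:
  assumes "k' ** k = mat 1"
  shows "(k ** X ** k') ** (k ** Y ** k') - (k ** Y ** k') ** (k ** X ** k') = k ** (X ** Y - Y ** X) ** (k' :: real ^ 'n ^ 'n)"
proof -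
  have *: "(k ** X ** k') ** (k ** Y ** k') = k ** (X ** Y) ** k'" for X Y
  proof -
    have "(k ** X ** k') ** (k ** Y ** k') = k ** X ** (k' ** k) ** Y ** k'" by (simp add: matrix_mul_assoc)
    then show ?thesis using assms by (simp add: matrix_mul_assoc)
  qed
  show ?thesis unfolding * by (simp add: matmul_simps)
qed

text \<open>The conditions on \<open>q\<close> and \<open>r\<close> say that the two elements have no common fixed point on the
  projective line.\<close>

lemma generates_SL2:
  assumes T: "mult_closed T" and c: "det c = 1" "det c' = 1" "c ** c' = mat 1" "c' ** c = mat 1"
    and b: "cmat (L (c ** mk p q r (- p) ** c')) \<in> tangent T"
    and a: "(cmat (\<rho> c ** h ** \<rho> c') \<in> tangent T \<and> q \<noteq> 0 \<and> r \<noteq> 0) \<or> (cmat (\<rho> c ** e ** \<rho> c') \<in> tangent T \<and> r \<noteq> 0)"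
    and A: "det A = 1"
  shows "cmat (\<rho> A) \<in> zclosure T"
proof -
  \<comment> \<open>Working up to conjugation by \<open>\<rho> c\<close>, so that the first element
    is in normal form.\<close>
  define S where "S = {X. cmat (\<rho> c ** X ** \<rho> c') \<in> tangent T}"
  have rc: "\<rho> c ** \<rho> c' = mat 1" "\<rho> c' ** \<rho> c = mat 1" using rho_inverse c by auto
  have sub: "subspace S"
    using subspace_tangent[of T] unfolding S_def subspace_def
    by (auto simp: matmul_simps linear_add[OF linear_cmat] linear_scale[OF linear_cmat] linear_0[OF linear_cmat])
  have br: "X ** Y - Y ** X \<in> S" if "X \<in> S" "Y \<in> S" for X Y
  proof -
    have "cmat (\<rho> c ** X ** \<rho> c') ** cmat (\<rho> c ** Y ** \<rho> c') - cmat (\<rho> c ** Y ** \<rho> c') ** cmat (\<rho> c ** X ** \<rho> c') \<in> tangent T"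
      using that unfolding S_def by (intro tangent_bracket[OF T]) auto
    then show ?thesis unfolding S_def
      by (simp add: cmat_mult[symmetric] linear_diff[OF linear_cmat, symmetric] conj_bracket[OF rc(2)])
  qed
  have X: "L (mk p q r (- p)) \<in> S"
    using b equivariant[OF c(1-3), of p q r] by (simp add: S_def)
  have eq1: "h ** L (mk p q r (- p)) - L (mk p q r (- p)) ** h = (2 * q) *\<^sub>R e - (2 * r) *\<^sub>R f" for p q r
    using bracket_H[of p q r] L_mk[of 0 "2 * q" "- 2 * r"] by (simp add: algebra_simps)
  \<comment> \<open>Bracketing with \<open>h\<close> once and twice gives two combinations of
    \<open>e\<close> and \<open>f\<close>, independent because the eigenvalues 2 and -2
    differ.\<close>
  have fromH: "e \<in> S \<and> f \<in> S" if h: "h \<in> S" and X: "L (mk p q r (- p)) \<in> S" and q: "q \<noteq> 0 \<or> e \<in> S" and r: "r \<noteq> 0" for p q r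
  proof -
    have 1: "(2 * q) *\<^sub>R e - (2 * r) *\<^sub>R f \<in> S" using br[OF h X] unfolding eq1 .
    have "h ** ((2 * q) *\<^sub>R e - (2 * r) *\<^sub>R f) - ((2 * q) *\<^sub>R e - (2 * r) *\<^sub>R f) ** h
      = (2 * q) *\<^sub>R (h ** e - e ** h) - (2 * r) *\<^sub>R (h ** f - f ** h)"
      by (simp add: matmul_simps algebra_simps)
    also have "\<dots> = (4 * q) *\<^sub>R e + (4 * r) *\<^sub>R f" unfolding he hf by simp
    finally have 2: "(4 * q) *\<^sub>R e + (4 * r) *\<^sub>R f \<in> S" using br[OF h 1] by simp
    have "(2::real) *\<^sub>R ((2 * q) *\<^sub>R e - (2 * r) *\<^sub>R f) + ((4 * q) *\<^sub>R e + (4 * r) *\<^sub>R f) \<in> S"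
      by (intro subspace_add subspace_scale sub 1 2)
    moreover have "(2::real) *\<^sub>R ((2 * q) *\<^sub>R e - (2 * r) *\<^sub>R f) + ((4 * q) *\<^sub>R e + (4 * r) *\<^sub>R f) = (8 * q) *\<^sub>R e"
      by (simp add: vec_eq_iff algebra_simps)
    ultimately have "(8 * q) *\<^sub>R e \<in> S" by simp
    from subspace_scale[OF sub this, of "1 / (8 * q)"] have eS: "e \<in> S" using q by (cases "q = 0") auto
    have "((4 * q) *\<^sub>R e + (4 * r) *\<^sub>R f) - (4 * q) *\<^sub>R e \<in> S" by (intro subspace_diff subspace_scale sub 2 eS)
    then have "(4 * r) *\<^sub>R f \<in> S" by simp
    from subspace_scale[OF sub this, of "1 / (4 * r)"] show ?thesis using eS r by simp
  qed
  have efh: "e \<in> S \<and> f \<in> S \<and> h \<in> S"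
    using a
  proof
    assume "cmat (\<rho> c ** h ** \<rho> c') \<in> tangent T \<and> q \<noteq> 0 \<and> r \<noteq> 0"
    then show ?thesis using fromH[OF _ X] by (auto simp: S_def)
  next
    assume 1: "cmat (\<rho> c ** e ** \<rho> c') \<in> tangent T \<and> r \<noteq> 0"
    then have eS: "e \<in> S" by (simp add: S_def)
    have "e ** L (mk p q r (- p)) - L (mk p q r (- p)) ** e = r *\<^sub>R h - (2 * p) *\<^sub>R e"
      using bracket_E[of p q r] L_mk[of r "- 2 * p" 0] by (simp add: algebra_simps)
    then have "(r *\<^sub>R h - (2 * p) *\<^sub>R e) + (2 * p) *\<^sub>R e \<in> S"
      using br[OF eS X] by (intro subspace_add subspace_scale sub eS) simp
    then have "r *\<^sub>R h \<in> S" by simp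
    from subspace_scale[OF sub this, of "1 / r"] have "h \<in> S" using 1 by simp
    then show ?thesis using fromH[OF _ X] eS 1 by auto
  qed
  have all: "cmat (L Y) \<in> tangent T" if Y: "trace Y = 0" for Y
  proof -
    have "trace (c' ** Y ** c) = trace (c ** (c' ** Y))" by (rule trace_mul_sym)
    also have "\<dots> = 0" using Y c by (simp add: matrix_mul_assoc)
    finally obtain u v w where Z: "c' ** Y ** c = mk u v w (- u)" using trace_zero_mk by blast
    have "L (mk u v w (- u)) \<in> S" unfolding L_mk using efh by (intro subspace_add subspace_scale sub) auto
    then have "cmat (L (c ** (c' ** Y ** c) ** c')) \<in> tangent T"
      unfolding S_def Z using equivariant[OF c(1-3), of u v w] by simp
    moreover have "c ** (c' ** Y ** c) ** c' = (c ** c') ** Y ** (c ** c')" by (simp add: matrix_mul_assoc)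
    ultimately show ?thesis using c by simp
  qed
  show ?thesis
    by (rule rho_in_zclosure[OF T _ _ A]) (use all[of "mk 0 1 0 0"] all[of "mk 0 0 1 0"] in \<open>simp_all add: e_def f_def trace_def sum_2\<close>)
qed

end

section \<open>Bending\<close>

text \<open>In size two a hyperbolic or parabolic matrix is a scalar matrix plus a nonzero multiple
  of a traceless generator \<open>Y\<close> of its one-parameter group. So \<open>b\<close> and
  \<open>Y\<close> are triangular in the same bases.\<close>

lemma (in sl2_hom) element_tangent:
  assumes T: "mult_closed T" and c: "det c = 1" "det c' = 1" "c ** c' = mat 1" "c' ** c = mat 1"
    and nf: "(\<exists>x. x \<noteq> 0 \<and> \<bar>x\<bar> \<noteq> 1 \<and> b = c ** diag x ** c') \<or>
     (\<exists>s t. \<bar>s\<bar> = 1 \<and> t \<noteq> 0 \<and> b = c ** (s *\<^sub>R upper t) ** c')"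
    and b: "\<And>n. cmat (\<rho> (mat_pow b n)) \<in> zclosure T"
  obtains Y \<mu> \<nu> where "\<nu> \<noteq> 0" "trace Y = 0" "b = \<mu> *\<^sub>R mat 1 + \<nu> *\<^sub>R Y" "cmat (L Y) \<in> tangent T"
proof -
  have tr: "trace (c ** X ** c') = trace X" for X :: "real ^ 2 ^ 2"
  proof -
    have "trace (c ** X ** c') = trace (c' ** (c ** X))" by (rule trace_mul_sym)
    then show ?thesis using c by (simp add: matrix_mul_assoc)
  qed
  have split: "c ** (\<mu> *\<^sub>R mat 1 + \<nu> *\<^sub>R X) ** c' = \<mu> *\<^sub>R mat 1 + \<nu> *\<^sub>R (c ** X ** c')" for \<mu> \<nu> X
    using c by (simp add: matmul_simps)
  from nf show ?thesis
  proof
    assume "\<exists>x. x \<noteq> 0 \<and> \<bar>x\<bar> \<noteq> 1 \<and> b = c ** diag x ** c'"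
    then obtain x where x: "x \<noteq> 0" "\<bar>x\<bar> \<noteq> 1" and bx: "b = c ** diag x ** c'" by blast
    show ?thesis
    proof (rule that)
      show "(x - 1 / x) / 2 \<noteq> 0"
      proof
        assume "(x - 1 / x) / 2 = 0"
        then have "x * x = 1" using x(1) by (simp add: field_simps)
        then show False using x(2) by (auto simp: square_eq_1_iff)
      qed
      show "trace (c ** mk 1 0 0 (- 1) ** c') = 0" unfolding tr by (simp add: trace_def sum_2)
      have "diag x = ((x + 1 / x) / 2) *\<^sub>R mat 1 + ((x - 1 / x) / 2) *\<^sub>R mk 1 0 0 (- 1)"
        by (simp add: diag_def mat_1_mk field_simps)
      then show "b = ((x + 1 / x) / 2) *\<^sub>R mat 1 + ((x - 1 / x) / 2) *\<^sub>R (c ** mk 1 0 0 (- 1) ** c')"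
        unfolding bx by (simp only: split)
      show "cmat (L (c ** mk 1 0 0 (- 1) ** c')) \<in> tangent T"
        using hyperbolic_tangent[OF T c x] b equivariant[OF c(1-3), of 1 0 0] by (simp add: bx h_def)
    qed
  next
    assume "\<exists>s t. \<bar>s\<bar> = 1 \<and> t \<noteq> 0 \<and> b = c ** (s *\<^sub>R upper t) ** c'"
    then obtain s t where st: "\<bar>s\<bar> = 1" "t \<noteq> 0" and bs: "b = c ** (s *\<^sub>R upper t) ** c'" by blast
    show ?thesis
    proof (rule that)
      show "s * t \<noteq> 0" using st by auto
      show "trace (c ** mk 0 1 0 0 ** c') = 0" unfolding tr by (simp add: trace_def sum_2)
      have "s *\<^sub>R upper t = s *\<^sub>R mat 1 + (s * t) *\<^sub>R mk 0 1 0 0"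
        by (simp add: upper_def mat_1_mk)
      then show "b = s *\<^sub>R mat 1 + (s * t) *\<^sub>R (c ** mk 0 1 0 0 ** c')"
        unfolding bs by (simp only: split)
      show "cmat (L (c ** mk 0 1 0 0 ** c')) \<in> tangent T"
        using parabolic_tangent[OF T c st] b equivariant[OF c(1-3), of 0 1 0] by (simp add: bs e_def)
    qed
  qed
qed

text \<open>The basis \<open>c\<close> normalizes the first generator. Vanishing of a critical entry
  of the second would make both triangular in that basis, hence metabelian, which the surface
  relations forbid.\<close>

lemma (in sl2_hom) handle_generates_SL2:
  assumes \<alpha>: "surface_gens g \<Gamma> \<alpha>" and \<Gamma>: "subgroup \<Gamma> SL2R" and disc: "discrete \<Gamma>" and g: "g \<ge> 2"
    and T: "mult_closed T" and in0: "\<And>n. cmat (\<rho> (mat_pow (\<alpha> 0) n)) \<in> zclosure T"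
    and in1: "\<And>n. cmat (\<rho> (mat_pow (\<alpha> 1) n)) \<in> zclosure T" and A: "det A = 1"
  shows "cmat (\<rho> A) \<in> zclosure T"
proof -
  have k: "0 < 2 * g" "1 < 2 * g" using g by auto
  obtain c c' where c: "det c = 1" "det c' = 1" "c ** c' = mat 1" "c' ** c = mat 1"
    and nf: "(\<exists>x. x \<noteq> 0 \<and> \<bar>x\<bar> \<noteq> 1 \<and> \<alpha> 0 = c ** diag x ** c') \<or>
     (\<exists>s t. \<bar>s\<bar> = 1 \<and> t \<noteq> 0 \<and> \<alpha> 0 = c ** (s *\<^sub>R upper t) ** c')"
    by (rule gens_normal_form[OF \<alpha> \<Gamma> k(1) disc]) (rule that)
  obtain d d' where d: "det d = 1" "det d' = 1" "d ** d' = mat 1" "d' ** d = mat 1"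
    and nf1: "(\<exists>x. x \<noteq> 0 \<and> \<bar>x\<bar> \<noteq> 1 \<and> \<alpha> 1 = d ** diag x ** d') \<or>
     (\<exists>s t. \<bar>s\<bar> = 1 \<and> t \<noteq> 0 \<and> \<alpha> 1 = d ** (s *\<^sub>R upper t) ** d')"
    by (rule gens_normal_form[OF \<alpha> \<Gamma> k(2) disc]) (rule that)
  obtain Y \<mu> \<nu> where Y: "\<nu> \<noteq> 0" "trace Y = 0" "\<alpha> 1 = \<mu> *\<^sub>R mat 1 + \<nu> *\<^sub>R Y" "cmat (L Y) \<in> tangent T"
    by (rule element_tangent[OF T d nf1 in1])
  have "trace (c' ** Y ** c) = trace (c ** (c' ** Y))" by (rule trace_mul_sym)
  then have "trace (c' ** Y ** c) = 0" using c Y(2) by (simp add: matrix_mul_assoc)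
  then obtain p q r where Z: "c' ** Y ** c = mk p q r (- p)" using trace_zero_mk by blast
  have Yc: "Y = c ** mk p q r (- p) ** c'"
  proof -
    have "c ** (c' ** Y ** c) ** c' = (c ** c') ** Y ** (c ** c')" by (simp add: matrix_mul_assoc)
    then show ?thesis using c by (simp add: Z)
  qed
  have b: "\<alpha> 1 = c ** mk (\<mu> + \<nu> * p) (\<nu> * q) (\<nu> * r) (\<mu> - \<nu> * p) ** c'"
  proof -
    have "mk (\<mu> + \<nu> * p) (\<nu> * q) (\<nu> * r) (\<mu> - \<nu> * p) = \<mu> *\<^sub>R mat 1 + \<nu> *\<^sub>R mk p q r (- p)"
      by (simp add: mat_1_mk)
    moreover have "c ** (\<mu> *\<^sub>R mat 1 + \<nu> *\<^sub>R mk p q r (- p)) ** c' = \<mu> *\<^sub>R mat 1 + \<nu> *\<^sub>R (c ** mk p q r (- p) ** c')"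
      using c by (simp add: matmul_simps del: mk_scaleR)
    ultimately show ?thesis by (simp only: Y(3) Yc)
  qed
  have detconj: "det X = 1" if "det (c ** X ** c') = 1" for X :: "real ^ 2 ^ 2"
    using that c by (simp add: det_mul)
  have db: "(\<mu> + \<nu> * p) * (\<mu> - \<nu> * p) - (\<nu> * q) * (\<nu> * r) = 1"
    using detconj[of "mk (\<mu> + \<nu> * p) (\<nu> * q) (\<nu> * r) (\<mu> - \<nu> * p)"] gens_det[OF \<alpha> \<Gamma> k(2)] unfolding b[symmetric] by simp
  obtain A' where A': "det A' = 1" "\<alpha> 0 ** A' = mat 1" "A' ** \<alpha> 0 = mat 1"
    using SL2R_inverse[OF gens_det[OF \<alpha> \<Gamma> k(1)]] by blast
  obtain B' where B': "det B' = 1" "\<alpha> 1 ** B' = mat 1" "B' ** \<alpha> 1 = mat 1"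
    using SL2R_inverse[OF gens_det[OF \<alpha> \<Gamma> k(2)]] by blast
  \<comment> \<open>\<open>r\<close> or \<open>q\<close> may vanish only if the matching entry of
    the first generator does not; this feeds the case distinction of
    \<open>generates_SL2\<close>.\<close>
  have nt: False if a: "\<alpha> 0 = c ** mk p' q' r' s' ** c'"
    and tri: "(r' = 0 \<and> \<nu> * r = 0) \<or> (q' = 0 \<and> \<nu> * q = 0)" for p' q' r' s'
  proof -
    have da: "p' * s' - q' * r' = 1" using detconj[of "mk p' q' r' s'"] gens_det[OF \<alpha> \<Gamma> k(1)] unfolding a[symmetric] by simp
    show False
      using triangular_metabelian[OF a b c(4) tri da db A'(2,3) B'(2,3) c(3)]
        gens_not_metabelian[OF \<alpha> \<Gamma> g A'(2,3) B'(2,3) A'(1) B'(1)] by blast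
  qed
  have "(cmat (\<rho> c ** h ** \<rho> c') \<in> tangent T \<and> q \<noteq> 0 \<and> r \<noteq> 0) \<or> (cmat (\<rho> c ** e ** \<rho> c') \<in> tangent T \<and> r \<noteq> 0)"
    using nf
  proof
    assume "\<exists>x. x \<noteq> 0 \<and> \<bar>x\<bar> \<noteq> 1 \<and> \<alpha> 0 = c ** diag x ** c'"
    then obtain x where x: "x \<noteq> 0" "\<bar>x\<bar> \<noteq> 1" and ax: "\<alpha> 0 = c ** diag x ** c'" by blast
    have "cmat (\<rho> c ** h ** \<rho> c') \<in> tangent T" using hyperbolic_tangent[OF T c x] in0 by (simp add: ax)
    moreover have "q \<noteq> 0" "r \<noteq> 0" using nt[OF ax[unfolded diag_def]] by auto
    ultimately show ?thesis by blast
  next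
    assume "\<exists>s t. \<bar>s\<bar> = 1 \<and> t \<noteq> 0 \<and> \<alpha> 0 = c ** (s *\<^sub>R upper t) ** c'"
    then obtain s t where st: "\<bar>s\<bar> = 1" "t \<noteq> 0" and as: "\<alpha> 0 = c ** (s *\<^sub>R upper t) ** c'" by blast
    have "cmat (\<rho> c ** e ** \<rho> c') \<in> tangent T" using parabolic_tangent[OF T c st] in0 by (simp add: as)
    moreover have "r \<noteq> 0" using nt[OF as[unfolded upper_def mk_scaleR]] by auto
    ultimately show ?thesis by blast
  qed
  then show ?thesis using generates_SL2[OF T c _ _ A, of p q r] Y(4) unfolding Yc by blast
qed

text \<open>The spanning family is padded with zeros to a length that does not depend on the
  subspace, so the number of handles can be fixed beforehand.\<close>

lemma subspace_finite_spanning: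
  fixes U :: "'a::euclidean_space set"
  assumes "subspace U"
  obtains w :: "nat \<Rightarrow> 'a" where "\<And>j. w j \<in> U" "U \<subseteq> span (w ` {..<DIM('a)})"
proof -
  obtain B where B: "B \<subseteq> U" "independent B" "U \<subseteq> span B" by (metis basis_exists)
  have fin: "finite B" "card B \<le> DIM('a)" using independent_bound[OF B(2)] by auto
  obtain f where f: "bij_betw f {..<card B} B" using bij_betw_from_nat_into_finite[OF fin(1)] by blast
  define w where "w j = (if j < card B then f j else 0)" for j
  have "w j \<in> U" for j using f B(1) subspace_0[OF assms] by (auto simp: w_def bij_betw_def)
  moreover have "B \<subseteq> w ` {..<DIM('a)}"
  proof
    fix b assume "b \<in> B"
    then obtain j where "j < card B" "b = f j" using f by (auto simp: bij_betw_def)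
    then show "b \<in> w ` {..<DIM('a)}" using fin(2) by (intro image_eqI[of _ _ j]) (auto simp: w_def)
  qed
  then have "U \<subseteq> span (w ` {..<DIM('a)})" using B(3) span_mono by blast
  ultimately show ?thesis using that by blast
qed

context even_sl2_hom
begin

text \<open>The size \<open>\<epsilon>\<close> is quantified inside: the directions \<open>z\<close>
  must be fixed before the neighbourhood decides how far to bend.\<close>

definition spreads :: "nat \<Rightarrow> (nat \<Rightarrow> real ^ 'n ^ 'n) \<Rightarrow> bool" where
  "spreads g z \<longleftrightarrow> (\<forall>T \<epsilon>. mult_closed T \<longrightarrow> \<epsilon> \<noteq> 0 \<longrightarrow> (\<forall>A. det A = 1 \<longrightarrow> cmat (\<rho> A) \<in> zclosure T) \<longrightarrow>
     (\<forall>i<g. cmat (gexp (\<epsilon> *\<^sub>R z i)) \<in> zclosure T \<and> cmat (gexp ((- \<epsilon>) *\<^sub>R z i)) \<in> zclosure T) \<longrightarrow>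
     (\<forall>X\<in>lie_algebra G. cmat X \<in> tangent T))"

text \<open>For each basis vector of the centralizer two handles are bent, by incommensurable amounts, so
  that the Zariski closure contains the whole one-parameter group.\<close>

lemma bending_data_aux:
  assumes U: "subspace U" "U \<subseteq> lie_algebra G" "U = W 0 \<or> U = {X \<in> lie_algebra G. e ** X = X ** e}"
    and I: "finite I" "0 \<notin> I" "2 * DIM(real ^ 'n ^ 'n) \<le> card I" "I \<subseteq> {..<g}"
    and c: "\<And>i. i \<in> I \<Longrightarrow> det (c i) = 1 \<and> det (c' i) = 1 \<and> c i ** c' i = mat 1 \<and> c' i ** c i = mat 1"
    and comm: "\<And>i X. i \<in> I \<Longrightarrow> X \<in> U \<Longrightarrow> A i ** (\<rho> (c i) ** X ** \<rho> (c' i)) = (\<rho> (c i) ** X ** \<rho> (c' i)) ** A i"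
  obtains z where "z 0 = 0" "\<And>i. z i \<in> lie_algebra G" "\<And>i. A i ** z i = z i ** A i"
    "spreads g z"
proof -
  let ?N = "DIM(real ^ 'n ^ 'n)"
  obtain w where w: "\<And>j. w j \<in> U" "U \<subseteq> span (w ` {..<?N})" 
    by (rule subspace_finite_spanning[OF U(1)]) (rule that)
  have "\<exists>\<theta>::real. \<theta> \<notin> \<rat>" using countable_rat uncountable_UNIV_real by (metis UNIV_eq_I)
  then obtain \<theta> :: real where \<theta>: "\<theta> \<notin> \<rat>" by blast
  obtain J where J: "J \<subseteq> I" "card J = 2 * ?N" "finite J" by (rule obtain_subset_with_card_n[OF I(3)])
  obtain \<iota> where \<iota>: "bij_betw \<iota> {..<2 * ?N} J" using bij_betw_from_nat_into_finite[OF J(3)] J(2) by metis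
  define m where "m i = inv_into {..<2 * ?N} \<iota> i" for i
  have m: "m (\<iota> j) = j" "\<iota> j \<in> J" if "j < 2 * ?N" for j
    using \<iota> that by (auto simp: m_def bij_betw_def)
  \<comment> \<open>With \<open>m i\<close> the position of handle \<open>i\<close>,
    \<open>m i div 2\<close> selects the basis vector and the parity of \<open>m i\<close> the
    amount, \<open>1\<close> or \<open>\<theta>\<close>. Handles outside \<open>J\<close>, in
    particular handle \<open>0\<close>, are not bent.\<close>
  define z where "z i = (if i \<in> J then (if even (m i) then 1 else \<theta>) *\<^sub>R (\<rho> (c i) ** w (m i div 2) ** \<rho> (c' i)) else 0)" for i
  show ?thesis
  proof (rule that[of z])
    show "z 0 = 0" using I(2) J(1) by (auto simp: z_def)
    have zc: "\<rho> (c i) ** w j ** \<rho> (c' i) \<in> lie_algebra G" if "i \<in> J" for i j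
      using c[of i] that J(1) w(1) U(2) by (intro Ad_closed) auto
    show "z i \<in> lie_algebra G" for i
      unfolding z_def using zc subspace_scale[OF subg] subspace_0[OF subg] by auto
    show "A i ** z i = z i ** A i" for i
      using comm[of i] J(1) w(1) by (auto simp: z_def matmul_simps)
    show "spreads g z" unfolding spreads_def
    proof (intro allI impI ballI)
      fix T :: "(complex ^ 'n ^ 'n) set" and \<epsilon> :: real and X
      assume T: "mult_closed T" and \<epsilon>: "\<epsilon> \<noteq> 0" and SL': "\<forall>A. det A = 1 \<longrightarrow> cmat (\<rho> A) \<in> zclosure T"
        and y': "\<forall>i<g. cmat (gexp (\<epsilon> *\<^sub>R z i)) \<in> zclosure T \<and> cmat (gexp ((- \<epsilon>) *\<^sub>R z i)) \<in> zclosure T"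
        and X: "X \<in> lie_algebra G"
      note SL = SL'[rule_format] and y = y'[rule_format]
      have T': "\<And>A B. A \<in> zclosure T \<Longrightarrow> B \<in> zclosure T \<Longrightarrow> A ** B \<in> zclosure T"
        using mult_closed_zclosure[OF T] by (auto simp: mult_closed_def)
      \<comment> \<open>The conjugating elements lie in the image of SL(2,R), which the closure
        already contains.\<close>
      have unconj: "gexp (t *\<^sub>R cmat Y) \<in> zclosure T"
        if i: "i \<in> J" and Y: "cmat (gexp (t *\<^sub>R (\<rho> (c i) ** Y ** \<rho> (c' i)))) \<in> zclosure T" for i t Y
      proof -
        have ci: "det (c i) = 1" "det (c' i) = 1" "c i ** c' i = mat 1" "c' i ** c i = mat 1" using c[of i] i J(1) by auto
        have r: "\<rho> (c i) ** \<rho> (c' i) = mat 1" "\<rho> (c' i) ** \<rho> (c i) = mat 1" using rho_inverse ci by auto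
        have "\<rho> (c' i) ** gexp (t *\<^sub>R (\<rho> (c i) ** Y ** \<rho> (c' i))) ** \<rho> (c i) = gexp (t *\<^sub>R Y)"
        proof -
          have "t *\<^sub>R (\<rho> (c i) ** Y ** \<rho> (c' i)) = \<rho> (c i) ** (t *\<^sub>R Y) ** \<rho> (c' i)" by (simp add: matmul_simps)
          then have "\<rho> (c' i) ** gexp (t *\<^sub>R (\<rho> (c i) ** Y ** \<rho> (c' i))) ** \<rho> (c i)
            = (\<rho> (c' i) ** \<rho> (c i)) ** gexp (t *\<^sub>R Y) ** (\<rho> (c' i) ** \<rho> (c i))"
            by (simp only: gexp_conj[OF r(2,1)] matrix_mul_assoc)
          then show ?thesis by (simp add: r)
        qed
        moreover have "cmat (\<rho> (c' i)) ** cmat (gexp (t *\<^sub>R (\<rho> (c i) ** Y ** \<rho> (c' i)))) ** cmat (\<rho> (c i)) \<in> zclosure T"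
          by (intro T' SL ci Y)
        ultimately have "cmat (gexp (t *\<^sub>R Y)) \<in> zclosure T" by (simp add: cmat_mult[symmetric])
        then show ?thesis by (simp add: cmat_gexp linear_scale[OF linear_cmat])
      qed
      have Jg: "i < g" if "i \<in> J" for i using that J(1) I(4) by auto
      define S where "S = {Y. cmat Y \<in> tangent T}"
      have wS: "w j \<in> S" if j: "j < ?N" for j
      proof -
        have j2: "2 * j < 2 * ?N" "2 * j + 1 < 2 * ?N" using j by auto
        let ?i = "\<iota> (2 * j)" and ?k = "\<iota> (2 * j + 1)"
        have zi: "z ?i = \<rho> (c ?i) ** w j ** \<rho> (c' ?i)" using m[OF j2(1)] by (simp add: z_def)
        have zk: "z ?k = \<theta> *\<^sub>R (\<rho> (c ?k) ** w j ** \<rho> (c' ?k))" using m[OF j2(2)] by (simp add: z_def)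
        have "cmat (w j) \<in> tangent T"
        proof (rule tangent_incommensurable[OF T \<epsilon> \<theta>])
          show "gexp (\<epsilon> *\<^sub>R cmat (w j)) \<in> zclosure T" "gexp ((- \<epsilon>) *\<^sub>R cmat (w j)) \<in> zclosure T"
            using y[OF Jg[OF m(2)[OF j2(1)]]] unfolding zi by (blast intro: unconj[OF m(2)[OF j2(1)]])+
          show "gexp ((\<theta> * \<epsilon>) *\<^sub>R cmat (w j)) \<in> zclosure T" "gexp ((- (\<theta> * \<epsilon>)) *\<^sub>R cmat (w j)) \<in> zclosure T"
          proof -
            note yk = y[OF Jg[OF m(2)[OF j2(2)]], unfolded zk scaleR_scaleR]
            have "gexp ((\<epsilon> * \<theta>) *\<^sub>R cmat (w j)) \<in> zclosure T" "gexp ((- \<epsilon> * \<theta>) *\<^sub>R cmat (w j)) \<in> zclosure T"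
              using yk by (blast intro: unconj[OF m(2)[OF j2(2)]])+
            moreover have "\<theta> * \<epsilon> = \<epsilon> * \<theta>" "- (\<theta> * \<epsilon>) = - \<epsilon> * \<theta>" by simp_all
            ultimately show "gexp ((\<theta> * \<epsilon>) *\<^sub>R cmat (w j)) \<in> zclosure T" "gexp ((- (\<theta> * \<epsilon>)) *\<^sub>R cmat (w j)) \<in> zclosure T"
              by (simp_all only:)
          qed
        qed
        then show ?thesis by (simp add: S_def)
      qed
      have subS: "subspace S"
        using subspace_tangent[of T] unfolding S_def subspace_def
        by (auto simp: linear_add[OF linear_cmat] linear_scale[OF linear_cmat] linear_0[OF linear_cmat])
      have US: "U \<subseteq> S" using w(2) span_minimal[OF _ subS, of "w ` {..<?N}"] wS by blast
      have eT: "cmat e \<in> tangent T" unfolding tangent_gexp_iff[OF T]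
        using SL[OF det_upper] by (simp add: rho_upper cmat_gexp linear_scale[OF linear_cmat])
      have fT: "cmat f \<in> tangent T" unfolding tangent_gexp_iff[OF T]
        using SL[OF det_lower] by (simp add: rho_lower cmat_gexp linear_scale[OF linear_cmat])
      have "lie_algebra G \<subseteq> S"
      proof (rule lie_algebra_generated[OF subS])
        show "e ** Y - Y ** e \<in> S" "f ** Y - Y ** f \<in> S" if "Y \<in> S" for Y
          using tangent_bracket[OF T _ eT, of "cmat Y"] tangent_bracket[OF T _ fT, of "cmat Y"] that
          by (auto simp: S_def linear_diff[OF linear_cmat] cmat_mult)
        show "W 0 \<subseteq> S \<or> {X \<in> lie_algebra G. e ** X = X ** e} \<subseteq> S" using US U(3) by auto
      qed
      then show "cmat X \<in> tangent T" using X by (auto simp: S_def)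
    qed
  qed
qed

text \<open>Pigeonhole: of the at least \<open>4 * DIM\<close> handles other than the first,
  \<open>2 * DIM\<close> are of one type, hyperbolic or parabolic. Centralizing directions of the
  normal form are conjugated into place handle by handle.\<close>

lemma bending_data:
  assumes \<alpha>: "surface_gens g \<Gamma> \<alpha>" and \<Gamma>: "subgroup \<Gamma> SL2R" and disc: "discrete \<Gamma>"
    and g: "g \<ge> 4 * DIM(real ^ 'n ^ 'n) + 1"
  obtains z where "z 0 = 0" "\<And>i. z i \<in> lie_algebra G" "\<And>i. \<rho> (\<alpha> (2 * i)) ** z i = z i ** \<rho> (\<alpha> (2 * i))"
    "spreads g z"
proof -
  let ?N = "DIM(real ^ 'n ^ 'n)"
  let ?hyp = "\<lambda>i c c'. \<exists>x. x \<noteq> 0 \<and> \<bar>x\<bar> \<noteq> 1 \<and> \<alpha> (2 * i) = c ** diag x ** c'"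
  let ?par = "\<lambda>i c c'. \<exists>s t. \<bar>s\<bar> = 1 \<and> t \<noteq> 0 \<and> \<alpha> (2 * i) = c ** (s *\<^sub>R upper t) ** c'"
  let ?inv = "\<lambda>c c' :: real ^ 2 ^ 2. det c = 1 \<and> det c' = 1 \<and> c ** c' = mat 1 \<and> c' ** c = mat 1"
  have "\<exists>c c'. ?inv c c' \<and> (?hyp i c c' \<or> ?par i c c')" if "i < g" for i
  proof -
    have "2 * i < 2 * g" using that by simp
    then show ?thesis by (rule gens_normal_form[OF \<alpha> \<Gamma> _ disc]) blast
  qed
  then obtain c c' where cc: "\<And>i. i < g \<Longrightarrow> ?inv (c i) (c' i) \<and> (?hyp i (c i) (c' i) \<or> ?par i (c i) (c' i))"
    by metis
  define Hy where "Hy = {i \<in> {1..<g}. ?hyp i (c i) (c' i)}"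
  define Pa where "Pa = {i \<in> {1..<g}. ?par i (c i) (c' i)}"
  have "i \<in> Hy \<union> Pa" if "i \<in> {1..<g}" for i using cc[of i] that unfolding Hy_def Pa_def by fastforce
  then have "{1..<g} \<subseteq> Hy \<union> Pa" by blast
  moreover have "finite (Hy \<union> Pa)" by (simp add: Hy_def Pa_def)
  ultimately have "card {1..<g} \<le> card (Hy \<union> Pa)" by (intro card_mono)
  also have "\<dots> \<le> card Hy + card Pa" by (rule card_Un_le)
  finally have cards: "2 * ?N \<le> card Hy \<or> 2 * ?N \<le> card Pa" using g by auto
  have conj_comm: "(\<rho> k ** P ** \<rho> k') ** (\<rho> k ** X ** \<rho> k') = (\<rho> k ** X ** \<rho> k') ** (\<rho> k ** P ** \<rho> k')"
    if "?inv k k'" "P ** X = X ** P" for k k' P X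
  proof -
    have *: "(\<rho> k ** P ** \<rho> k') ** (\<rho> k ** X ** \<rho> k') = \<rho> k ** (P ** X) ** \<rho> k'" for P X
    proof -
      have "(\<rho> k ** P ** \<rho> k') ** (\<rho> k ** X ** \<rho> k') = \<rho> k ** P ** (\<rho> k' ** \<rho> k) ** X ** \<rho> k'"
        by (simp add: matrix_mul_assoc)
      then show ?thesis using rho_inverse[of k' k] that(1) by (simp add: matrix_mul_assoc)
    qed
    show ?thesis unfolding * that(2) ..
  qed
  from cards show ?thesis
  proof
    assume card: "2 * ?N \<le> card Hy"
    show ?thesis
    proof (rule bending_data_aux[where U = "W 0" and I = Hy and g = g and c = c and c' = c' and A = "\<lambda>i. \<rho> (\<alpha> (2 * i))"])
      show "W 0 \<subseteq> lie_algebra G" by (auto simp: W_def)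
      fix i X assume i: "i \<in> Hy" and X: "X \<in> W 0"
      then obtain x where x: "x \<noteq> 0" "\<alpha> (2 * i) = c i ** diag x ** c' i" by (auto simp: Hy_def)
      have inv: "?inv (c i) (c' i)" using cc[of i] i by (auto simp: Hy_def)
      have "\<rho> (\<alpha> (2 * i)) = \<rho> (c i) ** \<rho> (diag x) ** \<rho> (c' i)" using x inv by (simp add: hom_mult det_mul)
      then show "\<rho> (\<alpha> (2 * i)) ** (\<rho> (c i) ** X ** \<rho> (c' i)) = \<rho> (c i) ** X ** \<rho> (c' i) ** \<rho> (\<alpha> (2 * i))"
        using conj_comm[OF inv commute_diag[OF X x(1)]] by simp
    qed (use card cc subspace_W that in \<open>auto simp: Hy_def\<close>)
  next
    assume card: "2 * ?N \<le> card Pa"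
    show ?thesis
    proof (rule bending_data_aux[where U = "{X \<in> lie_algebra G. e ** X = X ** e}" and I = Pa and g = g and c = c and c' = c' and A = "\<lambda>i. \<rho> (\<alpha> (2 * i))"])
      show "subspace {X \<in> lie_algebra G. e ** X = X ** e}"
        using subg unfolding subspace_def by (auto simp: matmul_simps)
      fix i X assume i: "i \<in> Pa" and X: "X \<in> {X \<in> lie_algebra G. e ** X = X ** e}"
      then obtain s t where st: "\<bar>s\<bar> = 1" "\<alpha> (2 * i) = c i ** (s *\<^sub>R upper t) ** c' i" by (auto simp: Pa_def)
      have inv: "?inv (c i) (c' i)" using cc[of i] i by (auto simp: Pa_def)
      have "det (s *\<^sub>R upper t) = 1" using st(1) by (auto simp: upper_def abs_if split: if_splits)
      then have "\<rho> (\<alpha> (2 * i)) = \<rho> (c i) ** \<rho> (s *\<^sub>R upper t) ** \<rho> (c' i)" using st inv by (simp add: hom_mult det_mul)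
      then show "\<rho> (\<alpha> (2 * i)) ** (\<rho> (c i) ** X ** \<rho> (c' i)) = \<rho> (c i) ** X ** \<rho> (c' i) ** \<rho> (\<alpha> (2 * i))"
        using conj_comm[OF inv commute_upper[OF _ _ st(1)], of X t] X by simp
    qed (use card cc that in \<open>auto simp: Pa_def\<close>)
  qed
qed

end

section \<open>The bent representations and the final argument\<close>

lemma weval_hom:
  assumes A: "group A" and B: "group B" and \<phi>: "\<phi> \<in> hom A B" and x: "\<And>k. k < 2 * g \<Longrightarrow> x k \<in> carrier A"
  shows "u \<in> surface_words g \<Longrightarrow> weval B (\<lambda>k. \<phi> (x k)) u = \<phi> (weval A x u)"
proof (induction u)
  case Nil
  then show ?case using hom_one[OF \<phi> A B] by simp
next
  case (Cons l u)
  interpret group_hom A B \<phi> by (rule group_hom.intro[OF A B]) (simp add: group_hom_axioms_def \<phi>)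
  obtain k s where l: "l = (k, s)" by (cases l)
  have k: "k < 2 * g" and u: "u \<in> surface_words g" using Cons.prems unfolding l surface_words_Cons by auto
  have "x k \<in> carrier A" by (rule x[OF k])
  moreover have "weval A x u \<in> carrier A" using weval_closed[of A g x, OF A _ u] x by blast
  ultimately show ?case using Cons.IH[OF u] by (simp add: l)
qed

lemma continuous_on_matmul:
  fixes f g :: "'t::topological_space \<Rightarrow> real ^ 'n ^ 'n"
  assumes "continuous_on S f" "continuous_on S g"
  shows "continuous_on S (\<lambda>x. f x ** g x)"
  using bounded_bilinear.continuous_on[OF bounded_bilinear_matrix_mult assms] .

lemma continuous_on_gexp: "continuous_on UNIV (\<lambda>t. gexp (t *\<^sub>R (X :: real ^ 'n ^ 'n)))"
  using gexp_vector_derivative[of X] by (intro continuous_at_imp_continuous_on ballI has_vector_derivative_continuous)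

theorem corollary1p7:
  fixes G :: "(real ^ 'n ^ 'n) set" and \<rho> :: "real ^ 2 ^ 2 \<Rightarrow> real ^ 'n ^ 'n"
  assumes "real_reductive_group G"
    and "lie_group_hom_SL2R G \<rho>"
    and "even_nilpotent_hom G \<rho>"
  shows "\<exists>g\<^sub>0\<ge>2. \<forall>g\<ge>g\<^sub>0. \<forall>\<Gamma>.
           subgroup \<Gamma> SL2R \<and> discrete \<Gamma> \<and> SL2R\<lparr>carrier := \<Gamma>\<rparr> \<cong> surface_group g \<longrightarrow>
           (\<forall>U. openin (Hom_space \<Gamma> G) U \<and> restrict \<rho> \<Gamma> \<in> U \<longrightarrow>
              (\<exists>\<rho>'\<in>U. zariski_dense_in G (\<rho>' ` \<Gamma>)))"
proof -
  obtain H where H: "linear_algebraic_group H" "connectedin zariski H" "defined_over_reals H"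
    and G: "subgroup G GL" "openin (top_of_set (real_points H)) G"
    using assms(1) by (auto simp: real_reductive_group_def)
  obtain L where L: "sl2_hom \<rho> L" by (rule sl2_hom_exists[OF assms(2) G(1)])
  let ?K = "GL\<lparr>carrier := G\<rparr>"
  have K: "group ?K" by (rule subgroup.subgroup_is_group[OF G(1) group_GL])
  have \<rho>: "\<rho> \<in> hom SL2R ?K" using assms(2) by (simp add: lie_group_hom_SL2R_def)
  have \<rho>G: "\<rho> A \<in> G" if "det A = 1" for A using hom_in_carrier[OF \<rho>, of A] that by simp
  interpret sl2_hom \<rho> L by (rule L)
  interpret even_sl2_hom \<rho> L G
    by (rule even_sl2_hom.intro[OF L], rule even_sl2_hom_axioms.intro)
      (fact subspace_lie_algebra[OF H(1) G] G(1) \<rho>G assms(3))+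
  note Gd = GL_subgroupD[OF G(1)]
  \<comment> \<open>\<open>bending_data\<close> asks for \<open>4 * DIM + 1\<close>, the unit being
    the unbent first handle; one more makes \<open>g\<^sub>0 \<ge> 2\<close> evident.\<close>
  define g\<^sub>0 where "g\<^sub>0 = 4 * DIM(real ^ 'n ^ 'n) + 2"
  show ?thesis
  proof (intro exI[of _ g\<^sub>0] conjI allI impI)
    show "g\<^sub>0 \<ge> 2" by (simp add: g\<^sub>0_def)
    fix g \<Gamma> U
    assume g: "g\<^sub>0 \<le> g" and "subgroup \<Gamma> SL2R \<and> discrete \<Gamma> \<and> SL2R\<lparr>carrier := \<Gamma>\<rparr> \<cong> surface_group g"
      and U: "openin (Hom_space \<Gamma> G) U \<and> restrict \<rho> \<Gamma> \<in> U"
    then have \<Gamma>: "subgroup \<Gamma> SL2R" and disc: "discrete \<Gamma>" and iso: "SL2R\<lparr>carrier := \<Gamma>\<rparr> \<cong> surface_group g" by auto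
    have g2: "g \<ge> 2" "g \<ge> 4 * DIM(real ^ 'n ^ 'n) + 1" using g by (auto simp: g\<^sub>0_def)
    obtain \<alpha> where \<alpha>: "surface_gens g \<Gamma> \<alpha>" by (rule surface_gens_exist[OF \<Gamma> iso])
    obtain z where z0: "z 0 = 0" and zg: "\<And>i. z i \<in> lie_algebra G"
      and zc: "\<And>i. \<rho> (\<alpha> (2 * i)) ** z i = z i ** \<rho> (\<alpha> (2 * i))"
      and zT: "spreads g z"
      by (rule bending_data[OF \<alpha> \<Gamma> disc g2(2)]) (rule that)
    note \<alpha>det = gens_det[OF \<alpha> \<Gamma>] and \<alpha>in = gens_in[OF \<alpha> \<Gamma>]
    have im: "\<Gamma> = weval SL2R \<alpha> ` surface_words g" using \<alpha> unfolding surface_gens_def by blast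
    define y where "y \<epsilon> i = gexp (\<epsilon> *\<^sub>R z i)" for \<epsilon> i
    have yG: "y \<epsilon> i \<in> G" for \<epsilon> i using zg[of i] by (simp add: y_def lie_algebra_gexp)
    have yinv: "y \<epsilon> i ** y (- \<epsilon>) i = mat 1" "y (- \<epsilon>) i ** y \<epsilon> i = mat 1" for \<epsilon> i
      using gexp_inverse[of "\<epsilon> *\<^sub>R z i"] by (simp_all add: y_def)
    \<comment> \<open>Even indices are the \<open>a\<close> generators, which stay fixed; the
      \<open>b\<close> generator of handle \<open>i\<close> is bent by
      \<open>y \<epsilon> i\<close>.\<close>
    define x where "x \<epsilon> k = (if even k then \<rho> (\<alpha> k) else \<rho> (\<alpha> k) ** y \<epsilon> (k div 2))" for \<epsilon> k
    have xG: "x \<epsilon> k \<in> carrier ?K" if "k < 2 * g" for \<epsilon> k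
      using \<rho>G[OF \<alpha>det[OF that]] yG Gd(2) by (simp add: x_def)
    have \<rho>\<alpha>G: "\<rho> (\<alpha> k) \<in> carrier ?K" if "k < 2 * g" for k using \<rho>G[OF \<alpha>det[OF that]] by simp
    have Ks: "A \<otimes>\<^bsub>GL\<^esub> B = A ** B" "\<one>\<^bsub>GL\<^esub> = (mat 1 :: real ^ 'n ^ 'n)" for A B :: "real ^ 'n ^ 'n"
      by (simp_all add: GL_def)
    have invK: "A ** inv\<^bsub>?K\<^esub> A = mat 1" "inv\<^bsub>?K\<^esub> A ** A = mat 1" "inv\<^bsub>?K\<^esub> A \<in> G" if "A \<in> G" for A
      using group.r_inv[OF K, of A] group.l_inv[OF K, of A] group.inv_closed[OF K, of A] that by (simp_all add: Ks)
    have inv_y: "inv\<^bsub>?K\<^esub> (A ** y \<epsilon> i) = y (- \<epsilon>) i ** inv\<^bsub>?K\<^esub> A" if A: "A \<in> G" for A \<epsilon> i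
    proof (rule group.inv_equality[OF K])
      have "y (- \<epsilon>) i ** inv\<^bsub>?K\<^esub> A ** (A ** y \<epsilon> i) = y (- \<epsilon>) i ** (inv\<^bsub>?K\<^esub> A ** A) ** y \<epsilon> i"
        by (simp add: matrix_mul_assoc)
      then show "(y (- \<epsilon>) i ** inv\<^bsub>?K\<^esub> A) \<otimes>\<^bsub>?K\<^esub> (A ** y \<epsilon> i) = \<one>\<^bsub>?K\<^esub>"
        using invK[OF A] yinv by (simp add: Ks)
    qed (use A yG invK(3)[OF A] Gd(2) in auto)
    have rel: "weval ?K (x \<epsilon>) (surface_relator g) = \<one>\<^bsub>?K\<^esub>" for \<epsilon>
    proof -
      have "weval ?K (x \<epsilon>) (surface_relator g) = weval ?K (\<lambda>k. \<rho> (\<alpha> k)) (surface_relator g)"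
      proof (rule weval_relator_cong[OF K])
        fix i assume i: "i < g"
        let ?a = "\<rho> (\<alpha> (2 * i))" and ?b = "\<rho> (\<alpha> (2 * i + 1))"
        have a: "?a \<in> G" "?b \<in> G" using \<rho>\<alpha>G[of "2 * i"] \<rho>\<alpha>G[of "2 * i + 1"] i by auto
        \<comment> \<open>As \<open>y \<epsilon> i\<close> commutes with the image of
          \<open>a\<close>, it passes that inverse and meets its own inverse, so each commutator in
          the relator is unchanged.\<close>
        have comm: "y \<epsilon> i ** inv\<^bsub>?K\<^esub> ?a = inv\<^bsub>?K\<^esub> ?a ** y \<epsilon> i"
        proof -
          have "?a ** y \<epsilon> i = y \<epsilon> i ** ?a"
            unfolding y_def by (rule gexp_commute) (simp add: matmul_simps zc)
          then have "inv\<^bsub>?K\<^esub> ?a ** (?a ** y \<epsilon> i) ** inv\<^bsub>?K\<^esub> ?a = inv\<^bsub>?K\<^esub> ?a ** (y \<epsilon> i ** ?a) ** inv\<^bsub>?K\<^esub> ?a" by simp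
          then have "(inv\<^bsub>?K\<^esub> ?a ** ?a) ** y \<epsilon> i ** inv\<^bsub>?K\<^esub> ?a = inv\<^bsub>?K\<^esub> ?a ** y \<epsilon> i ** (?a ** inv\<^bsub>?K\<^esub> ?a)"
            by (simp only: matrix_mul_assoc)
          then show ?thesis using invK[OF a(1)] by simp
        qed
        have "?a ** (?b ** y \<epsilon> i ** (inv\<^bsub>?K\<^esub> ?a ** (y (- \<epsilon>) i ** inv\<^bsub>?K\<^esub> ?b)))
          = ?a ** ?b ** (y \<epsilon> i ** inv\<^bsub>?K\<^esub> ?a) ** y (- \<epsilon>) i ** inv\<^bsub>?K\<^esub> ?b" by (simp add: matrix_mul_assoc)
        also have "\<dots> = ?a ** ?b ** inv\<^bsub>?K\<^esub> ?a ** (y \<epsilon> i ** y (- \<epsilon>) i) ** inv\<^bsub>?K\<^esub> ?b"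
          unfolding comm by (simp add: matrix_mul_assoc)
        finally have "?a ** (?b ** y \<epsilon> i ** (inv\<^bsub>?K\<^esub> ?a ** (y (- \<epsilon>) i ** inv\<^bsub>?K\<^esub> ?b))) = ?a ** (?b ** (inv\<^bsub>?K\<^esub> ?a ** inv\<^bsub>?K\<^esub> ?b))"
          using yinv by (simp add: matrix_mul_assoc)
        then show "weval ?K (x \<epsilon>) [(2*i, True), (2*i+1, True), (2*i, False), (2*i+1, False)]
          = weval ?K (\<lambda>k. \<rho> (\<alpha> k)) [(2*i, True), (2*i+1, True), (2*i, False), (2*i+1, False)]"
          using inv_y[OF a(2), of \<epsilon> i] by (simp add: x_def Ks)
      qed (use xG \<rho>\<alpha>G in auto)
      also have "\<dots> = \<rho> (weval SL2R \<alpha> (surface_relator g))"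
        by (rule weval_hom[OF group_SL2R K \<rho> _ surface_relator_in_words]) (use \<alpha>det in simp)
      also have "weval SL2R \<alpha> (surface_relator g) = weval SL2R \<alpha> []"
      proof -
        have "([] @ surface_relator g @ [], [] @ []) \<in> surface_rel g" by (intro surface_rel.relator surface_words_Nil)
        then have "(surface_relator g, []) \<in> surface_rel g" by simp
        then show ?thesis using \<alpha> surface_relator_in_words[of g] surface_words_Nil[of g]
          unfolding surface_gens_def by blast
      qed
      finally show ?thesis by (simp add: hom_one Ks)
    qed
    have "\<exists>\<Phi>. \<Phi> \<in> hom (SL2R\<lparr>carrier := \<Gamma>\<rparr>) ?K \<and> (\<forall>u\<in>surface_words g. \<Phi> (weval SL2R \<alpha> u) = weval ?K (x \<epsilon>) u)" for \<epsilon>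
      by (rule surface_gens_hom[OF \<alpha> \<Gamma> K xG rel]) blast+
    then obtain \<Phi> where \<Phi>hom: "\<And>\<epsilon>. \<Phi> \<epsilon> \<in> hom (SL2R\<lparr>carrier := \<Gamma>\<rparr>) ?K"
      and \<Phi>: "\<And>\<epsilon> u. u \<in> surface_words g \<Longrightarrow> \<Phi> \<epsilon> (weval SL2R \<alpha> u) = weval ?K (x \<epsilon>) u" by metis
    define R where "R \<epsilon> = restrict (\<Phi> \<epsilon>) \<Gamma>" for \<epsilon>
    have R0: "R 0 = restrict \<rho> \<Gamma>"
    proof -
      have "\<Phi> 0 \<gamma> = \<rho> \<gamma>" if \<gamma>: "\<gamma> \<in> \<Gamma>" for \<gamma>
      proof -
        obtain u where u: "u \<in> surface_words g" "\<gamma> = weval SL2R \<alpha> u" using \<gamma> im by blast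
        have "x 0 = (\<lambda>k. \<rho> (\<alpha> k))" by (auto simp: x_def y_def gexp_zero)
        then have "\<Phi> 0 \<gamma> = weval ?K (\<lambda>k. \<rho> (\<alpha> k)) u" using \<Phi>[OF u(1), of 0] u(2) by simp
        also have "\<dots> = \<rho> \<gamma>" unfolding u(2)
          by (rule weval_hom[OF group_SL2R K \<rho> _ u(1)]) (use \<alpha>det in simp)
        finally show ?thesis .
      qed
      then show ?thesis unfolding R_def by (rule restrict_ext)
    qed
    have wc: "continuous_on UNIV (\<lambda>\<epsilon>. weval ?K (x \<epsilon>) u)" if "u \<in> surface_words g" for u
      using that
    proof (induction u)
      case (Cons l u)
      obtain k s where l: "l = (k, s)" by (cases l)
      have k: "k < 2 * g" and u: "u \<in> surface_words g" using Cons.prems unfolding l surface_words_Cons by auto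
      have yc: "continuous_on UNIV (\<lambda>\<epsilon>. y \<epsilon> i)" "continuous_on UNIV (\<lambda>\<epsilon>. y (- \<epsilon>) i)" for i
        using continuous_on_gexp[of "z i"] continuous_on_gexp[of "- z i"] by (simp_all add: y_def)
      have "continuous_on UNIV (\<lambda>\<epsilon>. if s then x \<epsilon> k else inv\<^bsub>?K\<^esub> (x \<epsilon> k))"
      proof (cases s; cases "even k")
        assume "\<not> s" "odd k"
        then show ?thesis using inv_y[of "\<rho> (\<alpha> k)"] \<rho>\<alpha>G[OF k]
          by (simp add: x_def) (intro continuous_on_matmul yc continuous_on_const)
      next
        assume "s" "odd k"
        then show ?thesis by (simp add: x_def) (intro continuous_on_matmul yc continuous_on_const)
      qed (simp_all add: x_def)
      then have "continuous_on UNIV (\<lambda>\<epsilon>. (if s then x \<epsilon> k else inv\<^bsub>?K\<^esub> (x \<epsilon> k)) ** weval ?K (x \<epsilon>) u)"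
        by (rule continuous_on_matmul[OF _ Cons.IH[OF u]])
      moreover have "weval ?K (x \<epsilon>) (l # u) = (if s then x \<epsilon> k else inv\<^bsub>?K\<^esub> (x \<epsilon> k)) ** weval ?K (x \<epsilon>) u" for \<epsilon>
        by (cases s) (simp_all add: l Ks)
      ultimately show ?case by (simp only:)
    qed simp
    \<comment> \<open>The bent representations form a path through the given one. Continuity is
      pointwise on \<open>\<Gamma>\<close>, hence a matter of single words.\<close>
    have "continuous_map euclideanreal (Hom_space \<Gamma> G) R"
      unfolding Hom_space_def
    proof (rule continuous_map_in_subtopology[THEN iffD2], intro conjI continuous_map_componentwise[THEN iffD2] ballI)
      show "R ` topspace euclideanreal \<subseteq> extensional \<Gamma>" by (auto simp: R_def)
      fix \<gamma> assume \<gamma>: "\<gamma> \<in> \<Gamma>"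
      then obtain u where u: "u \<in> surface_words g" "\<gamma> = weval SL2R \<alpha> u" using im by blast
      have "(\<lambda>\<epsilon>. R \<epsilon> \<gamma>) = (\<lambda>\<epsilon>. weval ?K (x \<epsilon>) u)" using \<gamma> \<Phi>[OF u(1)] u(2) by (simp add: R_def)
      moreover have "weval ?K (x \<epsilon>) u \<in> G" for \<epsilon> using weval_closed[of ?K g "x \<epsilon>", OF K _ u(1)] xG by simp
      ultimately show "continuous_map euclideanreal (top_of_set G) (\<lambda>\<epsilon>. R \<epsilon> \<gamma>)"
        using wc[OF u(1)] by (auto simp: continuous_map_in_subtopology)
    next
      have "R \<epsilon> \<in> hom (SL2R\<lparr>carrier := \<Gamma>\<rparr>) ?K" for \<epsilon>
      proof (rule homI)
        fix a b assume a: "a \<in> carrier (SL2R\<lparr>carrier := \<Gamma>\<rparr>)" and b: "b \<in> carrier (SL2R\<lparr>carrier := \<Gamma>\<rparr>)"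
        have "a \<otimes>\<^bsub>SL2R\<^esub> b \<in> \<Gamma>" using subgroup.m_closed[OF \<Gamma>, of a b] a b by simp
        then show "R \<epsilon> (a \<otimes>\<^bsub>SL2R\<lparr>carrier := \<Gamma>\<rparr>\<^esub> b) = R \<epsilon> a \<otimes>\<^bsub>?K\<^esub> R \<epsilon> b"
          using Group.hom_mult[OF \<Phi>hom a b, of \<epsilon>] a b by (simp add: R_def)
      next
        fix a assume a: "a \<in> carrier (SL2R\<lparr>carrier := \<Gamma>\<rparr>)"
        then show "R \<epsilon> a \<in> carrier ?K" using hom_in_carrier[OF \<Phi>hom a, of \<epsilon>] by (simp add: R_def)
      qed
      then show "R \<in> topspace euclideanreal \<rightarrow> hom (SL2R\<lparr>carrier := \<Gamma>\<rparr>) ?K" by auto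
    qed
    then have "openin euclideanreal {\<epsilon> \<in> topspace euclideanreal. R \<epsilon> \<in> U}"
      by (rule openin_continuous_map_preimage) (use U in blast)
    then have "open {\<epsilon>. R \<epsilon> \<in> U}" by simp
    moreover have "0 \<in> {\<epsilon>. R \<epsilon> \<in> U}" using R0 U by simp
    ultimately obtain d where d: "d > 0" "ball 0 d \<subseteq> {\<epsilon>. R \<epsilon> \<in> U}" by (meson open_contains_ball)
    define \<epsilon> where "\<epsilon> = d / 2"
    have \<epsilon>: "\<epsilon> \<noteq> 0" "R \<epsilon> \<in> U" using d by (auto simp: \<epsilon>_def subset_iff)
    have RS: "R \<epsilon> ` \<Gamma> = \<Phi> \<epsilon> ` \<Gamma>" by (auto simp: R_def)
    let ?S = "\<Phi> \<epsilon> ` \<Gamma>"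
    have m\<Gamma>: "a ** b \<in> \<Gamma>" if "a \<in> \<Gamma>" "b \<in> \<Gamma>" for a b using subgroup.m_closed[OF \<Gamma> that] by simp
    have \<Phi>m: "\<Phi> \<epsilon> (a ** b) = \<Phi> \<epsilon> a ** \<Phi> \<epsilon> b" if "a \<in> \<Gamma>" "b \<in> \<Gamma>" for a b
      using Group.hom_mult[OF \<Phi>hom, of a b \<epsilon>] that by (simp add: Ks)
    have one\<Gamma>: "mat 1 \<in> \<Gamma>" using subgroup.one_closed[OF \<Gamma>] by simp
    have \<Phi>1: "\<Phi> \<epsilon> (mat 1) = mat 1" using \<Phi>[OF surface_words_Nil, of \<epsilon>] by (simp add: Ks)
    have S: "?S \<subseteq> G" "mat 1 \<in> ?S" "\<And>A B. A \<in> ?S \<Longrightarrow> B \<in> ?S \<Longrightarrow> A ** B \<in> ?S"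
    proof -
      show "?S \<subseteq> G" using hom_in_carrier[OF \<Phi>hom, of _ \<epsilon>] by auto
      show "mat 1 \<in> ?S" using imageI[OF one\<Gamma>, of "\<Phi> \<epsilon>"] \<Phi>1 by simp
      fix A B assume "A \<in> ?S" "B \<in> ?S"
      then obtain a b where ab: "a \<in> \<Gamma>" "b \<in> \<Gamma>" "A = \<Phi> \<epsilon> a" "B = \<Phi> \<epsilon> b" by auto
      show "A ** B \<in> ?S" unfolding ab(3,4) \<Phi>m[OF ab(1,2), symmetric] by (rule imageI[OF m\<Gamma>[OF ab(1,2)]])
    qed
    let ?T = "cmat ` ?S"
    have T: "mult_closed ?T" by (rule mult_closed_cmat_image[OF S(2,3)])
    have T': "\<And>A B. A \<in> zclosure ?T \<Longrightarrow> B \<in> zclosure ?T \<Longrightarrow> A ** B \<in> zclosure ?T"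
      using mult_closed_zclosure[OF T] by (auto simp: mult_closed_def)
    have ST: "cmat (\<Phi> \<epsilon> \<gamma>) \<in> zclosure ?T" if "\<gamma> \<in> \<Gamma>" for \<gamma> 
      by (rule subsetD[OF zclosure_superset]) (intro imageI that)
    \<comment> \<open>Only for generators that are not bent; it gives the first handle the powers
      needed by \<open>handle_generates_SL2\<close>.\<close>
    have pow: "\<Phi> \<epsilon> (mat_pow (\<alpha> k) n) = \<rho> (mat_pow (\<alpha> k) n)" if k: "k < 2 * g" and xk: "x \<epsilon> k = \<rho> (\<alpha> k)" for k n
    proof (induction n)
      case 0
      then show ?case using \<Phi>1 hom_one by simp
    next
      case (Suc n)
      have "\<Phi> \<epsilon> (\<alpha> k) = \<rho> (\<alpha> k)"
        using \<Phi>[of "[(k, True)]" \<epsilon>] k by (simp add: surface_words_def Ks xk)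
      moreover have "det (mat_pow (\<alpha> k) n) = 1" using gens_pow_in[OF \<alpha> \<Gamma> k, of n] subgroup.subset[OF \<Gamma>] by auto
      ultimately show ?case using Suc \<Phi>m[OF \<alpha>in[OF k] gens_pow_in[OF \<alpha> \<Gamma> k, of n]] \<alpha>det[OF k]
        by (simp add: mat_pow_Suc sl2_hom.hom_mult[OF L])
    qed
    have SL: "cmat (\<rho> A) \<in> zclosure ?T" if A: "det A = 1" for A
    proof (rule handle_generates_SL2[OF \<alpha> \<Gamma> disc g2(1) T _ _ A])
      have x01: "x \<epsilon> 0 = \<rho> (\<alpha> 0)" "x \<epsilon> 1 = \<rho> (\<alpha> 1)" by (simp_all add: x_def y_def z0 gexp_zero)
      have k: "0 < 2 * g" "1 < 2 * g" using g2 by auto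
      show "cmat (\<rho> (mat_pow (\<alpha> 0) n)) \<in> zclosure ?T" for n
        using ST[OF gens_pow_in[OF \<alpha> \<Gamma> k(1), of n]] pow[OF k(1) x01(1)] by simp
      show "cmat (\<rho> (mat_pow (\<alpha> 1) n)) \<in> zclosure ?T" for n
        using ST[OF gens_pow_in[OF \<alpha> \<Gamma> k(2), of n]] pow[OF k(2) x01(2)] by simp
    qed
    \<comment> \<open>With the image of SL(2,R) in the closure, dividing the bent image of a
      \<open>b\<close> generator by the unbent one isolates \<open>y \<epsilon> i\<close>. The
      inverse is isolated separately, since the closure is only known to be closed under
      products.\<close>
    have yT: "cmat (y \<epsilon> i) \<in> zclosure ?T \<and> cmat (y (- \<epsilon>) i) \<in> zclosure ?T" if i: "i < g" for i
    proof -
      let ?k = "2 * i + 1"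
      have k: "?k < 2 * g" using i by simp
      obtain b where b: "det b = 1" "\<alpha> ?k ** b = mat 1" "b ** \<alpha> ?k = mat 1" using SL2R_inverse[OF \<alpha>det[OF k]] by blast
      have b\<Gamma>: "b \<in> \<Gamma>"
      proof -
        have "inv\<^bsub>SL2R\<^esub> (\<alpha> ?k) = b" using b \<alpha>det[OF k] by (intro SL2R_inv_eq)
        then show ?thesis using subgroup.m_inv_closed[OF \<Gamma> \<alpha>in[OF k]] by simp
      qed
      have \<rho>b: "\<rho> b ** \<rho> (\<alpha> ?k) = mat 1" "\<rho> (\<alpha> ?k) ** \<rho> b = mat 1" using rho_inverse b \<alpha>det[OF k] by auto
      have \<Phi>k: "\<Phi> \<epsilon> (\<alpha> ?k) = \<rho> (\<alpha> ?k) ** y \<epsilon> i"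
        using \<Phi>[of "[(?k, True)]" \<epsilon>] k by (simp add: surface_words_def Ks x_def)
      have "\<rho> b ** \<Phi> \<epsilon> (\<alpha> ?k) = y \<epsilon> i" unfolding \<Phi>k using \<rho>b by (simp add: matrix_mul_assoc)
      moreover have "cmat (\<rho> b) ** cmat (\<Phi> \<epsilon> (\<alpha> ?k)) \<in> zclosure ?T" by (intro T' SL b ST \<alpha>in k)
      ultimately have 1: "cmat (y \<epsilon> i) \<in> zclosure ?T" by (simp add: cmat_mult[symmetric])
      have "\<Phi> \<epsilon> b ** (\<rho> (\<alpha> ?k) ** y \<epsilon> i) = mat 1" using \<Phi>m[OF b\<Gamma> \<alpha>in[OF k]] b \<Phi>1 \<Phi>k by simp
      then have "\<Phi> \<epsilon> b ** \<rho> (\<alpha> ?k) ** (y \<epsilon> i ** y (- \<epsilon>) i) = y (- \<epsilon>) i" by (simp add: matrix_mul_assoc)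
      then have "\<Phi> \<epsilon> b ** \<rho> (\<alpha> ?k) = y (- \<epsilon>) i" using yinv by simp
      moreover have "cmat (\<Phi> \<epsilon> b) ** cmat (\<rho> (\<alpha> ?k)) \<in> zclosure ?T" by (intro T' SL \<alpha>det k ST b\<Gamma>)
      ultimately have "cmat (y (- \<epsilon>) i) \<in> zclosure ?T" by (simp add: cmat_mult[symmetric])
      with 1 show ?thesis by blast
    qed
    have "zariski_dense_in G ?S"
    proof (rule zariski_denseI_lie_algebra[OF H G S])
      fix X assume X: "X \<in> lie_algebra G"
      show "cmat X \<in> tangent ?T"
      proof (rule zT[unfolded spreads_def, rule_format, OF T \<epsilon>(1) _ _ X])
        show "cmat (\<rho> A) \<in> zclosure ?T" if "det A = 1" for A using that by (rule SL)
        show "cmat (gexp (\<epsilon> *\<^sub>R z i)) \<in> zclosure ?T \<and> cmat (gexp ((- \<epsilon>) *\<^sub>R z i)) \<in> zclosure ?T" if "i < g" for i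
          using yT[OF that] unfolding y_def .
      qed
    qed
    then show "\<exists>\<rho>'\<in>U. zariski_dense_in G (\<rho>' ` \<Gamma>)" by (intro bexI[OF _ \<epsilon>(2)]) (simp only: RS)
  qed
qed

end
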